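(* Let $A$ be a Koszul algebra with quadratic relation space $I_2=\ker(\mu_A|_{A_1\otimes A_1})$, let $B$ be a (one-generated) free algebra, and suppose $\tau:B\otimes A\to A\otimes B$ is a separable graded twisting map. Assume that $\pi_{A_0\otimes A_2\otimes B_1}(1\otimes\tau)(\tau_B\otimes 1)(B_1\otimes I_2)=0$. Then $A\otimes_\tau B$ is Koszul.
   Context: $\mathbb K$ is a field, $\otimes=\otimes_{\mathbb K}$. All graded algebras are $\mathbb N$-graded associative unital $\mathbb K$-algebras which are connected ($A_0=\mathbb K 1_A$) and locally finite dimensional. $\mu_A$ is the multiplication of $A$; $1_A$ (or $1$) also denotes an identity map. Tensor products of graded spaces are graded by $(V\otimes W)_m=\bigoplus_{k+l=m}V_k\otimes W_l$. A linear map is graded if it preserves degree. $A$ is one-generated if $T(A_1)\to A$ is surjective; a one-generated free algebra is $B=T(B_1)$ with generators in degree $1$. $A$ is Koszul if $\mathbb K=A/A_{+}$ (with $A_+=\bigoplus_{i>0}A_i$) has a resolution $\cdots\to P_1\to P_0\to\mathbb K\to 0$ with each $P_i$ a graded free left $A$-module generated in degree $i$. A graded twisting map is a graded linear map $\tau:B\otimes A\to A\otimes B$ with $\tau(1_B\otimes a)=a\otimes 1_B$, $\tau(b\otimes 1_A)=1_A\otimes b$ and $\tau(\mu_B\otimes\mu_A)=(\mu_A\otimes\mu_B)(1_A\otimes\tau\otimes 1_B)(\tau\otimes\tau)(1_B\otimes\tau\otimes 1_A)$. Then $A\otimes_\tau B$ is the graded associative algebra with underlying space $A\otimes B$ and multiplication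 $(\mu_A\otimes\mu_B)(1_A\otimes\tau\otimes 1_B)$. For $A,B$ one-generated, $\tau$ is separable if there is a vector space decomposition $B_1=B_1'\oplus B_1''$ such that $\tau(B_1'\otimes A_1)\subset A_2\otimes B_0\oplus A_1\otimes B_1'$ and $\tau(B_1''\otimes A_1)\subset A_1\otimes B_1''\oplus A_0\otimes\mu_B(B_1\otimes B_1'')$. $\pi_X$ denotes the canonical projection onto the indicated graded summand $X$, and $\tau_B=\pi_{A_0\otimes B_2}\circ\tau|_{B_1\otimes A_1}$. The composite in the hypothesis is $B_1\otimes A_1\otimes A_1\to A_0\otimes B_2\otimes A_1\to A_0\otimes A\otimes B\to A_0\otimes A_2\otimes B_1$. *)

theory Defs
  imports Main "HOL.Vector_Spaces" "HOL-Library.Function_Algebras"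
begin

section \<open>Graded vector spaces\<close>

text \<open>
  The ground field is a type \<open>'k::field\<close>.  A graded vector space lives inside an ambient
  vector space, the type \<open>'v\<close> with scalar multiplication \<open>scl\<close>; its underlying space \<open>car\<close>
  is the (internal) direct sum of its homogeneous components and may be a proper subspace of
  the ambient space.
\<close>

record ('k, 'v) gspace =
  scl :: "'k \<Rightarrow> 'v \<Rightarrow> 'v"
  gr :: "nat \<Rightarrow> 'v set"

definition car :: "('k::field, 'v::ab_group_add, 'z) gspace_scheme \<Rightarrow> 'v set" where
  "car V = module.span (scl V) (\<Union>n. gr V n)"

locale graded_space =
  fixes V :: "('k::field, 'v::ab_group_add, 'z) gspace_scheme"
  assumes vector_space: "vector_space (scl V)"
    and subspace_comp: "\<And>n. module.subspace (scl V) (gr V n)"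
    and independent_comp: "\<And>f N n. \<lbrakk>finite N; \<And>m. m \<in> N \<Longrightarrow> f m \<in> gr V m; sum f N = 0; n \<in> N\<rbrakk>
           \<Longrightarrow> f n = 0"

text \<open>The projection \<open>hcomp V n\<close> of \<open>car V\<close> onto its summand \<open>gr V n\<close>.\<close>

definition hcomp :: "('k::field, 'v::ab_group_add, 'z) gspace_scheme \<Rightarrow> nat \<Rightarrow> 'v \<Rightarrow> 'v" where
  "hcomp V n v = (THE u. \<exists>f N. finite N \<and> (\<forall>m. f m \<in> gr V m) \<and> (\<forall>m. m \<notin> N \<longrightarrow> f m = 0)
                          \<and> v = sum f N \<and> u = f n)"

definition linear_on ::
    "'v set \<Rightarrow> ('k::field \<Rightarrow> 'v::ab_group_add \<Rightarrow> 'v) \<Rightarrow> ('k \<Rightarrow> 'w::ab_group_add \<Rightarrow> 'w) \<Rightarrow> ('v \<Rightarrow> 'w) \<Rightarrow> bool"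
  where "linear_on S s1 s2 f \<longleftrightarrow>
    (\<forall>x\<in>S. \<forall>y\<in>S. f (x + y) = f x + f y) \<and> (\<forall>c. \<forall>x\<in>S. f (s1 c x) = s2 c (f x))"

definition graded_linear ::
    "('k::field, 'v::ab_group_add, 'y) gspace_scheme \<Rightarrow> ('k, 'w::ab_group_add, 'z) gspace_scheme
     \<Rightarrow> ('v \<Rightarrow> 'w) \<Rightarrow> bool"
  where "graded_linear V W f \<longleftrightarrow>
    linear_on (car V) (scl V) (scl W) f \<and> (\<forall>n. f ` gr V n \<subseteq> gr W n)"


section \<open>Tensor products\<close>

text \<open>
  \<open>V \<otimes> W\<close> is realised inside the dual of the space of bilinear forms on the two ambient spaces:
  \<open>v \<otimes> w\<close> is evaluation at \<open>(v, w)\<close>, and \<open>V \<otimes> W\<close> is the span of these evaluations.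
  Lemma \<open>tensor_universal\<close> below is the universal property.
\<close>

type_synonym ('k, 'v, 'w) tensor = "('v \<Rightarrow> 'w \<Rightarrow> 'k) \<Rightarrow> 'k"

definition fscale :: "'k::field \<Rightarrow> ('x \<Rightarrow> 'k) \<Rightarrow> 'x \<Rightarrow> 'k" where
  "fscale c f = (\<lambda>x. c * f x)"

definition bilinear_form ::
    "('k::field \<Rightarrow> 'v::ab_group_add \<Rightarrow> 'v) \<Rightarrow> ('k \<Rightarrow> 'w::ab_group_add \<Rightarrow> 'w) \<Rightarrow> ('v \<Rightarrow> 'w \<Rightarrow> 'k) \<Rightarrow> bool"
  where "bilinear_form s1 s2 \<phi> \<longleftrightarrow>
    (\<forall>w. Vector_Spaces.linear s1 (*) (\<lambda>v. \<phi> v w)) \<and> (\<forall>v. Vector_Spaces.linear s2 (*) (\<phi> v))"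

definition pure ::
    "('k::field, 'v::ab_group_add, 'y) gspace_scheme \<Rightarrow> ('k, 'w::ab_group_add, 'z) gspace_scheme
     \<Rightarrow> 'v \<Rightarrow> 'w \<Rightarrow> ('k, 'v, 'w) tensor"
  where "pure V W v w = (\<lambda>\<phi>. if bilinear_form (scl V) (scl W) \<phi> then \<phi> v w else 0)"

text \<open>The subspace \<open>S \<otimes> T\<close> of \<open>V \<otimes> W\<close> for subspaces \<open>S\<close> of \<open>V\<close> and \<open>T\<close> of \<open>W\<close>.\<close>

definition tensor_sub ::
    "('k::field, 'v::ab_group_add, 'y) gspace_scheme \<Rightarrow> ('k, 'w::ab_group_add, 'z) gspace_scheme
     \<Rightarrow> 'v set \<Rightarrow> 'w set \<Rightarrow> ('k, 'v, 'w) tensor set"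
  where "tensor_sub V W S T = module.span fscale {pure V W v w | v w. v \<in> S \<and> w \<in> T}"

definition tensor ::
    "('k::field, 'v::ab_group_add, 'y) gspace_scheme \<Rightarrow> ('k, 'w::ab_group_add, 'z) gspace_scheme
     \<Rightarrow> ('k, ('k, 'v, 'w) tensor) gspace"  (infixr "\<otimes>" 70)
  where "V \<otimes> W =
    \<lparr>scl = fscale,
     gr = (\<lambda>m. module.span fscale (\<Union>k\<le>m. tensor_sub V W (gr V k) (gr W (m - k))))\<rparr>"

text \<open>
  \<open>tensor_lift V W Z h\<close> is the linear map \<open>V \<otimes> W \<rightarrow> Z\<close> induced by a map \<open>h\<close> that is bilinear on
  \<open>car V \<times> car W\<close>.  It is determined on \<open>car (V \<otimes> W)\<close>; off that subspace it is an arbitrary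
  linear extension.
\<close>

definition tensor_lift ::
    "('k::field, 'v::ab_group_add, 'x) gspace_scheme \<Rightarrow> ('k, 'w::ab_group_add, 'y) gspace_scheme
     \<Rightarrow> ('k, 'u::ab_group_add, 'z) gspace_scheme \<Rightarrow> ('v \<Rightarrow> 'w \<Rightarrow> 'u) \<Rightarrow> ('k, 'v, 'w) tensor \<Rightarrow> 'u"
  where "tensor_lift V W Z h =
    (SOME L. Vector_Spaces.linear fscale (scl Z) L \<and>
             (\<forall>v\<in>car V. \<forall>w\<in>car W. L (pure V W v w) = h v w))"

lemma vector_space_fscale: "vector_space (fscale :: 'k::field \<Rightarrow> ('x \<Rightarrow> 'k) \<Rightarrow> 'x \<Rightarrow> 'k)"
  by unfold_locales (auto simp: fscale_def fun_eq_iff algebra_simps)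

lemma pure_add_left:
  "pure V W (v + v') w = pure V W v w + pure V W v' w"
  by (auto simp: pure_def fun_eq_iff bilinear_form_def Vector_Spaces.linear_iff)

lemma pure_add_right:
  "pure V W v (w + w') = pure V W v w + pure V W v w'"
  by (auto simp: pure_def fun_eq_iff bilinear_form_def Vector_Spaces.linear_iff)

lemma pure_scale_left: "pure V W (scl V c v) w = fscale c (pure V W v w)"
  by (auto simp: pure_def fun_eq_iff bilinear_form_def Vector_Spaces.linear_iff fscale_def)

lemma pure_scale_right: "pure V W v (scl W c w) = fscale c (pure V W v w)"
  by (auto simp: pure_def fun_eq_iff bilinear_form_def Vector_Spaces.linear_iff fscale_def)

lemma subspace_linear_eq:
  assumes a: "vector_space s1" and b: "vector_space s2" and S: "module.subspace s1 S" and f: "linear_on S s1 s2 f" and g: "linear_on S s1 s2 g"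
  shows "module.subspace s1 {v \<in> S. f v = g v}"
proof -
  interpret a: vector_space s1 by fact
  interpret b: vector_space s2 by fact
  have z: "h 0 = 0" if h: "linear_on S s1 s2 h" for h
  proof -
    have "h (s1 0 0) = s2 0 (h 0)" using h a.subspace_0[OF S] unfolding linear_on_def by blast
    then show ?thesis by simp
  qed
  show ?thesis
  proof (rule a.subspaceI)
    show "0 \<in> {v \<in> S. f v = g v}" using z[OF f] z[OF g] a.subspace_0[OF S] by simp
  next
    fix x y assume "x \<in> {v \<in> S. f v = g v}" "y \<in> {v \<in> S. f v = g v}"
    then show "x + y \<in> {v \<in> S. f v = g v}"
      using f g a.subspace_add[OF S] by (simp add: linear_on_def)
  next
    fix c x assume "x \<in> {v \<in> S. f v = g v}"
    then show "s1 c x \<in> {v \<in> S. f v = g v}"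
      using f g a.subspace_scale[OF S] by (simp add: linear_on_def)
  qed
qed

lemma linear_on_if_linear: "Vector_Spaces.linear s1 s2 f \<Longrightarrow> linear_on S s1 s2 f"
  by (simp add: linear_on_def Vector_Spaces.linear_iff)

lemma pure_basis_independent:
  fixes V :: "('k::field, 'v::ab_group_add, 'y) gspace_scheme"
    and W :: "('k, 'w::ab_group_add, 'z) gspace_scheme"
  assumes V: "vector_space (scl V)" and W: "vector_space (scl W)"
    and X: "\<not> module.dependent (scl V) X" and Y: "\<not> module.dependent (scl W) Y"
  shows "inj_on (\<lambda>(x, y). pure V W x y) (X \<times> Y)"
    and "\<not> module.dependent fscale ((\<lambda>(x, y). pure V W x y) ` (X \<times> Y))"
proof -
  interpret V: vector_space "scl V" by fact
  interpret W: vector_space "scl W" by fact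
  interpret T: vector_space "fscale :: 'k \<Rightarrow> ('k, 'v, 'w) tensor \<Rightarrow> _" by (rule vector_space_fscale)
  define X' where "X' = V.extend_basis X"
  define Y' where "Y' = W.extend_basis Y"
  have X': "V.independent X'" "V.span X' = UNIV" "X \<subseteq> X'"
    using X unfolding X'_def by (auto simp: V.independent_extend_basis V.extend_basis_superset)
  have Y': "W.independent Y'" "W.span Y' = UNIV" "Y \<subseteq> Y'"
    using Y unfolding Y'_def by (auto simp: W.independent_extend_basis W.extend_basis_superset)
  define \<phi> where "\<phi> x y = (\<lambda>v w. V.representation X' v x * W.representation Y' w y)" for x y
  have lin: "Vector_Spaces.linear (scl V) (*) (\<lambda>v. V.representation X' v x)"
            "Vector_Spaces.linear (scl W) (*) (\<lambda>w. W.representation Y' w y)" for x y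
    by (rule V.linear_representation[OF X'(1,2)], rule W.linear_representation[OF Y'(1,2)])
  have bil: "bilinear_form (scl V) (scl W) (\<phi> x y)" for x y
    using lin unfolding bilinear_form_def \<phi>_def
    by (auto simp: Vector_Spaces.linear_iff algebra_simps)
  have ev: "pure V W x' y' (\<phi> x y) = (if x' = x \<and> y' = y then 1 else 0)"
    if "x' \<in> X" "y' \<in> Y" "x \<in> X" "y \<in> Y" for x y x' y'
    using that X'(1,3) Y'(1,3) bil[of x y]
    by (auto simp: pure_def \<phi>_def V.representation_basis W.representation_basis subset_iff)
  show inj: "inj_on (\<lambda>(x, y). pure V W x y) (X \<times> Y)"
  proof (rule inj_onI, clarify)
    fix x y x' y' assume a: "x \<in> X" "y \<in> Y" "x' \<in> X" "y' \<in> Y" "pure V W x y = pure V W x' y'"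
    have "pure V W x y (\<phi> x y) = 1" by (simp only: ev a(1,2) if_True simp_thms)
    then have "(if x' = x \<and> y' = y then 1 else 0) = (1 :: 'k)"
      unfolding a(5) by (simp only: ev a(1-4))
    then show "x = x' \<and> y = y'" by (simp split: if_splits)
  qed
  show "T.independent ((\<lambda>(x, y). pure V W x y) ` (X \<times> Y))"
    proof
    assume "T.dependent ((\<lambda>(x, y). pure V W x y) ` (X \<times> Y))"
    then obtain t u where tu: "finite t \<and> t \<subseteq> (\<lambda>(x, y). pure V W x y) ` (X \<times> Y)
        \<and> (\<Sum>v\<in>t. fscale (u v) v) = 0 \<and> (\<exists>v\<in>t. u v \<noteq> 0)"
      unfolding T.dependent_explicit by (elim exE)
    then obtain v where t: "finite t" "t \<subseteq> (\<lambda>(x, y). pure V W x y) ` (X \<times> Y)"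
        "(\<Sum>v\<in>t. fscale (u v) v) = 0" "v \<in> t" and nz: "u v \<noteq> 0"
      by (elim conjE bexE)
    from t obtain x y where xy: "v = pure V W x y" "x \<in> X" "y \<in> Y" by auto
    have "0 = (\<Sum>v\<in>t. fscale (u v) v) (\<phi> x y)" unfolding t(3) by simp
    also have "\<dots> = (\<Sum>v'\<in>t. u v' * v' (\<phi> x y))"
      using t(1) by (induction t rule: finite_induct) (auto simp: fscale_def)
    also have "\<dots> = (\<Sum>v'\<in>t. if v' = v then u v' else 0)"
    proof (rule sum.cong)
      fix v' assume "v' \<in> t"
      then obtain x' y' where v': "v' = pure V W x' y'" "x' \<in> X" "y' \<in> Y" using t(2) by auto
      have A: "v' (\<phi> x y) = (if x' = x \<and> y' = y then 1 else 0)" unfolding v'(1) by (intro ev v' xy)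
      have B: "v' = v \<longleftrightarrow> x' = x \<and> y' = y"
      proof
        assume "v' = v"
        then have "(\<lambda>(x, y). pure V W x y) (x', y') = (\<lambda>(x, y). pure V W x y) (x, y)"
          by (simp only: v'(1) xy(1) prod.case)
        then have "(x', y') = (x, y)" by (rule inj_onD[OF inj]) (simp_all only: v' xy mem_Times_iff fst_conv snd_conv)
        then show "x' = x \<and> y' = y" by (simp only: prod.inject)
      next
        assume "x' = x \<and> y' = y"
        then show "v' = v" by (simp only: v'(1) xy(1))
      qed
      show "u v' * v' (\<phi> x y) = (if v' = v then u v' else 0)"
        unfolding A B by simp
    qed simp
    also have "\<dots> = u v" using t(1,4) by simp
    finally show False using nz by simp
  qed
qed

lemma car_subspace: "vector_space (scl V) \<Longrightarrow> module.subspace (scl V) (car V)"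
  unfolding car_def by (simp add: module.subspace_span module_iff_vector_space)

theorem tensor_universal:
  fixes V :: "('k::field, 'v::ab_group_add, 'x) gspace_scheme"
    and W :: "('k, 'w::ab_group_add, 'y) gspace_scheme"
    and Z :: "('k, 'u::ab_group_add, 'z) gspace_scheme"
  assumes V: "vector_space (scl V)" and W: "vector_space (scl W)" and Z: "vector_space (scl Z)"
    and h1: "\<And>w. w \<in> car W \<Longrightarrow> linear_on (car V) (scl V) (scl Z) (\<lambda>v. h v w)"
    and h2: "\<And>v. v \<in> car V \<Longrightarrow> linear_on (car W) (scl W) (scl Z) (h v)"
  shows "Vector_Spaces.linear fscale (scl Z) (tensor_lift V W Z h)"
    and "\<lbrakk>v \<in> car V; w \<in> car W\<rbrakk> \<Longrightarrow> tensor_lift V W Z h (pure V W v w) = h v w"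
proof -
  interpret V: vector_space "scl V" by fact
  interpret W: vector_space "scl W" by fact
  interpret Z: vector_space "scl Z" by fact
  interpret T: vector_space "fscale :: 'k \<Rightarrow> ('k, 'v, 'w) tensor \<Rightarrow> _" by (rule vector_space_fscale)
  interpret TZ: vector_space_pair "fscale :: 'k \<Rightarrow> ('k, 'v, 'w) tensor \<Rightarrow> _" "scl Z" ..
  obtain X where X: "X \<subseteq> car V" "V.independent X" "car V \<subseteq> V.span X"
    using V.maximal_independent_subset[of "car V"] by blast
  obtain Y where Y: "Y \<subseteq> car W" "W.independent Y" "car W \<subseteq> W.span Y"
    using W.maximal_independent_subset[of "car W"] by blast
  let ?e = "\<lambda>(x, y). pure V W x y"
  note ind = pure_basis_independent[OF V W X(2) Y(2)]
  obtain L where L: "Vector_Spaces.linear fscale (scl Z) L"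
      "\<And>t. t \<in> ?e ` (X \<times> Y) \<Longrightarrow> L t = (\<lambda>(x, y). h x y) (the_inv_into (X \<times> Y) ?e t)"
    using TZ.linear_independent_extend[OF ind(2),
        of "\<lambda>t. (\<lambda>(x, y). h x y) (the_inv_into (X \<times> Y) ?e t)"] by blast
  have Lxy: "L (pure V W x y) = h x y" if "x \<in> X" "y \<in> Y" for x y
    using L(2)[of "pure V W x y"] the_inv_into_f_f[OF ind(1), of "(x, y)"] that by force
  have L1: "linear_on S (scl V) (scl Z) (\<lambda>v. L (pure V W v w))" for S w
    using L(1) by (auto simp: linear_on_def Vector_Spaces.linear_iff pure_add_left pure_scale_left)
  have L2: "linear_on S (scl W) (scl Z) (\<lambda>w. L (pure V W v w))" for S v
    using L(1) by (auto simp: linear_on_def Vector_Spaces.linear_iff pure_add_right pure_scale_right)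
  have s1: "L (pure V W v y) = h v y" if "v \<in> car V" "y \<in> Y" for v y
  proof -
    have "V.span X \<subseteq> {v \<in> car V. L (pure V W v y) = h v y}"
      using X(1) Y(1) that Lxy
      by (intro V.span_minimal subspace_linear_eq[OF V Z car_subspace[OF V] L1 h1]) auto
    then show ?thesis using that X(3) by auto
  qed
  have s2: "L (pure V W v w) = h v w" if "v \<in> car V" "w \<in> car W" for v w
  proof -
    have "W.span Y \<subseteq> {w \<in> car W. L (pure V W v w) = h v w}"
      using Y(1) that s1
      by (intro W.span_minimal subspace_linear_eq[OF W Z car_subspace[OF W] L2 h2]) auto
    then show ?thesis using that Y(3) by auto
  qed
  have "\<exists>L. Vector_Spaces.linear fscale (scl Z) L \<and>
             (\<forall>v\<in>car V. \<forall>w\<in>car W. L (pure V W v w) = h v w)"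
    using L(1) s2 by blast
  then have *: "Vector_Spaces.linear fscale (scl Z) (tensor_lift V W Z h) \<and>
             (\<forall>v\<in>car V. \<forall>w\<in>car W. tensor_lift V W Z h (pure V W v w) = h v w)"
    unfolding tensor_lift_def by (rule someI_ex)
  show "Vector_Spaces.linear fscale (scl Z) (tensor_lift V W Z h)"
    using * by blast
  show "tensor_lift V W Z h (pure V W v w) = h v w" if "v \<in> car V" "w \<in> car W"
    using * that by blast
qed

lemma car_tensor:
  fixes V :: "('k::field, 'v::ab_group_add, 'x) gspace_scheme"
    and W :: "('k, 'w::ab_group_add, 'y) gspace_scheme"
  assumes V: "vector_space (scl V)" and W: "vector_space (scl W)"
  shows "car (V \<otimes> W) = tensor_sub V W (car V) (car W)"
proof -
  interpret V: vector_space "scl V" by fact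
  interpret W: vector_space "scl W" by fact
  interpret T: vector_space "fscale :: 'k \<Rightarrow> ('k, 'v, 'w) tensor \<Rightarrow> _" by (rule vector_space_fscale)
  have sc: "scl (V \<otimes> W) = fscale" by (simp add: tensor_def)
  have sub: "gr V k \<subseteq> car V" "gr W k \<subseteq> car W" for k
    unfolding car_def by (auto intro: V.span_base W.span_base)
  have le: "car (V \<otimes> W) \<subseteq> tensor_sub V W (car V) (car W)"
    unfolding car_def[of "V \<otimes> W"] sc
  proof (rule T.span_minimal)
    have "tensor_sub V W (gr V k) (gr W l) \<subseteq> tensor_sub V W (car V) (car W)" for k l
      unfolding tensor_sub_def by (rule T.span_mono) (use sub in blast)
    then have "gr (V \<otimes> W) m \<subseteq> tensor_sub V W (car V) (car W)" for m
      unfolding tensor_def gspace.simps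
      by (intro T.span_minimal UN_least) (simp_all add: tensor_sub_def)
    then show "(\<Union>n. gr (V \<otimes> W) n) \<subseteq> tensor_sub V W (car V) (car W)" by blast
  qed (simp add: tensor_sub_def)
  have sc2: "module.subspace fscale (car (V \<otimes> W))"
    using car_subspace[of "V \<otimes> W"] T.vector_space_axioms by (simp add: sc)
  have subl: "V.subspace {v. pure V W v w \<in> car (V \<otimes> W)}" for w
  proof (rule V.subspaceI)
    have "pure V W 0 w = 0" using pure_scale_left[of V W 0 0 w] by simp
    then show "0 \<in> {v. pure V W v w \<in> car (V \<otimes> W)}" using T.subspace_0[OF sc2] by simp
  qed (auto simp: pure_add_left pure_scale_left T.subspace_add[OF sc2] T.subspace_scale[OF sc2])
  have subr: "W.subspace {w. pure V W v w \<in> car (V \<otimes> W)}" for v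
  proof (rule W.subspaceI)
    have "pure V W v 0 = 0" using pure_scale_right[of V W v 0 0] by simp
    then show "0 \<in> {w. pure V W v w \<in> car (V \<otimes> W)}" using T.subspace_0[OF sc2] by simp
  qed (auto simp: pure_add_right pure_scale_right T.subspace_add[OF sc2] T.subspace_scale[OF sc2])
  have p: "pure V W v w \<in> car (V \<otimes> W)" if "v \<in> gr V k" "w \<in> gr W l" for v w k l
  proof -
    have "pure V W v w \<in> tensor_sub V W (gr V k) (gr W (k + l - k))"
      unfolding tensor_sub_def by (rule T.span_base) (use that in auto)
    then have "pure V W v w \<in> gr (V \<otimes> W) (k + l)"
      unfolding tensor_def by (auto intro!: T.span_base bexI[of _ k])
    then show ?thesis unfolding car_def sc by (auto intro: T.span_base)
  qed
  have p1: "pure V W v w \<in> car (V \<otimes> W)" if "v \<in> car V" "w \<in> gr W l" for v w l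
  proof -
    have "car V \<subseteq> {v. pure V W v w \<in> car (V \<otimes> W)}" unfolding car_def[of V]
      using p that(2)
      by (intro V.span_minimal subl) auto
    then show ?thesis using that by auto
  qed
  have p2: "pure V W v w \<in> car (V \<otimes> W)" if "v \<in> car V" "w \<in> car W" for v w
  proof -
    have "car W \<subseteq> {w. pure V W v w \<in> car (V \<otimes> W)}" unfolding car_def[of W]
      using p1 that(1)
      by (intro W.span_minimal subr) auto
    then show ?thesis using that by auto
  qed
  have "tensor_sub V W (car V) (car W) \<subseteq> car (V \<otimes> W)"
    unfolding tensor_sub_def by (rule T.span_minimal) (use p2 sc2 in auto)
  with le show ?thesis by blast
qed

lemma tensor_eqI:
  fixes V :: "('k::field, 'v::ab_group_add, 'x) gspace_scheme"
    and W :: "('k, 'w::ab_group_add, 'y) gspace_scheme"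
  assumes V: "vector_space (scl V)" and W: "vector_space (scl W)" and Z: "vector_space s"
    and L: "linear_on (car (V \<otimes> W)) fscale s L" and L': "linear_on (car (V \<otimes> W)) fscale s L'"
    and eq: "\<And>v w. \<lbrakk>v \<in> car V; w \<in> car W\<rbrakk> \<Longrightarrow> L (pure V W v w) = L' (pure V W v w)"
    and t: "t \<in> car (V \<otimes> W)"
  shows "L t = L' t"
proof -
  interpret T: vector_space "fscale :: 'k \<Rightarrow> ('k, 'v, 'w) tensor \<Rightarrow> _" by (rule vector_space_fscale)
  have "module.subspace fscale {t \<in> car (V \<otimes> W). L t = L' t}"
    using subspace_linear_eq[OF vector_space_fscale Z _ L L'] car_subspace[of "V \<otimes> W"]
    by (simp add: tensor_def vector_space_fscale)
  then have "tensor_sub V W (car V) (car W) \<subseteq> {t \<in> car (V \<otimes> W). L t = L' t}"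
    unfolding tensor_sub_def using eq
    by (intro T.span_minimal) (auto simp: car_tensor[OF V W] tensor_sub_def intro!: T.span_base)
  then show ?thesis using t car_tensor[OF V W] by auto
qed

text \<open>\<open>f \<otimes> g : V \<otimes> W \<rightarrow> V' \<otimes> W'\<close>.\<close>

definition tensor_map ::
    "('k::field, 'v::ab_group_add, 'x) gspace_scheme \<Rightarrow> ('k, 'w::ab_group_add, 'y) gspace_scheme
     \<Rightarrow> ('k, 'v'::ab_group_add, 'x') gspace_scheme \<Rightarrow> ('k, 'w'::ab_group_add, 'y') gspace_scheme
     \<Rightarrow> ('v \<Rightarrow> 'v') \<Rightarrow> ('w \<Rightarrow> 'w') \<Rightarrow> ('k, 'v, 'w) tensor \<Rightarrow> ('k, 'v', 'w') tensor"
  where "tensor_map V W V' W' f g =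
    tensor_lift V W (V' \<otimes> W') (\<lambda>v w. pure V' W' (f v) (g w))"

text \<open>\<open>(U \<otimes> V) \<otimes> W \<rightarrow> U \<otimes> (V \<otimes> W)\<close> and its inverse.\<close>

definition assoc ::
    "('k::field, 'u::ab_group_add, 'x) gspace_scheme \<Rightarrow> ('k, 'v::ab_group_add, 'y) gspace_scheme
     \<Rightarrow> ('k, 'w::ab_group_add, 'z) gspace_scheme
     \<Rightarrow> ('k, ('k, 'u, 'v) tensor, 'w) tensor \<Rightarrow> ('k, 'u, ('k, 'v, 'w) tensor) tensor"
  where "assoc U V W =
    tensor_lift (U \<otimes> V) W (U \<otimes> V \<otimes> W)
      (\<lambda>s w. tensor_lift U V (U \<otimes> V \<otimes> W) (\<lambda>u v. pure U (V \<otimes> W) u (pure V W v w)) s)"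

definition assoc_inv ::
    "('k::field, 'u::ab_group_add, 'x) gspace_scheme \<Rightarrow> ('k, 'v::ab_group_add, 'y) gspace_scheme
     \<Rightarrow> ('k, 'w::ab_group_add, 'z) gspace_scheme
     \<Rightarrow> ('k, 'u, ('k, 'v, 'w) tensor) tensor \<Rightarrow> ('k, ('k, 'u, 'v) tensor, 'w) tensor"
  where "assoc_inv U V W =
    tensor_lift U (V \<otimes> W) ((U \<otimes> V) \<otimes> W)
      (\<lambda>u t. tensor_lift V W ((U \<otimes> V) \<otimes> W) (\<lambda>v w. pure (U \<otimes> V) W (pure U V u v) w) t)"

text \<open>
  \<open>1 \<otimes> f \<otimes> 1\<close> for \<open>f : Y \<otimes> Z \<rightarrow> Y' \<otimes> Z'\<close>, with the fourfold tensor products bracketed in pairs: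
  \<open>(X \<otimes> Y) \<otimes> (Z \<otimes> W) \<rightarrow> (X \<otimes> Y') \<otimes> (Z' \<otimes> W)\<close>.
\<close>

definition middle_map ::
    "('k::field, 'x::ab_group_add, 'x0) gspace_scheme \<Rightarrow> ('k, 'y::ab_group_add, 'y0) gspace_scheme
     \<Rightarrow> ('k, 'z::ab_group_add, 'z0) gspace_scheme \<Rightarrow> ('k, 'w::ab_group_add, 'w0) gspace_scheme
     \<Rightarrow> ('k, 'y'::ab_group_add, 'y1) gspace_scheme \<Rightarrow> ('k, 'z'::ab_group_add, 'z1) gspace_scheme
     \<Rightarrow> (('k, 'y, 'z) tensor \<Rightarrow> ('k, 'y', 'z') tensor)
     \<Rightarrow> ('k, ('k, 'x, 'y) tensor, ('k, 'z, 'w) tensor) tensor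
     \<Rightarrow> ('k, ('k, 'x, 'y') tensor, ('k, 'z', 'w) tensor) tensor"
  where "middle_map X Y Z W Y' Z' f =
    (let T = (X \<otimes> Y') \<otimes> (Z' \<otimes> W) in
     tensor_lift (X \<otimes> Y) (Z \<otimes> W) T (\<lambda>s t.
       tensor_lift X Y T (\<lambda>x y.
         tensor_lift Z W T (\<lambda>z w.
           tensor_lift Y' Z' T (\<lambda>y' z'. pure (X \<otimes> Y') (Z' \<otimes> W) (pure X Y' x y') (pure Z' W z' w))
             (f (pure Y Z y z))) t) s))"


section \<open>Graded algebras\<close>

record ('k, 'v) galg = "('k, 'v) gspace" +
  mult :: "'v \<Rightarrow> 'v \<Rightarrow> 'v"
  unit :: "'v"

locale connected_graded_algebra = graded_space A
  for A :: "('k::field, 'a::ab_group_add) galg" +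
  assumes distrib_left: "\<lbrakk>x \<in> car A; y \<in> car A; z \<in> car A\<rbrakk>
             \<Longrightarrow> mult A x (y + z) = mult A x y + mult A x z"
    and distrib_right: "\<lbrakk>x \<in> car A; y \<in> car A; z \<in> car A\<rbrakk>
             \<Longrightarrow> mult A (x + y) z = mult A x z + mult A y z"
    and scale_mult_left: "\<lbrakk>x \<in> car A; y \<in> car A\<rbrakk> \<Longrightarrow> mult A (scl A c x) y = scl A c (mult A x y)"
    and scale_mult_right: "\<lbrakk>x \<in> car A; y \<in> car A\<rbrakk> \<Longrightarrow> mult A x (scl A c y) = scl A c (mult A x y)"
    and mult_assoc: "\<lbrakk>x \<in> car A; y \<in> car A; z \<in> car A\<rbrakk>
             \<Longrightarrow> mult A (mult A x y) z = mult A x (mult A y z)"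
    and unit_left: "x \<in> car A \<Longrightarrow> mult A (unit A) x = x"
    and unit_right: "x \<in> car A \<Longrightarrow> mult A x (unit A) = x"
    and mult_comp: "\<lbrakk>x \<in> gr A m; y \<in> gr A n\<rbrakk> \<Longrightarrow> mult A x y \<in> gr A (m + n)"
    and unit_nonzero: "unit A \<noteq> 0"
    and connected: "gr A 0 = {scl A c (unit A) | c. True}"
    and locally_finite: "\<exists>S. finite S \<and> gr A n = module.span (scl A) S"

text \<open>\<open>\<mu>\<^sub>A : A \<otimes> A \<rightarrow> A\<close>.\<close>

definition mu :: "('k::field, 'a::ab_group_add) galg \<Rightarrow> ('k, 'a, 'a) tensor \<Rightarrow> 'a" where
  "mu A = tensor_lift A A A (mult A)"

text \<open>\<open>I\<^sub>2\<close>, the kernel of \<open>\<mu>\<^sub>A\<close> on \<open>A\<^sub>1 \<otimes> A\<^sub>1\<close>.\<close>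

definition quadratic_relations :: "('k::field, 'a::ab_group_add) galg \<Rightarrow> ('k, 'a, 'a) tensor set" where
  "quadratic_relations A = {t \<in> tensor_sub A A (gr A 1) (gr A 1). mu A t = 0}"


subsection \<open>Free algebras\<close>

text \<open>
  The tensor algebra \<open>T(S)\<close> of a subspace \<open>S\<close>, realised like the binary tensor product:
  \<open>v\<^sub>1 \<otimes> \<dots> \<otimes> v\<^sub>n\<close> is evaluation of multilinear forms (on lists of every length) at \<open>[v\<^sub>1, \<dots>, v\<^sub>n]\<close>.
\<close>

definition multilinear_form :: "('k::field \<Rightarrow> 'v::ab_group_add \<Rightarrow> 'v) \<Rightarrow> ('v list \<Rightarrow> 'k) \<Rightarrow> bool" where
  "multilinear_form s \<phi> \<longleftrightarrow> (\<forall>xs ys. Vector_Spaces.linear s (*) (\<lambda>v. \<phi> (xs @ v # ys)))"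

definition pure_word ::
    "('k::field \<Rightarrow> 'v::ab_group_add \<Rightarrow> 'v) \<Rightarrow> 'v list \<Rightarrow> ('v list \<Rightarrow> 'k) \<Rightarrow> 'k" where
  "pure_word s vs = (\<lambda>\<phi>. if multilinear_form s \<phi> then \<phi> vs else 0)"

definition tensor_algebra ::
    "('k::field \<Rightarrow> 'v::ab_group_add \<Rightarrow> 'v) \<Rightarrow> 'v set \<Rightarrow> (('v list \<Rightarrow> 'k) \<Rightarrow> 'k) set" where
  "tensor_algebra s S = module.span fscale (pure_word s ` lists S)"

text \<open>The canonical map \<open>T(B\<^sub>1) \<rightarrow> B\<close> is bijective.\<close>

definition one_generated_free :: "('k::field, 'b::ab_group_add) galg \<Rightarrow> bool" where
  "one_generated_free B \<longleftrightarrow>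
    (\<exists>\<Phi>. linear_on (tensor_algebra (scl B) (gr B 1)) fscale (scl B) \<Phi> \<and>
         (\<forall>vs\<in>lists (gr B 1). \<Phi> (pure_word (scl B) vs) = foldr (mult B) vs (unit B)) \<and>
         bij_betw \<Phi> (tensor_algebra (scl B) (gr B 1)) (car B))"


subsection \<open>Koszul algebras\<close>

text \<open>
  The free left \<open>A\<close>-module on a set \<open>X\<close> consists of the finitely supported functions on \<open>X\<close>
  with values in \<open>A\<close>, extended by 0.  With its generators placed in degree \<open>i\<close>, its component of
  degree \<open>n\<close> consists of the functions with values in \<open>A\<^bsub>n-i\<^esub>\<close>.
\<close>

definition free_car :: "('k::field, 'a::ab_group_add) galg \<Rightarrow> 'x set \<Rightarrow> ('x \<Rightarrow> 'a) set" where
  "free_car A X = {p. finite {x. p x \<noteq> 0} \<and> (\<forall>x. p x \<in> car A) \<and> (\<forall>x. x \<notin> X \<longrightarrow> p x = 0)}"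

definition free_comp ::
    "('k::field, 'a::ab_group_add) galg \<Rightarrow> nat \<Rightarrow> 'x set \<Rightarrow> nat \<Rightarrow> ('x \<Rightarrow> 'a) set" where
  "free_comp A i X n =
    {p \<in> free_car A X. \<forall>x. p x \<in> (if i \<le> n then gr A (n - i) else {0})}"

definition act :: "('k::field, 'a::ab_group_add) galg \<Rightarrow> 'a \<Rightarrow> ('x \<Rightarrow> 'a) \<Rightarrow> 'x \<Rightarrow> 'a" where
  "act A a p = (\<lambda>x. mult A a (p x))"

definition free_hom ::
    "('k::field, 'a::ab_group_add) galg \<Rightarrow> nat \<Rightarrow> 'x set \<Rightarrow> nat \<Rightarrow> 'y set
     \<Rightarrow> (('x \<Rightarrow> 'a) \<Rightarrow> 'y \<Rightarrow> 'a) \<Rightarrow> bool"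
  where "free_hom A i X j Y d \<longleftrightarrow>
    (\<forall>p\<in>free_car A X. \<forall>q\<in>free_car A X. d (p + q) = d p + d q) \<and>
    (\<forall>a\<in>car A. \<forall>p\<in>free_car A X. d (act A a p) = act A a (d p)) \<and>
    (\<forall>n. d ` free_comp A i X n \<subseteq> free_comp A j Y n)"

text \<open>
  The trivial module \<open>A/A\<^sub>+\<close> is the field \<open>'k\<close>, concentrated in degree 0, on which \<open>A\<close> acts through
  the augmentation.
\<close>

definition augmentation :: "('k::field, 'a::ab_group_add) galg \<Rightarrow> 'a \<Rightarrow> 'k" where
  "augmentation A a = (THE c. hcomp A 0 a = scl A c (unit A))"

definition hom_to_field ::
    "('k::field, 'a::ab_group_add) galg \<Rightarrow> nat \<Rightarrow> 'x set \<Rightarrow> (('x \<Rightarrow> 'a) \<Rightarrow> 'k) \<Rightarrow> bool"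
  where "hom_to_field A i X e \<longleftrightarrow>
    (\<forall>p\<in>free_car A X. \<forall>q\<in>free_car A X. e (p + q) = e p + e q) \<and>
    (\<forall>a\<in>car A. \<forall>p\<in>free_car A X. e (act A a p) = augmentation A a * e p) \<and>
    (\<forall>n>0. e ` free_comp A i X n \<subseteq> {0})"

definition linear_free_resolution ::
    "('k::field, 'a::ab_group_add) galg \<Rightarrow> (nat \<Rightarrow> 'x set) \<Rightarrow> (nat \<Rightarrow> ('x \<Rightarrow> 'a) \<Rightarrow> 'x \<Rightarrow> 'a)
     \<Rightarrow> (('x \<Rightarrow> 'a) \<Rightarrow> 'k) \<Rightarrow> bool"
  where "linear_free_resolution A X d e \<longleftrightarrow>
    (\<forall>i. free_hom A (Suc i) (X (Suc i)) i (X i) (d i)) \<and>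
    hom_to_field A 0 (X 0) e \<and>
    e ` free_car A (X 0) = UNIV \<and>
    {p \<in> free_car A (X 0). e p = 0} = d 0 ` free_car A (X 1) \<and>
    (\<forall>i. {p \<in> free_car A (X (Suc i)). d i p = 0} = d (Suc i) ` free_car A (X (Suc (Suc i))))"

text \<open>
  Generating sets are subsets of \<open>nat\<close>.  This is no restriction: in a linear free resolution
  over any index type the generating sets are finite, see \<open>linear_free_resolution_finite\<close>
  and \<open>koszulI\<close> below.
\<close>

definition koszul :: "('k::field, 'a::ab_group_add) galg \<Rightarrow> bool" where
  "koszul A \<longleftrightarrow> connected_graded_algebra A \<and>
    (\<exists>(X :: nat \<Rightarrow> nat set) d e. linear_free_resolution A X d e)"

definition gen :: "('k::field, 'a::ab_group_add) galg \<Rightarrow> 'x \<Rightarrow> 'x \<Rightarrow> 'a" where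
  "gen A x = (\<lambda>y. if y = x then unit A else 0)"

lemma sum_apply: "(sum f S :: 'x \<Rightarrow> 'v::ab_group_add) y = (\<Sum>x\<in>S. f x y)"
  by (induction S rule: infinite_finite_induct) auto

context connected_graded_algebra
begin

sublocale vector_space "scl A" by (rule vector_space)

lemma gr_car: "x \<in> gr A n \<Longrightarrow> x \<in> car A"
  unfolding car_def by (auto intro: span_base)

lemma subspace_car: "subspace (car A)"
  unfolding car_def by simp

lemma unit_gr: "unit A \<in> gr A 0"
  unfolding connected by (auto intro: exI[of _ 1])

lemma mult_zero: "x \<in> car A \<Longrightarrow> mult A x 0 = 0"
  using scale_mult_right[of x 0 0] subspace_0[OF subspace_car] by simp

lemma hcomp_eq:
  assumes N: "finite N" and f: "\<And>m. f m \<in> gr A m" and f0: "\<And>m. m \<notin> N \<Longrightarrow> f m = 0"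
  shows "hcomp A n (sum f N) = f n"
  unfolding hcomp_def
proof (rule the_equality)
  show "\<exists>g M. finite M \<and> (\<forall>m. g m \<in> gr A m) \<and> (\<forall>m. m \<notin> M \<longrightarrow> g m = 0) \<and> sum f N = sum g M \<and> f n = g n"
    using assms by blast
next
  fix u assume "\<exists>g M. finite M \<and> (\<forall>m. g m \<in> gr A m) \<and> (\<forall>m. m \<notin> M \<longrightarrow> g m = 0) \<and> sum f N = sum g M \<and> u = g n"
  then obtain g M where g: "finite M" "\<And>m. g m \<in> gr A m" "\<And>m. m \<notin> M \<Longrightarrow> g m = 0"
    "sum f N = sum g M" "u = g n" by blast
  have "sum f N = sum f (insert n (N \<union> M))"
    by (rule sum.mono_neutral_left) (use N g(1) f0 in auto)
  moreover have "sum g M = sum g (insert n (N \<union> M))"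
    by (rule sum.mono_neutral_left) (use N g(1,3) in auto)
  ultimately have "(\<Sum>m\<in>insert n (N \<union> M). f m - g m) = 0"
    using g(4) by (simp add: sum_subtractf)
  then have "f n - g n = 0"
    by (rule independent_comp[of "insert n (N \<union> M)", rotated 2])
       (use N g(1,2) f subspace_comp subspace_diff in auto)
  then show "u = f n" using g(5) by simp
qed

lemma augmentation_unit: "augmentation A (scl A c (unit A)) = c"
proof -
  let ?f = "\<lambda>m::nat. if m = 0 then scl A c (unit A) else 0"
  have "hcomp A 0 (sum ?f {0}) = ?f 0"
    by (rule hcomp_eq) (use unit_gr subspace_comp subspace_scale subspace_0 in auto)
  then have "hcomp A 0 (scl A c (unit A)) = scl A c (unit A)" by simp
  then show ?thesis unfolding augmentation_def using unit_nonzero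
    by (auto intro!: the_equality dest: scale_right_imp_eq)
qed

lemma gr0_positive:
  assumes "x \<in> gr A 0" "x \<in> span (\<Union>n\<in>{0<..}. gr A n)"
  shows "x = 0"
proof -
  have "\<exists>g N. finite N \<and> 0 \<notin> N \<and> (\<forall>m. g m \<in> gr A m) \<and> (\<forall>m. m \<notin> N \<longrightarrow> g m = 0) \<and> x = sum g N"
    using assms(2)
  proof (induction rule: span_induct_alt)
    case base
    show ?case using subspace_comp subspace_0 by (intro exI[of _ "\<lambda>_. 0"] exI[of _ "{}"]) auto
  next
    case (step c a y)
    then obtain g N n where g: "finite N" "0 \<notin> N" "\<And>m. g m \<in> gr A m" "\<And>m. m \<notin> N \<Longrightarrow> g m = 0"
      "y = sum g N" and n: "n > 0" "a \<in> gr A n" by auto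
    let ?g = "\<lambda>m. (if m = n then scl A c a else 0) + g m"
    have "sum ?g (insert n N) = scl A c a + sum g (insert n N)"
      using g(1) by (simp add: sum.distrib)
    also have "sum g (insert n N) = sum g N"
      by (rule sum.mono_neutral_right) (use g in auto)
    finally have "scl A c a + y = sum ?g (insert n N)" using g(5) by simp
    moreover have "?g m \<in> gr A m" for m
      using n g(3) subspace_comp subspace_add subspace_scale by auto
    ultimately show ?case using g n
      by (intro exI[of _ ?g] exI[of _ "insert n N"]) auto
  qed
  then obtain g N where g: "finite N" "0 \<notin> N" "\<And>m. g m \<in> gr A m" "\<And>m. m \<notin> N \<Longrightarrow> g m = 0" "x = sum g N"
    by blast
  let ?f = "\<lambda>m::nat. if m = 0 then x else 0"
  have "hcomp A 0 (sum ?f {0}) = ?f 0"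
    by (rule hcomp_eq) (use assms(1) subspace_comp subspace_0 in auto)
  moreover have "hcomp A 0 (sum g N) = g 0" by (rule hcomp_eq) (use g in auto)
  ultimately show ?thesis using g by simp
qed

lemma mult_positive:
  assumes a: "a \<in> car A" and b: "b \<in> gr A 1"
  shows "mult A a b \<in> span (\<Union>n\<in>{0<..}. gr A n)"
proof -
  note b' = gr_car[OF b]
  have "a \<in> car A \<and> mult A a b \<in> span (\<Union>n\<in>{0<..}. gr A n)"
    using a unfolding car_def[of A]
  proof (induction rule: span_induct_alt)
    case base
    show ?case using scale_mult_left[of 0 b 0] subspace_0[OF subspace_car] b'
      by (simp add: span_zero)
  next
    case (step c x y)
    then obtain n where n: "x \<in> gr A n" by auto
    have x: "x \<in> car A" "scl A c x \<in> car A" "y \<in> car A"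
      using gr_car[OF n] subspace_scale[OF subspace_car] step unfolding car_def by auto
    have "mult A x b \<in> gr A (n + 1)" using mult_comp n b by blast
    then have "mult A x b \<in> span (\<Union>n\<in>{0<..}. gr A n)" by (intro span_base) auto
    then show ?case
      using x step b' unfolding car_def[symmetric]
      by (simp add: distrib_right scale_mult_left span_add span_scale subspace_add[OF subspace_car])
  qed
  then show ?thesis by blast
qed

lemma gen_free_car: "x \<in> X \<Longrightarrow> gen A x \<in> free_car A X"
  using gr_car[OF unit_gr] subspace_0[OF subspace_car]
  by (auto simp: free_car_def gen_def)

lemma gen_free_comp: "x \<in> X \<Longrightarrow> gen A x \<in> free_comp A i X i"
  using gen_free_car[of x X] unit_gr subspace_0[OF subspace_comp]
  by (auto simp: free_comp_def gen_def)

lemma free_car_add: "p \<in> free_car A X \<Longrightarrow> q \<in> free_car A X \<Longrightarrow> p + q \<in> free_car A X"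
  using subspace_add[OF subspace_car]
  by (auto simp: free_car_def intro: finite_subset[of _ "{x. p x \<noteq> 0} \<union> {x. q x \<noteq> 0}"])

lemma free_car_zero: "0 \<in> free_car A X"
  using subspace_0[OF subspace_car] by (auto simp: free_car_def)

lemma mult_car: "a \<in> car A \<Longrightarrow> b \<in> car A \<Longrightarrow> mult A a b \<in> car A"
proof -
  assume a: "a \<in> car A" and b: "b \<in> car A"
  have *: "mult A x b \<in> car A" if x: "x \<in> gr A m" for x m
  proof -
    have "b \<in> car A \<and> mult A x b \<in> car A"
      using b unfolding car_def[of A]
    proof (induction rule: span_induct_alt)
      case base
      show ?case using mult_zero[OF gr_car[OF x]] by (simp add: span_zero)
    next
      case (step c y z)
      then obtain n where n: "y \<in> gr A n" by auto
      note y = gr_car[OF n]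
      have "mult A x y \<in> car A" using mult_comp[OF x n] gr_car by blast
      then show ?case
        using gr_car[OF x] y step subspace_scale[OF subspace_car, of y] unfolding car_def[symmetric]
        by (simp add: distrib_left scale_mult_right subspace_add[OF subspace_car] subspace_scale[OF subspace_car])
    qed
    then show ?thesis by blast
  qed
  have "a \<in> car A \<and> mult A a b \<in> car A"
    using a unfolding car_def[of A]
  proof (induction rule: span_induct_alt)
    case base
    show ?case using scale_mult_left[of 0 b 0] subspace_0[OF subspace_car] b by (simp add: span_zero)
  next
    case (step c y z)
    then obtain n where n: "y \<in> gr A n" by auto
    note y = gr_car[OF n]
    show ?case
      using b y *[OF n] step subspace_scale[OF subspace_car, of y] unfolding car_def[symmetric]
      by (simp add: distrib_right scale_mult_left subspace_add[OF subspace_car] subspace_scale[OF subspace_car])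
  qed
  then show ?thesis by blast
qed

lemma act_free_car: "a \<in> car A \<Longrightarrow> p \<in> free_car A X \<Longrightarrow> act A a p \<in> free_car A X"
  by (auto simp: free_car_def act_def mult_zero mult_car
      intro: finite_subset[of _ "{x. p x \<noteq> 0}"])

lemma free_car_sum: "(\<And>x. x \<in> S \<Longrightarrow> p x \<in> free_car A X) \<Longrightarrow> sum p S \<in> free_car A X"
  by (induction S rule: infinite_finite_induct) (auto simp: free_car_zero free_car_add)

lemma free_car_decompose:
  assumes p: "p \<in> free_car A X"
  shows "p = (\<Sum>x\<in>{x. p x \<noteq> 0}. act A (p x) (gen A x))"
proof
  fix y
  have fin: "finite {x. p x \<noteq> 0}" and c: "\<And>x. p x \<in> car A" using p by (auto simp: free_car_def)
  have "(\<Sum>x\<in>{x. p x \<noteq> 0}. act A (p x) (gen A x)) y = (\<Sum>x\<in>{x. p x \<noteq> 0}. act A (p x) (gen A x) y)"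
    by (rule sum_apply)
  also have "\<dots> = (\<Sum>x\<in>{x. p x \<noteq> 0}. if y = x then p x else 0)"
    by (rule sum.cong) (auto simp: act_def gen_def unit_right c mult_zero)
  also have "\<dots> = p y" using fin by simp
  finally show "p y = (\<Sum>x\<in>{x. p x \<noteq> 0}. act A (p x) (gen A x)) y" by simp
qed

lemma additive_sum:
  assumes add: "\<And>p q. p \<in> free_car A X \<Longrightarrow> q \<in> free_car A X \<Longrightarrow> D (p + q) = D p + (D q :: 'w::ab_group_add)"
    and S: "finite S" "\<And>x. x \<in> S \<Longrightarrow> p x \<in> free_car A X"
  shows "D (sum p S) = (\<Sum>x\<in>S. D (p x))"
  using S
proof (induction S rule: finite_induct)
  case empty
  have "D (0 + 0) = D 0 + D 0" using add free_car_zero by blast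
  then have "D 0 = 0" unfolding add_0_left by simp
  then show ?case unfolding sum.empty .
next
  case (insert x S)
  then show ?case using add[of "p x" "sum p S"] free_car_sum[of S p X]
    by (simp del: plus_fun_apply plus_fun_def zero_fun_def)
qed

lemma free_homD:
  assumes "free_hom A i X j Y d"
  shows "\<lbrakk>p \<in> free_car A X; q \<in> free_car A X\<rbrakk> \<Longrightarrow> d (p + q) = d p + d q"
    and "\<lbrakk>a \<in> car A; p \<in> free_car A X\<rbrakk> \<Longrightarrow> d (act A a p) = act A a (d p)"
    and "p \<in> free_comp A i X n \<Longrightarrow> d p \<in> free_comp A j Y n"
  using assms by (simp_all only: free_hom_def image_subset_iff)

lemma hom_to_fieldD:
  assumes "hom_to_field A i X e"
  shows "\<lbrakk>p \<in> free_car A X; q \<in> free_car A X\<rbrakk> \<Longrightarrow> e (p + q) = e p + e q"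
    and "\<lbrakk>a \<in> car A; p \<in> free_car A X\<rbrakk> \<Longrightarrow> e (act A a p) = augmentation A a * e p"
    and "\<lbrakk>n > 0; p \<in> free_comp A i X n\<rbrakk> \<Longrightarrow> e p \<in> {0}"
  using assms by (simp_all only: hom_to_field_def image_subset_iff)

lemma free_comp_car: "p \<in> free_comp A i X n \<Longrightarrow> p \<in> free_car A X"
  by (simp add: free_comp_def)

lemma free_hom_expand:
  assumes h: "free_hom A (Suc i) X i Y d" and p: "p \<in> free_car A X"
  shows "d p = (\<Sum>x\<in>{x. p x \<noteq> 0}. act A (p x) (d (gen A x)))" and "d p \<in> free_car A Y"
proof -
  have fin: "finite {x. p x \<noteq> 0}" using p by (simp add: free_car_def)
  have sub: "x \<in> X" if "p x \<noteq> 0" for x using p that by (auto simp: free_car_def)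
  have pc: "p x \<in> car A" for x using p by (simp add: free_car_def)
  have "d p = d (\<Sum>x\<in>{x. p x \<noteq> 0}. act A (p x) (gen A x))"
    using free_car_decompose[OF p] by simp
  also have "\<dots> = (\<Sum>x\<in>{x. p x \<noteq> 0}. d (act A (p x) (gen A x)))"
  proof (rule additive_sum[where X = X])
    show "d (p + q) = d p + d q" if "p \<in> free_car A X" "q \<in> free_car A X" for p q
      using free_homD(1)[OF h that] .
    show "finite {x. p x \<noteq> 0}" by (rule fin)
    fix x assume "x \<in> {x. p x \<noteq> 0}"
    then have "x \<in> X" using sub[of x] by simp
    then show "act A (p x) (gen A x) \<in> free_car A X" by (intro act_free_car pc gen_free_car)
  qed
  also have "\<dots> = (\<Sum>x\<in>{x. p x \<noteq> 0}. act A (p x) (d (gen A x)))"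
  proof (rule sum.cong)
    fix x assume "x \<in> {x. p x \<noteq> 0}"
    then have "x \<in> X" using sub[of x] by simp
    then show "d (act A (p x) (gen A x)) = act A (p x) (d (gen A x))"
      by (intro free_homD(2)[OF h] pc gen_free_car)
  qed simp
  finally show *: "d p = (\<Sum>x\<in>{x. p x \<noteq> 0}. act A (p x) (d (gen A x)))" .
  show "d p \<in> free_car A Y" unfolding *
  proof (rule free_car_sum, rule act_free_car[OF pc])
    fix x assume "x \<in> {x. p x \<noteq> 0}"
    then have "x \<in> X" using sub[of x] by simp
    then show "d (gen A x) \<in> free_car A Y"
      by (rule free_comp_car[OF free_homD(3)[OF h gen_free_comp]])
  qed
qed

lemma finite_generators:
  fixes D :: "('x \<Rightarrow> 'a) \<Rightarrow> 'w::ab_group_add"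
  assumes s: "vector_space s"
    and add: "\<And>p q. p \<in> free_car A X \<Longrightarrow> q \<in> free_car A X \<Longrightarrow> D (p + q) = D p + D q"
    and sc: "\<And>c p. p \<in> free_car A X \<Longrightarrow> D (act A (scl A c (unit A)) p) = s c (D p)"
    and inj: "\<And>p. p \<in> free_comp A i X i \<Longrightarrow> D p = 0 \<Longrightarrow> p = 0"
    and T: "finite T" "\<And>x. x \<in> X \<Longrightarrow> D (gen A x) \<in> module.span s T"
  shows "finite X"
proof -
  interpret s: vector_space s by fact
  have ind: "u x = 0" if F: "finite F" "F \<subseteq> X" and 0: "(\<Sum>x\<in>F. s (u x) (D (gen A x))) = 0" and x: "x \<in> F"
    for F u x
  proof -
    have cu: "scl A c (unit A) \<in> gr A 0" for c using unit_gr subspace_scale[OF subspace_comp] by blast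
    define P where "P = (\<Sum>x\<in>F. act A (scl A (u x) (unit A)) (gen A x))"
    have a: "act A (scl A (u x) (unit A)) (gen A x) \<in> free_car A X" if "x \<in> F" for x
      using that F by (intro act_free_car gen_free_car gr_car[OF cu]) auto
    have Py: "P y = (if y \<in> F then scl A (u y) (unit A) else 0)" for y
    proof -
      have "P y = (\<Sum>x\<in>F. act A (scl A (u x) (unit A)) (gen A x) y)"
        unfolding P_def by (rule sum_apply)
      also have "\<dots> = (\<Sum>x\<in>F. if y = x then scl A (u x) (unit A) else 0)"
        by (rule sum.cong) (auto simp: act_def gen_def unit_right gr_car[OF cu] mult_zero)
      also have "\<dots> = (if y \<in> F then scl A (u y) (unit A) else 0)" using F(1) by simp
      finally show ?thesis .
    qed
    have "P \<in> free_car A X" unfolding P_def by (rule free_car_sum) (rule a)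
    then have "P \<in> free_comp A i X i"
      by (simp add: free_comp_def Py cu subspace_0[OF subspace_comp])
    moreover have "D P = 0"
    proof -
      have "D P = (\<Sum>x\<in>F. D (act A (scl A (u x) (unit A)) (gen A x)))"
        unfolding P_def
      proof (rule additive_sum[where X = X and S = F and D = D and p = "\<lambda>x. act A (scl A (u x) (unit A)) (gen A x)"])
        show "D (p + q) = D p + D q" if "p \<in> free_car A X" "q \<in> free_car A X" for p q
          by (rule add[OF that])
        show "finite F" by (rule F(1))
        show "act A (scl A (u x) (unit A)) (gen A x) \<in> free_car A X" if "x \<in> F" for x
          by (rule a[OF that])
      qed
      also have "\<dots> = (\<Sum>x\<in>F. s (u x) (D (gen A x)))"
      proof (rule sum.cong)
        fix x assume "x \<in> F"
        then have "x \<in> X" using F(2) by (rule subsetD[rotated])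
        then show "D (act A (scl A (u x) (unit A)) (gen A x)) = s (u x) (D (gen A x))"
          by (intro sc gen_free_car)
      qed simp
      finally show ?thesis using 0 by simp
    qed
    ultimately have "P = 0" using inj[of P] by blast
    then have "scl A (u x) (unit A) = 0" using Py[of x] x by simp
    then show ?thesis using unit_nonzero by simp
  qed
  have injD: "inj_on (\<lambda>x. D (gen A x)) X"
  proof (rule inj_onI, rule ccontr)
    fix x y assume xy: "x \<in> X" "y \<in> X" "D (gen A x) = D (gen A y)" "x \<noteq> y"
    have "(if x = x then 1 else - 1 :: 'k) = 0"
      by (rule ind[of "{x, y}" "\<lambda>z. if z = x then 1 else - 1" x]) (use xy in auto)
    then show False by simp
  qed
  have "s.independent ((\<lambda>x. D (gen A x)) ` X)"
    proof
    assume "s.dependent ((\<lambda>x. D (gen A x)) ` X)"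
    then obtain t u where tu: "finite t \<and> t \<subseteq> (\<lambda>x. D (gen A x)) ` X
        \<and> (\<Sum>v\<in>t. s (u v) v) = 0 \<and> (\<exists>v\<in>t. u v \<noteq> 0)"
      unfolding s.dependent_explicit by (elim exE)
    then obtain v where t: "finite t" "t \<subseteq> (\<lambda>x. D (gen A x)) ` X"
        "(\<Sum>v\<in>t. s (u v) v) = 0" "v \<in> t" and nz: "u v \<noteq> 0"
      by (elim conjE bexE)
    from t obtain F where F: "F \<subseteq> X" "t = (\<lambda>x. D (gen A x)) ` F" by (meson subset_imageE)
    have inF: "inj_on (\<lambda>x. D (gen A x)) F" using injD F(1) by (rule inj_on_subset)
    have fin: "finite F" using t(1) F(2) inF finite_imageD by blast
    obtain x where x: "x \<in> F" "v = D (gen A x)" using t(4) F(2) by blast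
    have "(\<Sum>x\<in>F. s (u (D (gen A x))) (D (gen A x))) = 0"
      using t(3) unfolding F(2) by (simp add: sum.reindex[OF inF])
    then have "u (D (gen A x)) = 0" 
      by (rule ind[OF fin F(1) _ x(1), where u = "\<lambda>x. u (D (gen A x))"])
    then show False using nz unfolding x(2) by (rule notE[rotated])
  qed
  then have "finite ((\<lambda>x. D (gen A x)) ` X)"
    using s.independent_span_bound[OF T(1)] T(2) by blast
  then show ?thesis using injD finite_imageD by blast
qed

lemma linear_free_resolution_finite:
  fixes X :: "nat \<Rightarrow> 'x set"
  assumes res: "linear_free_resolution A X d e"
  shows "finite (X i)"
proof (induction i)
  have ker: "p = 0"
    if p: "p \<in> free_comp A i (X i) i" "p \<in> d i ` free_car A (X (Suc i))" for p i
  proof -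
    obtain q where q: "p = d i q" "q \<in> free_car A (X (Suc i))" using p(2) by blast
    have h: "free_hom A (Suc i) (X (Suc i)) i (X i) (d i)"
      using res by (simp add: linear_free_resolution_def)
    have qc: "q x \<in> car A" for x using q(2) by (simp add: free_car_def)
    have sub: "x \<in> X (Suc i)" if "q x \<noteq> 0" for x
      using q(2) that by (auto simp: free_car_def)
    note p_eq = free_hom_expand(1)[OF h q(2), folded q(1)]
    have "p y = 0" for y
    proof (rule gr0_positive)
      show "p y \<in> gr A 0" using p(1) by (auto simp: free_comp_def)
      have "d i (gen A x) y \<in> gr A 1" if "q x \<noteq> 0" for x
      proof -
        have "gen A x \<in> free_comp A (Suc i) (X (Suc i)) (Suc i)" using sub[OF that] by (rule gen_free_comp)
        then have "d i (gen A x) \<in> free_comp A i (X i) (Suc i)" by (rule free_homD(3)[OF h])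
        then have "d i (gen A x) y \<in> (if i \<le> Suc i then gr A (Suc i - i) else {0})"
          unfolding free_comp_def by blast
        then show ?thesis by simp
      qed
      then show "p y \<in> span (\<Union>n\<in>{0<..}. gr A n)"
        unfolding p_eq sum_apply act_def by (intro span_sum mult_positive qc) auto
    qed
    then show ?thesis by (simp add: fun_eq_iff)
  qed
  {
    case 0
    have e: "hom_to_field A 0 (X 0) e" and ex: "{p \<in> free_car A (X 0). e p = 0} = d 0 ` free_car A (X (Suc 0))"
      using res by (simp_all add: linear_free_resolution_def)
    show ?case
    proof (rule finite_generators[where s = "(*)" and D = e and i = 0 and T = "{1}"])
      show v: "vector_space ((*) :: 'k \<Rightarrow> 'k \<Rightarrow> 'k)" by unfold_locales (simp_all add: algebra_simps)
      interpret v: vector_space "(*) :: 'k \<Rightarrow> 'k \<Rightarrow> 'k" by (rule v)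
      show "e (gen A x) \<in> v.span {1}" for x by (simp add: v.span_singleton)
      show "e (act A (scl A c (unit A)) p) = c * e p" if "p \<in> free_car A (X 0)" for c p
        using hom_to_fieldD(2)[OF e subspace_scale[OF subspace_car gr_car[OF unit_gr]] that]
        unfolding augmentation_unit .
      show "p = 0" if "p \<in> free_comp A 0 (X 0) 0" "e p = 0" for p
      proof (rule ker[OF that(1)])
        show "p \<in> d 0 ` free_car A (X (Suc 0))"
          unfolding ex[symmetric] using free_comp_car[OF that(1)] that(2) by simp
      qed
      show "e (p + q) = e p + e q" if "p \<in> free_car A (X 0)" "q \<in> free_car A (X 0)" for p q
        by (rule hom_to_fieldD(1)[OF e that])
    qed simp
  next
    case (Suc i)
    have h: "free_hom A (Suc i) (X (Suc i)) i (X i) (d i)"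
      and ex: "{p \<in> free_car A (X (Suc i)). d i p = 0} = d (Suc i) ` free_car A (X (Suc (Suc i)))"
      using res by (simp_all add: linear_free_resolution_def)
    obtain S where S: "finite S" "gr A 1 = span S" using locally_finite by blast
    define s :: "'k \<Rightarrow> ('x \<Rightarrow> 'a) \<Rightarrow> 'x \<Rightarrow> 'a" where "s c p = (\<lambda>x. scl A c (p x))" for c p
    have v: "vector_space s"
      by unfold_locales (auto simp: s_def fun_eq_iff scale_right_distrib scale_left_distrib)
    interpret v: vector_space s by (rule v)
    define single :: "'x \<Rightarrow> 'a \<Rightarrow> 'x \<Rightarrow> 'a" where "single x a = (\<lambda>y. if y = x then a else 0)" for x a
    define T where "T = (\<lambda>(x, a). single x a) ` (X i \<times> S)"
    have single_span: "single x a \<in> v.span T" if x: "x \<in> X i" and a: "a \<in> gr A 1" for x a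
    proof -
      have "a \<in> span S" using a S by simp
      then show ?thesis
      proof (induction rule: span_induct_alt)
        case base
        have *: "single x 0 = 0" by (auto simp: single_def)
        show ?case unfolding * by (rule v.span_zero)
      next
        case (step c b y)
        have *: "single x (scl A c b + y) = s c (single x b) + single x y"
          by (auto simp: single_def s_def fun_eq_iff)
        have "single x b \<in> v.span T"
          by (rule v.span_base) (use step x in \<open>auto simp: T_def\<close>)
        then show ?case unfolding * using step by (intro v.span_add v.span_scale)
      qed
    qed
    show ?case
    proof (rule finite_generators[where s = s and D = "d i" and i = "Suc i" and T = T])
      show "vector_space s" by (rule v)
      show "finite T" using S(1) Suc by (simp add: T_def)
      show "d i (gen A x) \<in> v.span T" if x: "x \<in> X (Suc i)" for x
      proof -
        have "gen A x \<in> free_comp A (Suc i) (X (Suc i)) (Suc i)" using x by (rule gen_free_comp)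
        then have "d i (gen A x) \<in> free_comp A i (X i) (Suc i)" by (rule free_homD(3)[OF h])
        then have g: "d i (gen A x) y \<in> gr A 1" "y \<notin> X i \<Longrightarrow> d i (gen A x) y = 0" for y
          unfolding free_comp_def free_car_def by auto
        have "d i (gen A x) = (\<Sum>y\<in>X i. single y (d i (gen A x) y))"
          using Suc g(2) by (auto simp: fun_eq_iff sum_apply single_def)
        also have "\<dots> \<in> v.span T" by (intro v.span_sum single_span g)
        finally show ?thesis .
      qed
      show "d i (act A (scl A c (unit A)) p) = s c (d i p)" if p: "p \<in> free_car A (X (Suc i))" for c p
      proof -
        have u: "scl A c (unit A) \<in> car A" using gr_car[OF unit_gr] subspace_scale[OF subspace_car] by blast
        have "d i p \<in> free_car A (X i)" by (rule free_hom_expand(2)[OF h p])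
        then have "d i p x \<in> car A" for x by (simp add: free_car_def)
        then have "act A (scl A c (unit A)) (d i p) = s c (d i p)"
          using gr_car[OF unit_gr] by (simp add: act_def s_def scale_mult_left unit_left)
        then show ?thesis using free_homD(2)[OF h u p] by (simp only:)
      qed
      show "p = 0" if "p \<in> free_comp A (Suc i) (X (Suc i)) (Suc i)" "d i p = 0" for p
      proof (rule ker[OF that(1)])
        show "p \<in> d (Suc i) ` free_car A (X (Suc (Suc i)))"
          unfolding ex[symmetric] using free_comp_car[OF that(1)] that(2) by simp
      qed
      show "d i (p + q) = d i p + d i q" if "p \<in> free_car A (X (Suc i))" "q \<in> free_car A (X (Suc i))" for p q
        by (rule free_homD(1)[OF h that])
    qed
  }
qed

lemma koszulI:
  fixes X :: "nat \<Rightarrow> 'x set"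
  assumes res: "linear_free_resolution A X d e"
  shows "koszul A"
proof -
  have "\<exists>f :: 'x \<Rightarrow> nat. inj_on f (X i)" for i
  proof -
    have "finite (X i)" by (rule linear_free_resolution_finite[OF res])
    then show ?thesis using finite_imp_inj_to_nat_seg[of "X i"] by blast
  qed
  then have "\<forall>i. \<exists>f :: 'x \<Rightarrow> nat. inj_on f (X i)" by (rule allI)
  then obtain f :: "nat \<Rightarrow> 'x \<Rightarrow> nat" where "\<forall>i. inj_on (f i) (X i)"
    using choice[of "\<lambda>i f. inj_on f (X i)"] by blast
  then have f: "inj_on (f i) (X i)" for i by (rule spec)
  define Y where "Y i = f i ` X i" for i
  define F :: "nat \<Rightarrow> ('x \<Rightarrow> 'a) \<Rightarrow> nat \<Rightarrow> 'a"
    where "F i p n = (if n \<in> Y i then p (the_inv_into (X i) (f i) n) else 0)" for i p n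
  define G :: "nat \<Rightarrow> (nat \<Rightarrow> 'a) \<Rightarrow> 'x \<Rightarrow> 'a"
    where "G i q x = (if x \<in> X i then q (f i x) else 0)" for i q x
  have z: "0 \<in> car A" by (rule subspace_0[OF subspace_car])
  have z': "0 \<in> gr A n" for n by (rule subspace_0[OF subspace_comp])
  have Xf: "finite (X i)" "finite (Y i)" for i
    using linear_free_resolution_finite[OF res] by (auto simp: Y_def)
  have fin: "finite {x. p x \<noteq> 0}" if "\<forall>x. x \<notin> S \<longrightarrow> p x = 0" "finite S" for S and p :: "'z \<Rightarrow> 'a"
    using that by (auto intro: finite_subset[of _ S])
  have inv: "f i (the_inv_into (X i) (f i) n) = n" "the_inv_into (X i) (f i) n \<in> X i" if "n \<in> Y i" for i n
    using that f_the_inv_into_f[OF f] the_inv_into_into[OF f _ subset_refl] by (auto simp: Y_def)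
  have inv': "the_inv_into (X i) (f i) (f i x) = x" if "x \<in> X i" for i x
    using the_inv_into_f_f[OF f that] .
  have Fc: "F i p \<in> free_car A (Y i)" if "p \<in> free_car A (X i)" for i p
    using that z fin[of "Y i" "F i p"] Xf by (auto simp: free_car_def F_def)
  have Gc: "G i p \<in> free_car A (X i)" if "p \<in> free_car A (Y i)" for i p
    using that z fin[of "X i" "G i p"] Xf by (auto simp: free_car_def G_def)
  have Fd: "F i p \<in> free_comp A j (Y i) n" if "p \<in> free_comp A j (X i) n" for i j p n
    using that Fc z' unfolding free_comp_def by (auto simp: F_def)
  have Gd: "G i p \<in> free_comp A j (X i) n" if "p \<in> free_comp A j (Y i) n" for i j p n
    using that Gc z' unfolding free_comp_def by (auto simp: G_def)
  have GF: "G i (F i p) = p" if "p \<in> free_car A (X i)" for i p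
    using that inv' by (auto simp: free_car_def F_def G_def Y_def fun_eq_iff)
  have FG: "F i (G i p) = p" if "p \<in> free_car A (Y i)" for i p
    using that inv by (auto simp: free_car_def F_def G_def fun_eq_iff)
  have Fadd: "F i (p + q) = F i p + F i q" for i p q by (auto simp: F_def fun_eq_iff)
  have Gadd: "G i (p + q) = G i p + G i q" for i p q by (auto simp: G_def fun_eq_iff)
  have Fact: "F i (act A a p) = act A a (F i p)" if "a \<in> car A" for i a p
    using that by (auto simp: F_def act_def fun_eq_iff mult_zero)
  have Gact: "G i (act A a p) = act A a (G i p)" if "a \<in> car A" for i a p
    using that by (auto simp: G_def act_def fun_eq_iff mult_zero)
  have F0: "F i 0 = 0" for i by (auto simp: F_def)
  define d' where "d' i p = F i (d i (G (Suc i) p))" for i p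
  define e' where "e' p = e (G 0 p)" for p
  have h: "free_hom A (Suc i) (X (Suc i)) i (X i) (d i)" for i
    using res by (simp add: linear_free_resolution_def)
  have e: "hom_to_field A 0 (X 0) e"
    and es: "e ` free_car A (X 0) = UNIV"
    and ex0: "{p \<in> free_car A (X 0). e p = 0} = d 0 ` free_car A (X (Suc 0))"
    using res by (simp_all add: linear_free_resolution_def)
  have ex: "{p \<in> free_car A (X (Suc i)). d i p = 0} = d (Suc i) ` free_car A (X (Suc (Suc i)))" for i
    using res by (simp add: linear_free_resolution_def)
  have hadd: "d i (p + q) = d i p + d i q" if "p \<in> free_car A (X (Suc i))" "q \<in> free_car A (X (Suc i))" for i p q
    using h[of i] that by (simp only: free_hom_def)
  have hact: "d i (act A a p) = act A a (d i p)" if "a \<in> car A" "p \<in> free_car A (X (Suc i))" for i a p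
    using h[of i] that by (simp only: free_hom_def)
  have hgr: "d i p \<in> free_comp A i (X i) n" if "p \<in> free_comp A (Suc i) (X (Suc i)) n" for i p n
    using h[of i] that by (simp only: free_hom_def image_subset_iff)
  have eadd: "e (p + q) = e p + e q" if "p \<in> free_car A (X 0)" "q \<in> free_car A (X 0)" for p q
    using e that by (simp only: hom_to_field_def)
  have eact: "e (act A a p) = augmentation A a * e p" if "a \<in> car A" "p \<in> free_car A (X 0)" for a p
    using e that by (simp only: hom_to_field_def)
  have egr: "e p \<in> {0}" if "n > 0" "p \<in> free_comp A 0 (X 0) n" for p n
    using e that by (simp only: hom_to_field_def image_subset_iff)
  note dc = free_hom_expand(2)[OF h]
  have Gim: "G i ` free_car A (Y i) = free_car A (X i)" for i
  proof (rule set_eqI, rule iffI)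
    fix p assume "p \<in> free_car A (X i)"
    then show "p \<in> G i ` free_car A (Y i)"
      by (intro image_eqI[of _ _ "F i p"] Fc) (simp add: GF)
  qed (auto intro: Gc)
  have d'im: "d' i ` free_car A (Y (Suc i)) = F i ` d i ` free_car A (X (Suc i))" for i
    unfolding Gim[symmetric] by (auto simp: d'_def image_image)
  have d'0: "d' i p = 0 \<longleftrightarrow> d i (G (Suc i) p) = 0" if p: "p \<in> free_car A (Y (Suc i))" for i p
  proof -
    have G0: "G i 0 = 0" by (auto simp: G_def)
    show ?thesis
    proof
      assume "d' i p = 0"
      then have "G i (F i (d i (G (Suc i) p))) = 0" unfolding d'_def by (simp only: G0)
      then show "d i (G (Suc i) p) = 0" unfolding GF[OF dc[OF Gc[OF p]]] .
    next
      assume "d i (G (Suc i) p) = 0"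
      then show "d' i p = 0" unfolding d'_def by (simp only: F0)
    qed
  qed
  have "linear_free_resolution A Y d' e'"
    unfolding linear_free_resolution_def
  proof (intro conjI allI)
    fix i
    show "free_hom A (Suc i) (Y (Suc i)) i (Y i) (d' i)"
      unfolding free_hom_def
    proof (intro conjI ballI allI)
      fix p q assume "p \<in> free_car A (Y (Suc i))" "q \<in> free_car A (Y (Suc i))"
      then have "d i (G (Suc i) p + G (Suc i) q) = d i (G (Suc i) p) + d i (G (Suc i) q)"
        by (intro hadd Gc)
      then show "d' i (p + q) = d' i p + d' i q" unfolding d'_def Gadd Fadd[symmetric] by simp
    next
      fix a p assume a: "a \<in> car A" and "p \<in> free_car A (Y (Suc i))"
      then have "d i (act A a (G (Suc i) p)) = act A a (d i (G (Suc i) p))"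
        by (intro hact Gc)
      then show "d' i (act A a p) = act A a (d' i p)" unfolding d'_def Gact[OF a] Fact[OF a, symmetric] by simp
    next
      fix n
      show "d' i ` free_comp A (Suc i) (Y (Suc i)) n \<subseteq> free_comp A i (Y i) n"
      proof (rule image_subsetI)
        fix p assume "p \<in> free_comp A (Suc i) (Y (Suc i)) n"
        then have "d i (G (Suc i) p) \<in> free_comp A i (X i) n" by (intro hgr Gd)
        then show "d' i p \<in> free_comp A i (Y i) n" unfolding d'_def by (rule Fd)
      qed
    qed
    show "{p \<in> free_car A (Y (Suc i)). d' i p = 0} = d' (Suc i) ` free_car A (Y (Suc (Suc i)))"
    proof -
      have "{p \<in> free_car A (Y (Suc i)). d' i p = 0} = F (Suc i) ` {p \<in> free_car A (X (Suc i)). d i p = 0}"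
        (is "?L = ?R")
      proof (rule set_eqI, rule iffI)
        fix p assume "p \<in> ?L"
        then have p: "p \<in> free_car A (Y (Suc i))" "d i (G (Suc i) p) = 0" using d'0[of p i] by simp_all
        show "p \<in> ?R"
        proof (rule image_eqI[of _ _ "G (Suc i) p"])
          show "p = F (Suc i) (G (Suc i) p)" by (simp only: FG[OF p(1)])
          show "G (Suc i) p \<in> {p \<in> free_car A (X (Suc i)). d i p = 0}"
            using Gc[OF p(1)] p(2) by (simp only: mem_Collect_eq)
        qed
      next
        fix p assume "p \<in> ?R"
        then obtain q where q: "p = F (Suc i) q" "q \<in> free_car A (X (Suc i))" "d i q = 0"
          by (elim imageE CollectE conjE)
        have "d' i p = 0" unfolding d'0[OF Fc[OF q(2), folded q(1)]] unfolding q(1) GF[OF q(2)] by (rule q(3))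
        then show "p \<in> ?L" using Fc[OF q(2)] by (simp only: q(1) mem_Collect_eq)
      qed
      then show ?thesis unfolding ex d'im .
    qed
  next
    show "hom_to_field A 0 (Y 0) e'"
      unfolding hom_to_field_def
    proof (intro conjI ballI allI impI)
      fix p q assume "p \<in> free_car A (Y 0)" "q \<in> free_car A (Y 0)"
      then show "e' (p + q) = e' p + e' q"
        unfolding e'_def Gadd by (intro eadd Gc)
    next
      fix a p assume a: "a \<in> car A" and "p \<in> free_car A (Y 0)"
      then show "e' (act A a p) = augmentation A a * e' p"
        unfolding e'_def Gact[OF a] by (intro eact a Gc)
    next
      fix n :: nat assume "n > 0"
      then show "e' ` free_comp A 0 (Y 0) n \<subseteq> {0}"
        unfolding e'_def by (intro image_subsetI egr[of n] Gd)
    qed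
    show "e' ` free_car A (Y 0) = UNIV"
      using es unfolding Gim[symmetric] by (simp add: e'_def image_image)
    have "{p \<in> free_car A (Y 0). e' p = 0} = F 0 ` {p \<in> free_car A (X 0). e p = 0}" (is "?L = ?R")
    proof (rule set_eqI, rule iffI)
      fix p assume "p \<in> ?L"
      then have p: "p \<in> free_car A (Y 0)" "e (G 0 p) = 0" by (simp_all add: e'_def)
      show "p \<in> ?R"
      proof (rule image_eqI[of _ _ "G 0 p"])
        show "p = F 0 (G 0 p)" by (simp only: FG[OF p(1)])
        show "G 0 p \<in> {p \<in> free_car A (X 0). e p = 0}"
          using Gc[OF p(1)] p(2) by (simp only: mem_Collect_eq)
      qed
    next
      fix p assume "p \<in> ?R"
      then obtain q where q: "p = F 0 q" "q \<in> free_car A (X 0)" "e q = 0"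
        by (elim imageE CollectE conjE)
      then show "p \<in> ?L" using Fc[OF q(2)] by (simp only: e'_def GF mem_Collect_eq)
    qed
    then show "{p \<in> free_car A (Y 0). e' p = 0} = d' 0 ` free_car A (Y 1)"
      unfolding ex0 One_nat_def d'im .
  qed
  then show ?thesis
    unfolding koszul_def by (intro conjI connected_graded_algebra_axioms exI)
qed

end


section \<open>Twisting maps\<close>

definition graded_twisting_map ::
    "('k::field, 'a::ab_group_add) galg \<Rightarrow> ('k, 'b::ab_group_add) galg
     \<Rightarrow> (('k, 'b, 'a) tensor \<Rightarrow> ('k, 'a, 'b) tensor) \<Rightarrow> bool"
  where "graded_twisting_map A B \<tau> \<longleftrightarrow>
    graded_linear (B \<otimes> A) (A \<otimes> B) \<tau> \<and>
    (\<forall>a\<in>car A. \<tau> (pure B A (unit B) a) = pure A B a (unit B)) \<and>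
    (\<forall>b\<in>car B. \<tau> (pure B A b (unit A)) = pure A B (unit A) b) \<and>
    (\<forall>t\<in>car ((B \<otimes> B) \<otimes> (A \<otimes> A)).
      \<tau> (tensor_map (B \<otimes> B) (A \<otimes> A) B A (mu B) (mu A) t) =
      tensor_map (A \<otimes> A) (B \<otimes> B) A B (mu A) (mu B)
        (middle_map A B A B A B \<tau>
          (tensor_map (B \<otimes> A) (B \<otimes> A) (A \<otimes> B) (A \<otimes> B) \<tau> \<tau>
            (middle_map B B A A A B \<tau> t))))"

definition twisted_tensor ::
    "('k::field, 'a::ab_group_add) galg \<Rightarrow> ('k, 'b::ab_group_add) galg
     \<Rightarrow> (('k, 'b, 'a) tensor \<Rightarrow> ('k, 'a, 'b) tensor) \<Rightarrow> ('k, ('k, 'a, 'b) tensor) galg"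
  where "twisted_tensor A B \<tau> =
    \<lparr>scl = scl (A \<otimes> B), gr = gr (A \<otimes> B),
     mult = (\<lambda>s t. tensor_map (A \<otimes> A) (B \<otimes> B) A B (mu A) (mu B)
                     (middle_map A B A B A B \<tau> (pure (A \<otimes> B) (A \<otimes> B) s t))),
     unit = pure A B (unit A) (unit B)\<rparr>"

definition sum_sub :: "'v::ab_group_add set \<Rightarrow> 'v set \<Rightarrow> 'v set" where
  "sum_sub S T = {x + y | x y. x \<in> S \<and> y \<in> T}"

definition separable ::
    "('k::field, 'a::ab_group_add) galg \<Rightarrow> ('k, 'b::ab_group_add) galg
     \<Rightarrow> (('k, 'b, 'a) tensor \<Rightarrow> ('k, 'a, 'b) tensor) \<Rightarrow> bool"
  where "separable A B \<tau> \<longleftrightarrow>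
    (\<exists>B' B''. module.subspace (scl B) B' \<and> module.subspace (scl B) B'' \<and>
      sum_sub B' B'' = gr B 1 \<and> B' \<inter> B'' = {0} \<and>
      \<tau> ` tensor_sub B A B' (gr A 1) \<subseteq>
        sum_sub (tensor_sub A B (gr A 2) (gr B 0)) (tensor_sub A B (gr A 1) B') \<and>
      \<tau> ` tensor_sub B A B'' (gr A 1) \<subseteq>
        sum_sub (tensor_sub A B (gr A 1) B'')
                (tensor_sub A B (gr A 0) (mu B ` tensor_sub B B (gr B 1) B'')))"

text \<open>
  \<open>\<tau>\<^sub>B\<close> is \<open>\<tau>\<close> followed by the projection onto \<open>A\<^sub>0 \<otimes> B\<^sub>2\<close>.  It is only applied on \<open>B\<^sub>1 \<otimes> A\<^sub>1\<close>.
\<close>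

definition tau_B ::
    "('k::field, 'a::ab_group_add) galg \<Rightarrow> ('k, 'b::ab_group_add) galg
     \<Rightarrow> (('k, 'b, 'a) tensor \<Rightarrow> ('k, 'a, 'b) tensor) \<Rightarrow> ('k, 'b, 'a) tensor \<Rightarrow> ('k, 'a, 'b) tensor"
  where "tau_B A B \<tau> = tensor_map A B A B (hcomp A 0) (hcomp B 2) \<circ> \<tau>"

text \<open>
  The composite of \<open>\<tau>\<^sub>B \<otimes> 1\<close>, \<open>1 \<otimes> \<tau>\<close> and the projection onto \<open>A\<^sub>0 \<otimes> A\<^sub>2 \<otimes> B\<^sub>1\<close>, from
  \<open>B \<otimes> (A \<otimes> A)\<close> to \<open>A \<otimes> (A \<otimes> B)\<close>.
\<close>

definition obstruction ::
    "('k::field, 'a::ab_group_add) galg \<Rightarrow> ('k, 'b::ab_group_add) galg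
     \<Rightarrow> (('k, 'b, 'a) tensor \<Rightarrow> ('k, 'a, 'b) tensor)
     \<Rightarrow> ('k, 'b, ('k, 'a, 'a) tensor) tensor \<Rightarrow> ('k, 'a, ('k, 'a, 'b) tensor) tensor"
  where "obstruction A B \<tau> =
    tensor_map A (A \<otimes> B) A (A \<otimes> B) (hcomp A 0) (tensor_map A B A B (hcomp A 2) (hcomp B 1)) \<circ>
    tensor_map A (B \<otimes> A) A (A \<otimes> B) id \<tau> \<circ>
    assoc A B A \<circ>
    tensor_map (B \<otimes> A) A (A \<otimes> B) A (tau_B A B \<tau>) id \<circ>
    assoc_inv B A A"

end

theory Submission
  imports Defs
begin

text \<open>
  Write \<open>C = A \<otimes>\<^sub>\<tau> B\<close> and let \<open>S = S' \<union> S''\<close> be a basis of \<open>B\<^sub>1\<close> adapted to the separation.  As a left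
  \<open>A\<close>-module \<open>C\<close> is free on the words in \<open>S\<close>.  Let \<open>A\<^bsup>X n\<^esup>\<close> be the terms of a linear free resolution of
  the field over \<open>A\<close>.  A map \<open>L : S \<times> X n \<rightarrow> A\<^sub>1\<^bsup>X n\<^esup>\<close> vanishing on \<open>S''\<close> defines a \<open>C\<close>-linear map
  \<open>r : C\<^bsup>S \<times> X n\<^esup> \<rightarrow> C\<^bsup>X n\<^esup>\<close>, \<open>e\<^bsub>s,x\<^esub> \<mapsto> s e\<^sub>x - L s x\<close>.  Separability makes it triangular for the number of
  trailing letters from \<open>S'\<close>, so that \<open>C\<^bsup>X n\<^esup> = A\<^bsup>X n\<^esup> \<oplus> im r\<close> and \<open>r\<close> is injective.

  Starting from \<open>L = 0\<close> at \<open>n = 0\<close>, the maps \<open>L\<close> can be chosen such that the \<open>C\<close>-linear extensions of the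
  differentials \<open>d\<close> commute with the maps \<open>r\<close>: the component of \<open>s (d e\<^sub>x)\<close> in \<open>A\<^bsup>X n\<^esup>\<close> is a cycle, hence
  equals \<open>d (L s x)\<close> for some \<open>L s x\<close>, and it vanishes if \<open>s \<in> S''\<close>.  The cone of \<open>r\<close> is then a linear free
  resolution of the field over \<open>C\<close>, with exactness following directly from the decomposition.
\<close>

section \<open>Free modules over a graded algebra\<close>

text \<open>Since im \<open>r\<close> is a \<open>C\<close>-submodule complementary to
  \<open>A^(X n)\<close>, choosing \<open>L\<close> means letting the letters act on
  \<open>A^(X n)\<close>, the class of \<open>s e_x\<close> being \<open>L s x\<close>; then
  \<open>r\<close> is a two-term free resolution of the resulting \<open>C\<close>-module.
  Commutation of \<open>d\<close> with the maps \<open>r\<close> says that the resolution over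
  \<open>A\<close> is a complex of such modules, and the cone splices their two-term resolutions.
  The cycle property is carried through the recursion. Applied to
  \<open>s (d e_x) = b + r q\<close>, the differential kills the left side and carries
  \<open>r q\<close> into the image of the preceding \<open>r\<close>, so uniqueness of the
  decomposition forces \<open>d b = 0\<close>. At \<open>n = 0\<close> positive degree takes the
  place of this argument. For \<open>s\<close> in \<open>S''\<close> the component \<open>b\<close>
  vanishes because the words ending in \<open>S''\<close> span a left ideal of \<open>C\<close>, and
  for \<open>t\<close> in \<open>S''\<close> the map \<open>r\<close> sends \<open>e_(t,x)\<close>
  to exactly \<open>t e_x\<close>. The obstacle is termination of the rewriting: moving a letter of
  \<open>S''\<close> past \<open>A\<close> may lengthen words, so word length cannot be the measure.
  Trailing letters from \<open>S'\<close> are immune to this.\<close>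

definition free_ext ::
    "('k::field, 'a::ab_group_add) galg \<Rightarrow> ('x \<Rightarrow> 'y \<Rightarrow> 'a) \<Rightarrow> ('x \<Rightarrow> 'a) \<Rightarrow> 'y \<Rightarrow> 'a" where
  "free_ext A D p = (\<Sum>x\<in>{x. p x \<noteq> 0}. act A (p x) (D x))"

text \<open>With the generators of the target in degree \<open>i\<close>, degree
  \<open>Suc i\<close> means that all entries of \<open>D x\<close> lie in \<open>gr A 1\<close>. So
  \<open>D\<close> is a matrix with entries of degree 1, and its extension preserves degree when the
  source generators sit in degree \<open>Suc i\<close>.\<close>

definition linear_gens ::
    "('k::field, 'a::ab_group_add) galg \<Rightarrow> nat \<Rightarrow> 'x set \<Rightarrow> 'y set \<Rightarrow> ('x \<Rightarrow> 'y \<Rightarrow> 'a) \<Rightarrow> bool" where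
  "linear_gens A i X Y D \<longleftrightarrow> (\<forall>x\<in>X. D x \<in> free_comp A i Y (Suc i))"

section \<open>Homogeneous components and products in a graded algebra\<close>

context connected_graded_algebra
begin

lemma car_zero: "0 \<in> car A"
  and car_add: "x \<in> car A \<Longrightarrow> y \<in> car A \<Longrightarrow> x + y \<in> car A"
  and car_diff: "x \<in> car A \<Longrightarrow> y \<in> car A \<Longrightarrow> x - y \<in> car A"
  and car_minus: "x \<in> car A \<Longrightarrow> - x \<in> car A"
  and car_scale: "x \<in> car A \<Longrightarrow> scl A c x \<in> car A"
  and car_sum: "(\<And>i. i \<in> I \<Longrightarrow> g i \<in> car A) \<Longrightarrow> sum g I \<in> car A"
  by (fact subspace_0[OF subspace_car] subspace_add[OF subspace_car] subspace_diff[OF subspace_car]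
    subspace_neg[OF subspace_car] subspace_scale[OF subspace_car] subspace_sum[OF subspace_car])+

lemma gr_zero: "0 \<in> gr A n"
  and gr_add: "x \<in> gr A n \<Longrightarrow> y \<in> gr A n \<Longrightarrow> x + y \<in> gr A n"
  and gr_diff: "x \<in> gr A n \<Longrightarrow> y \<in> gr A n \<Longrightarrow> x - y \<in> gr A n"
  and gr_minus: "x \<in> gr A n \<Longrightarrow> - x \<in> gr A n"
  and gr_scale: "x \<in> gr A n \<Longrightarrow> scl A c x \<in> gr A n"
  and gr_sum: "(\<And>i. i \<in> I \<Longrightarrow> g i \<in> gr A n) \<Longrightarrow> sum g I \<in> gr A n"
  by (fact subspace_0[OF subspace_comp] subspace_add[OF subspace_comp] subspace_diff[OF subspace_comp]
    subspace_neg[OF subspace_comp] subspace_scale[OF subspace_comp] subspace_sum[OF subspace_comp])+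

lemma unit_car: "unit A \<in> car A"
  using gr_car[OF unit_gr] .

lemma mult_zero_left: "x \<in> car A \<Longrightarrow> mult A 0 x = 0"
  using scale_mult_left[of 0 x 0] car_zero by simp

lemma mult_minus_right: "x \<in> car A \<Longrightarrow> y \<in> car A \<Longrightarrow> mult A x (- y) = - mult A x y"
  using distrib_left[of x y "- y"] car_minus[of y] mult_zero[of x]
  by (simp add: eq_neg_iff_add_eq_0 add.commute)

lemma mult_sum_left:
  "(\<And>i. i \<in> I \<Longrightarrow> g i \<in> car A) \<Longrightarrow> y \<in> car A \<Longrightarrow> mult A (sum g I) y = (\<Sum>i\<in>I. mult A (g i) y)"
  by (induction I rule: infinite_finite_induct) (auto simp: mult_zero_left distrib_right car_sum)

lemma mult_sum_right:
  "x \<in> car A \<Longrightarrow> (\<And>i. i \<in> I \<Longrightarrow> g i \<in> car A) \<Longrightarrow> mult A x (sum g I) = (\<Sum>i\<in>I. mult A x (g i))"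
  by (induction I rule: infinite_finite_induct) (auto simp: mult_zero distrib_left car_sum)

lemma car_homogeneous_sum:
  assumes "x \<in> car A"
  obtains f N where "finite N" "\<And>m. f m \<in> gr A m" "\<And>m. m \<notin> N \<Longrightarrow> f m = 0" "x = sum f N"
proof -
  have "\<exists>f N. finite N \<and> (\<forall>m. f m \<in> gr A m) \<and> (\<forall>m. m \<notin> N \<longrightarrow> f m = 0) \<and> x = sum f N"
    using assms unfolding car_def
  proof (induction rule: span_induct_alt)
    case base
    show ?case using gr_zero by (intro exI[of _ "\<lambda>_. 0"] exI[of _ "{}"]) auto
  next
    case (step c a y)
    then obtain g N n where g: "finite N" "\<And>m. g m \<in> gr A m" "\<And>m. m \<notin> N \<Longrightarrow> g m = 0"
      "y = sum g N" and n: "a \<in> gr A n" by auto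
    let ?g = "\<lambda>m. (if m = n then scl A c a else 0) + g m"
    have "sum ?g (insert n N) = scl A c a + sum g (insert n N)"
      using g(1) by (simp add: sum.distrib)
    also have "sum g (insert n N) = sum g N"
      by (rule sum.mono_neutral_right) (use g in auto)
    finally have "scl A c a + y = sum ?g (insert n N)" using g(4) by simp
    moreover have "?g m \<in> gr A m" for m
      using n g(2) gr_add gr_scale by auto
    ultimately show ?case using g n
      by (intro exI[of _ ?g] exI[of _ "insert n N"]) auto
  qed
  then show ?thesis using that by blast
qed

text \<open>Scalars are absorbed into the homogeneous case, since each \<open>gr A n\<close> is a
  subspace.\<close>

lemma car_induct [consumes 1, case_names homogeneous add]:
  assumes x: "x \<in> car A"
    and hom: "\<And>n x. x \<in> gr A n \<Longrightarrow> P x"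
    and add: "\<And>x y. \<lbrakk>x \<in> car A; y \<in> car A; P x; P y\<rbrakk> \<Longrightarrow> P (x + y)"
  shows "P x"
proof -
  obtain f N where f: "finite N" "\<And>m. f m \<in> gr A m" "x = sum f N"
    using car_homogeneous_sum[OF x] by metis
  have "P (sum f N)" using f(1)
  proof (induction N rule: finite_induct)
    case empty show ?case using hom[OF gr_zero] by simp
  next
    case (insert m N)
    have "P (f m + sum f N)"
      by (intro add insert hom[of _ m] f gr_car[of _ m] car_sum gr_car[OF f(2)])
    then show ?case using insert by simp
  qed
  then show ?thesis using f by simp
qed

lemma hcomp_homogeneous:
  assumes x: "x \<in> gr A m"
  shows "hcomp A n x = (if n = m then x else 0)"
proof -
  let ?f = "\<lambda>i. if i = m then x else 0"
  have "hcomp A n (sum ?f {m}) = ?f n"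
    by (rule hcomp_eq) (use x gr_zero in auto)
  then show ?thesis by simp
qed

lemma hcomp_add:
  assumes "x \<in> car A" "y \<in> car A"
  shows "hcomp A n (x + y) = hcomp A n x + hcomp A n y"
proof -
  obtain N f where f: "finite N" "\<And>m. f m \<in> gr A m" "\<And>m. m \<notin> N \<Longrightarrow> f m = 0" "x = sum f N"
    by (rule car_homogeneous_sum[OF assms(1)]) (rule that, assumption+)
  obtain g M where g: "finite M" "\<And>m. g m \<in> gr A m" "\<And>m. m \<notin> M \<Longrightarrow> g m = 0" "y = sum g M"
    by (rule car_homogeneous_sum[OF assms(2)]) (rule that, assumption+)
  have 1: "x = sum f (N \<union> M)" unfolding f(4) by (rule sum.mono_neutral_left) (use f g in auto)
  have 2: "y = sum g (N \<union> M)" unfolding g(4) by (rule sum.mono_neutral_left) (use f g in auto)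
  have 3: "x + y = sum (\<lambda>m. f m + g m) (N \<union> M)" by (simp add: 1 2 sum.distrib)
  have "hcomp A n x = f n" unfolding 1 by (rule hcomp_eq) (use f g in auto)
  moreover have "hcomp A n y = g n" unfolding 2 by (rule hcomp_eq) (use f g in auto)
  moreover have "hcomp A n (x + y) = f n + g n" unfolding 3
    by (rule hcomp_eq) (use f g gr_add in auto)
  ultimately show ?thesis by simp
qed

lemma hcomp_gr: "x \<in> car A \<Longrightarrow> hcomp A n x \<in> gr A n"
  by (induction rule: car_induct) (auto simp: hcomp_homogeneous gr_zero hcomp_add gr_add)

lemma hcomp_car: "x \<in> car A \<Longrightarrow> hcomp A n x \<in> car A"
  using gr_car[OF hcomp_gr] .

lemma hcomp_scale: "x \<in> car A \<Longrightarrow> hcomp A n (scl A c x) = scl A c (hcomp A n x)"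
  by (induction rule: car_induct)
    (auto simp: hcomp_homogeneous[OF gr_scale] hcomp_homogeneous hcomp_add scale_right_distrib car_scale)

lemma hcomp_zero: "hcomp A n 0 = 0"
  using hcomp_homogeneous[OF gr_zero, of n n] by simp

lemma hcomp_sum: "(\<And>i. i \<in> I \<Longrightarrow> g i \<in> car A) \<Longrightarrow> hcomp A n (sum g I) = (\<Sum>i\<in>I. hcomp A n (g i))"
  by (induction I rule: infinite_finite_induct) (auto simp: hcomp_zero hcomp_add car_sum)

text \<open>Right multiplication by an element of degree 1 shifts every homogeneous part up by
  exactly one, so nothing is left in degree 0.\<close>

lemma hcomp_mult_1:
  assumes c: "c \<in> car A" and v: "v \<in> gr A 1"
  shows "hcomp A (Suc n) (mult A c v) = mult A (hcomp A n c) v" and "hcomp A 0 (mult A c v) = 0"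
proof -
  note vc = gr_car[OF v]
  have "hcomp A (Suc n) (mult A c v) = mult A (hcomp A n c) v \<and> hcomp A 0 (mult A c v) = 0"
    using c
  proof (induction rule: car_induct)
    case (homogeneous m x)
    then have "mult A x v \<in> gr A (Suc m)" using mult_comp[OF _ v] by simp
    then show ?case using homogeneous vc by (auto simp: hcomp_homogeneous mult_zero_left)
  next
    case (add x y)
    then show ?case using vc by (simp add: distrib_right hcomp_add hcomp_car mult_car)
  qed
  then show "hcomp A (Suc n) (mult A c v) = mult A (hcomp A n c) v" "hcomp A 0 (mult A c v) = 0"
    by blast+
qed

section \<open>Elements of free modules and maps given by a matrix of linear entries\<close>

lemma free_carD:
  assumes "p \<in> free_car A X"
  shows "finite {x. p x \<noteq> 0}" "p x \<in> car A" "x \<notin> X \<Longrightarrow> p x = 0" "p x \<noteq> 0 \<Longrightarrow> x \<in> X"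
  using assms by (auto simp: free_car_def)

lemma free_car_minus: "p \<in> free_car A X \<Longrightarrow> - p \<in> free_car A X"
  by (auto simp: free_car_def car_minus)

lemma free_car_diff: "p \<in> free_car A X \<Longrightarrow> q \<in> free_car A X \<Longrightarrow> p - q \<in> free_car A X"
  using free_car_add[OF _ free_car_minus, of p X q] by simp

lemma free_compD:
  assumes "p \<in> free_comp A i X n"
  shows "i \<le> n \<Longrightarrow> p x \<in> gr A (n - i)" "\<not> i \<le> n \<Longrightarrow> p x = 0"
  using assms by (auto simp: free_comp_def split: if_splits)

lemma free_comp_SucD: "p \<in> free_comp A i X (Suc i) \<Longrightarrow> p x \<in> gr A 1"
  using free_compD(1)[of p i X "Suc i" x] by simp

lemma free_comp_minus: "p \<in> free_comp A i X n \<Longrightarrow> - p \<in> free_comp A i X n"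
  by (auto simp: free_comp_def free_car_minus gr_minus)

lemma free_comp_diff: "p \<in> free_comp A i X n \<Longrightarrow> q \<in> free_comp A i X n \<Longrightarrow> p - q \<in> free_comp A i X n"
  by (auto simp: free_comp_def free_car_diff gr_diff)

lemma free_comp_add: "p \<in> free_comp A i X n \<Longrightarrow> q \<in> free_comp A i X n \<Longrightarrow> p + q \<in> free_comp A i X n"
  by (auto simp: free_comp_def free_car_add gr_add)

lemma act_free_comp:
  assumes a: "a \<in> gr A k" and p: "p \<in> free_comp A i X n"
  shows "act A a p \<in> free_comp A i X (k + n)"
proof -
  have "act A a p x \<in> (if i \<le> k + n then gr A (k + n - i) else {0})" for x
  proof (cases "i \<le> n")
    case True
    then show ?thesis using mult_comp[OF a free_compD(1)[OF p True, of x]] by (simp add: act_def)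
  next
    case False
    then show ?thesis using free_compD(2)[OF p False, of x] gr_zero
      by (auto simp: act_def mult_zero gr_car[OF a])
  qed
  then show ?thesis using act_free_car[OF gr_car[OF a] free_comp_car[OF p]] by (simp add: free_comp_def)
qed

lemma act_add:
  assumes "a \<in> car A" "p \<in> free_car A X" "q \<in> free_car A X"
  shows "act A a (p + q) = act A a p + act A a q"
  using assms by (auto simp: act_def fun_eq_iff distrib_left free_carD(2))

lemma act_minus:
  assumes "a \<in> car A" "p \<in> free_car A X"
  shows "act A a (- p) = - act A a p"
  using assms by (auto simp: act_def fun_eq_iff mult_minus_right free_carD(2))

lemma linear_gensD:
  assumes "linear_gens A i X Y D" "x \<in> X"
  shows "D x \<in> free_comp A i Y (Suc i)" "D x \<in> free_car A Y" "D x y \<in> gr A 1" "D x y \<in> car A"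
proof -
  show D: "D x \<in> free_comp A i Y (Suc i)" using assms unfolding linear_gens_def by blast
  show "D x \<in> free_car A Y" "D x y \<in> gr A 1" "D x y \<in> car A"
    using free_comp_car[OF D] free_comp_SucD[OF D] gr_car[OF free_comp_SucD[OF D]] .
qed

text \<open>Summing over any finite set between the support and \<open>X\<close> lets several
  elements be compared over one index set.\<close>

lemma free_ext_apply:
  assumes D: "linear_gens A i X Y D" and F: "finite F" "{x. p x \<noteq> 0} \<subseteq> F" "F \<subseteq> X"
  shows "free_ext A D p y = (\<Sum>x\<in>F. mult A (p x) (D x y))"
  unfolding free_ext_def sum_apply act_def
  by (rule sum.mono_neutral_left[OF F(1,2)])
    (use F(3) linear_gensD(4)[OF D] in \<open>auto simp: mult_zero_left subset_iff\<close>)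

lemma free_ext_car:
  assumes D: "linear_gens A i X Y D" and p: "p \<in> free_car A X"
  shows "free_ext A D p \<in> free_car A Y"
  unfolding free_ext_def
  by (rule free_car_sum, rule act_free_car) (use linear_gensD(2)[OF D] free_carD(2,4)[OF p] in auto)

lemma free_ext_add:
  assumes D: "linear_gens A i X Y D" and p: "p \<in> free_car A X" and q: "q \<in> free_car A X"
  shows "free_ext A D (p + q) = free_ext A D p + free_ext A D q"
proof
  fix y
  let ?F = "{x. p x \<noteq> 0} \<union> {x. q x \<noteq> 0}"
  have F: "finite ?F" "?F \<subseteq> X" using free_carD(1,4)[OF p] free_carD(1,4)[OF q] by auto
  have E: "free_ext A D r y = (\<Sum>x\<in>?F. mult A (r x) (D x y))" if "{x. r x \<noteq> 0} \<subseteq> ?F" for r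
    by (rule free_ext_apply[OF D F(1) that F(2)])
  have "free_ext A D (p + q) y = (\<Sum>x\<in>?F. mult A ((p + q) x) (D x y))"
    by (rule E) auto
  also have "\<dots> = (\<Sum>x\<in>?F. mult A (p x) (D x y) + mult A (q x) (D x y))"
    by (rule sum.cong[OF refl])
      (use F(2) linear_gensD(4)[OF D] in \<open>auto simp: distrib_right free_carD(2)[OF p] free_carD(2)[OF q]\<close>)
  also have "\<dots> = free_ext A D p y + free_ext A D q y"
    using E[of p] E[of q] by (simp add: sum.distrib)
  finally show "free_ext A D (p + q) y = (free_ext A D p + free_ext A D q) y" by simp
qed

lemma free_ext_act:
  assumes D: "linear_gens A i X Y D" and a: "a \<in> car A" and p: "p \<in> free_car A X"
  shows "free_ext A D (act A a p) = act A a (free_ext A D p)"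
proof
  fix y
  let ?F = "{x. p x \<noteq> 0}"
  have F: "finite ?F" "?F \<subseteq> X" using free_carD(1,4)[OF p] by auto
  have Dc: "D x y \<in> car A" if "x \<in> ?F" for x using that F(2) linear_gensD(4)[OF D] by blast
  have "free_ext A D (act A a p) y = (\<Sum>x\<in>?F. mult A (act A a p x) (D x y))"
    by (rule free_ext_apply[OF D F(1) _ F(2)]) (use a in \<open>auto simp: act_def mult_zero\<close>)
  also have "\<dots> = (\<Sum>x\<in>?F. mult A a (mult A (p x) (D x y)))"
    by (rule sum.cong) (use a Dc free_carD(2)[OF p] in \<open>auto simp: act_def mult_assoc\<close>)
  also have "\<dots> = mult A a (\<Sum>x\<in>?F. mult A (p x) (D x y))"
    by (rule mult_sum_right[symmetric]) (use a Dc free_carD(2)[OF p] mult_car in auto)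
  also have "\<dots> = mult A a (free_ext A D p y)"
    unfolding free_ext_apply[OF D F(1) subset_refl F(2)] ..
  finally show "free_ext A D (act A a p) y = act A a (free_ext A D p) y" by (simp add: act_def)
qed

lemma free_ext_gen:
  assumes D: "linear_gens A i X Y D" and x: "x \<in> X"
  shows "free_ext A D (gen A x) = D x"
proof
  fix y
  have "free_ext A D (gen A x) y = (\<Sum>z\<in>{x}. mult A (gen A x z) (D z y))"
    by (rule free_ext_apply[OF D]) (use x in \<open>auto simp: gen_def\<close>)
  then show "free_ext A D (gen A x) y = D x y"
    using linear_gensD(4)[OF D x] by (simp add: gen_def unit_left)
qed

lemma free_ext_zero: "free_ext A D 0 = 0"
  by (simp add: free_ext_def)

lemma free_ext_minus:
  assumes D: "linear_gens A i X Y D" and p: "p \<in> free_car A X"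
  shows "free_ext A D (- p) = - free_ext A D p"
  using free_ext_add[OF D p free_car_minus[OF p]]
  by (simp add: free_ext_zero eq_neg_iff_add_eq_0 add.commute)

lemma free_ext_comp:
  assumes D: "linear_gens A i X Y D" and p: "p \<in> free_comp A (Suc i) X n"
  shows "free_ext A D p \<in> free_comp A i Y n"
proof -
  note pc = free_comp_car[OF p]
  have "free_ext A D p y \<in> (if i \<le> n then gr A (n - i) else {0})" for y
  proof (cases "Suc i \<le> n")
    case True
    have "mult A (p x) (D x y) \<in> gr A (n - i)" if "p x \<noteq> 0" for x
      using mult_comp[OF free_compD(1)[OF p True] linear_gensD(3)[OF D free_carD(4)[OF pc that]], of x y]
      True by (simp add: Suc_diff_Suc)
    then have "free_ext A D p y \<in> gr A (n - i)"
      by (auto simp: free_ext_def sum_apply act_def intro!: gr_sum)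
    then show ?thesis using True by simp
  next
    case False
    then have "{x. p x \<noteq> 0} = {}" using free_compD(2)[OF p] by auto
    then have "free_ext A D p y = 0" by (simp only: free_ext_def sum.empty zero_fun_apply)
    then show ?thesis using gr_zero by simp
  qed
  then show ?thesis using free_ext_car[OF D pc] by (simp add: free_comp_def)
qed

text \<open>The index counts the degree of entries, not of module elements: the source generators
  lie one degree above those of the target, so entries of degree \<open>n\<close> go to entries of
  degree \<open>Suc n\<close>.\<close>

lemma free_ext_hcomp:
  assumes D: "linear_gens A i X Y D" and p: "p \<in> free_car A X"
  shows "hcomp A (Suc n) (free_ext A D p y) = free_ext A D (\<lambda>x. hcomp A n (p x)) y"
    and "hcomp A 0 (free_ext A D p y) = 0"
proof -
  let ?F = "{x. p x \<noteq> 0}"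
  have F: "finite ?F" "?F \<subseteq> X" using free_carD(1,4)[OF p] by auto
  have D1: "D x y \<in> gr A 1" if "x \<in> ?F" for x using that F(2) linear_gensD(3)[OF D] by blast
  note E = free_ext_apply[OF D F(1) subset_refl F(2), of y]
  have m: "mult A (p x) (D x y) \<in> car A" if "x \<in> ?F" for x
    using mult_car free_carD(2)[OF p] gr_car[OF D1[OF that]] by blast
  have "hcomp A (Suc n) (free_ext A D p y) = (\<Sum>x\<in>?F. mult A (hcomp A n (p x)) (D x y))"
    unfolding E
    by (subst hcomp_sum, erule m) (rule sum.cong[OF refl], rule hcomp_mult_1(1)[OF free_carD(2)[OF p] D1])
  also have "\<dots> = free_ext A D (\<lambda>x. hcomp A n (p x)) y"
    by (rule free_ext_apply[OF D F(1) _ F(2), symmetric]) (auto simp: hcomp_zero)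
  finally show "hcomp A (Suc n) (free_ext A D p y) = free_ext A D (\<lambda>x. hcomp A n (p x)) y" .
  show "hcomp A 0 (free_ext A D p y) = 0"
    unfolding E
    by (subst hcomp_sum, erule m) (use hcomp_mult_1(2)[OF free_carD(2)[OF p] D1] in \<open>blast intro: sum.neutral\<close>)
qed

lemma free_comp_hcomp:
  assumes "p \<in> free_car A X"
  shows "(\<lambda>x. hcomp A n (p x)) \<in> free_comp A i X (i + n)"
  using assms hcomp_zero
  by (auto simp: free_comp_def free_car_def hcomp_gr hcomp_car elim: finite_subset[rotated])

lemma hcomp_free_comp:
  assumes "p \<in> free_comp A i X (i + n)"
  shows "(\<lambda>x. hcomp A n (p x)) = p"
proof
  fix x
  have "p x \<in> gr A n" using free_compD(1)[OF assms, of x] by simp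
  then show "hcomp A n (p x) = p x" by (simp add: hcomp_homogeneous)
qed

section \<open>Homomorphisms of free modules and generation in degree 1\<close>

lemma free_hom_eq_ext:
  assumes h: "free_hom A (Suc i) X i Y d" and p: "p \<in> free_car A X"
  shows "d p = free_ext A (\<lambda>x. d (gen A x)) p"
  using free_hom_expand(1)[OF assms] by (simp add: free_ext_def)

lemma free_hom_gens:
  assumes "free_hom A (Suc i) X i Y d"
  shows "linear_gens A i X Y (\<lambda>x. d (gen A x))"
  unfolding linear_gens_def using free_homD(3)[OF assms gen_free_comp] by blast

text \<open>An arbitrary preimage is cut down to its entries of degree \<open>n\<close>. As
  \<open>d\<close> raises the degree of entries by one, this part alone already maps to the
  homogeneous element \<open>u\<close>.\<close>

lemma free_hom_image_homogeneous:
  assumes h: "free_hom A (Suc i) X i Y d" and u: "u \<in> free_comp A i Y (i + Suc n)"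
    and im: "u \<in> d ` free_car A X"
  obtains p where "p \<in> free_comp A (Suc i) X (Suc i + n)" "u = d p"
proof -
  obtain q where q: "q \<in> free_car A X" "u = d q" using im by blast
  define p where "p = (\<lambda>x. hcomp A n (q x))"
  have p: "p \<in> free_comp A (Suc i) X (Suc i + n)" unfolding p_def by (rule free_comp_hcomp[OF q(1)])
  have "u = (\<lambda>y. hcomp A (Suc n) (u y))" using hcomp_free_comp[OF u] by simp
  also have "\<dots> = d p"
    unfolding q(2) free_hom_eq_ext[OF h q(1)] free_hom_eq_ext[OF h free_comp_car[OF p]]
    unfolding p_def by (rule HOL.ext, rule free_ext_hcomp(1)[OF free_hom_gens[OF h] q(1)])
  finally show ?thesis using that p by blast
qed

lemma free_hom_0:
  assumes "free_hom A i X j Y d"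
  shows "d 0 = 0"
proof -
  have "d (0 + 0) = d 0 + d 0" by (rule free_homD(1)[OF assms free_car_zero free_car_zero])
  then show ?thesis by simp
qed

lemma hom_to_field_expand:
  assumes e: "hom_to_field A 0 X e" and p: "p \<in> free_car A X"
  shows "e p = (\<Sum>x\<in>{x. p x \<noteq> 0}. augmentation A (p x) * e (gen A x))"
proof -
  note pD = free_carD(2,4)[OF p]
  have "e p = e (\<Sum>x\<in>{x. p x \<noteq> 0}. act A (p x) (gen A x))"
    using free_car_decompose[OF p] by simp
  also have "\<dots> = (\<Sum>x\<in>{x. p x \<noteq> 0}. e (act A (p x) (gen A x)))"
  proof (rule additive_sum[where X = X])
    show "e (p + q) = e p + e q" if "p \<in> free_car A X" "q \<in> free_car A X" for p q
      by (rule hom_to_fieldD(1)[OF e that])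
    show "act A (p x) (gen A x) \<in> free_car A X" if "x \<in> {x. p x \<noteq> 0}" for x
      using act_free_car[OF pD(1) gen_free_car[OF pD(2)]] that by blast
  qed (rule free_carD(1)[OF p])
  also have "\<dots> = (\<Sum>x\<in>{x. p x \<noteq> 0}. augmentation A (p x) * e (gen A x))"
    by (rule sum.cong[OF refl], rule hom_to_fieldD(2)[OF e pD(1)], rule gen_free_car) (use pD(2) in blast)
  finally show ?thesis .
qed

text \<open>For a generator \<open>x\<close> of \<open>X 0\<close> the element \<open>a e_x\<close>
  has positive degree, so \<open>e\<close> kills it and it equals some \<open>d 0 q\<close>. The
  matrix of \<open>d 0\<close> has entries in \<open>gr A 1\<close>, and the coordinate at
  \<open>x\<close> exhibits \<open>a\<close> as a sum of products.\<close>

lemma koszul_generated_degree_1: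
  fixes X :: "nat \<Rightarrow> 'x set"
  assumes res: "linear_free_resolution A X d e" and a: "a \<in> gr A (Suc n)"
  shows "\<exists>I u v. finite I \<and> (\<forall>i\<in>I. u i \<in> gr A n \<and> v i \<in> gr A 1) \<and> a = (\<Sum>i\<in>(I :: 'x set). mult A (u i) (v i))"
proof -
  have h: "free_hom A (Suc 0) (X (Suc 0)) 0 (X 0) (d 0)"
    and e: "hom_to_field A 0 (X 0) e" and es: "e ` free_car A (X 0) = UNIV"
    and ex: "{p \<in> free_car A (X 0). e p = 0} = d 0 ` free_car A (X (Suc 0))"
    using res by (simp_all add: linear_free_resolution_def)
  obtain x where x: "x \<in> X 0"
  proof -
    have "\<exists>p\<in>free_car A (X 0). e p = 1" using es by (metis UNIV_I imageE)
    then obtain p where p: "p \<in> free_car A (X 0)" "e p = 1" by blast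
    have "{x. p x \<noteq> 0} \<noteq> {}"
    proof
      assume "{x. p x \<noteq> 0} = {}"
      then have "e p = 0" unfolding hom_to_field_expand[OF e p(1)] by (simp only: sum.empty)
      then show False using p by simp
    qed
    then show ?thesis using that free_carD(4)[OF p(1)] by auto
  qed
  note ac = gr_car[OF a]
  let ?p = "act A a (gen A x)"
  have p: "?p \<in> free_comp A 0 (X 0) (Suc n)"
    using act_free_comp[OF a gen_free_comp[OF x, of 0]] by simp
  have "e ?p = 0" using hom_to_fieldD(3)[OF e _ p] by simp
  then have "?p \<in> d 0 ` free_car A (X (Suc 0))" unfolding ex[symmetric] using free_comp_car[OF p] by simp
  then obtain q where q: "q \<in> free_comp A (Suc 0) (X (Suc 0)) (Suc 0 + n)" "?p = d 0 q"
    using free_hom_image_homogeneous[OF h, of ?p n] p by auto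
  note qc = free_comp_car[OF q(1)]
  have "a = ?p x" by (simp add: act_def gen_def unit_right ac)
  also have "\<dots> = (\<Sum>z\<in>{z. q z \<noteq> 0}. mult A (q z) (d 0 (gen A z) x))"
    unfolding q(2) free_hom_expand(1)[OF h qc] sum_apply by (simp add: act_def)
  finally show ?thesis
    using free_carD(1,4)[OF qc] free_compD(1)[OF q(1)] linear_gensD(3)[OF free_hom_gens[OF h]]
    by (intro exI[of _ "{z. q z \<noteq> 0}"] exI[of _ q] exI[of _ "\<lambda>z. d 0 (gen A z) x"]) auto
qed

text \<open>Stated with additivity and \<open>A\<close>-linearity alone, so that composites of
  several extensions can be compared on generators directly.\<close>

lemma free_hom_eqI:
  fixes F G :: "('x \<Rightarrow> 'a) \<Rightarrow> 'y \<Rightarrow> 'a"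
  assumes F: "\<And>p q. \<lbrakk>p \<in> free_car A X; q \<in> free_car A X\<rbrakk> \<Longrightarrow> F (p + q) = F p + F q"
      "\<And>a p. \<lbrakk>a \<in> car A; p \<in> free_car A X\<rbrakk> \<Longrightarrow> F (act A a p) = act A a (F p)"
    and G: "\<And>p q. \<lbrakk>p \<in> free_car A X; q \<in> free_car A X\<rbrakk> \<Longrightarrow> G (p + q) = G p + G q"
      "\<And>a p. \<lbrakk>a \<in> car A; p \<in> free_car A X\<rbrakk> \<Longrightarrow> G (act A a p) = act A a (G p)"
    and gen: "\<And>x. x \<in> X \<Longrightarrow> F (gen A x) = G (gen A x)"
    and p: "p \<in> free_car A X"
  shows "F p = G p"
proof -
  note pD = free_carD[OF p]
  have g: "act A (p x) (gen A x) \<in> free_car A X" if "x \<in> {x. p x \<noteq> 0}" for x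
    using act_free_car[OF pD(2) gen_free_car[OF pD(4)]] that by blast
  have E: "H p = (\<Sum>x\<in>{x. p x \<noteq> 0}. act A (p x) (H (gen A x)))"
    if H: "\<And>p q. \<lbrakk>p \<in> free_car A X; q \<in> free_car A X\<rbrakk> \<Longrightarrow> H (p + q) = H p + H q"
      "\<And>a p. \<lbrakk>a \<in> car A; p \<in> free_car A X\<rbrakk> \<Longrightarrow> H (act A a p) = act A a (H p)"
    for H :: "('x \<Rightarrow> 'a) \<Rightarrow> 'y \<Rightarrow> 'a"
  proof -
    have "H p = H (\<Sum>x\<in>{x. p x \<noteq> 0}. act A (p x) (gen A x))"
      using free_car_decompose[OF p] by simp
    also have "\<dots> = (\<Sum>x\<in>{x. p x \<noteq> 0}. H (act A (p x) (gen A x)))"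
      by (rule additive_sum[where X = X, OF H(1) pD(1) g])
    also have "\<dots> = (\<Sum>x\<in>{x. p x \<noteq> 0}. act A (p x) (H (gen A x)))"
      by (rule sum.cong[OF refl], rule H(2)[OF pD(2)], rule gen_free_car) (use pD(4) in blast)
    finally show ?thesis .
  qed
  have "(\<Sum>x\<in>{x. p x \<noteq> 0}. act A (p x) (F (gen A x))) = (\<Sum>x\<in>{x. p x \<noteq> 0}. act A (p x) (G (gen A x)))"
  proof (rule sum.cong[OF refl])
    fix x assume "x \<in> {x. p x \<noteq> 0}"
    then have "x \<in> X" using pD(4) by blast
    then show "act A (p x) (F (gen A x)) = act A (p x) (G (gen A x))" by (simp only: gen)
  qed
  then show ?thesis using E[OF F] E[OF G] by (simp only:)
qed

section \<open>The augmentation as an algebra homomorphism\<close>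

lemma scale_unit_augmentation: "a \<in> car A \<Longrightarrow> hcomp A 0 a = scl A (augmentation A a) (unit A)"
proof -
  assume "a \<in> car A"
  then obtain c where c: "hcomp A 0 a = scl A c (unit A)" using hcomp_gr[of a 0] unfolding connected by blast
  then have "augmentation A a = c"
    unfolding augmentation_def using unit_nonzero by (auto intro!: the_equality dest: scale_right_imp_eq)
  then show ?thesis using c by simp
qed

lemma augmentation_eqI: "a \<in> car A \<Longrightarrow> hcomp A 0 a = scl A c (unit A) \<Longrightarrow> augmentation A a = c"
  unfolding scale_unit_augmentation using unit_nonzero by (auto dest: scale_right_imp_eq)

lemma augmentation_eq_zero: "a \<in> car A \<Longrightarrow> hcomp A 0 a = 0 \<Longrightarrow> augmentation A a = 0"
  by (rule augmentation_eqI) auto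

lemma augmentation_zero: "augmentation A 0 = 0"
  by (rule augmentation_eq_zero) (auto simp: car_zero hcomp_zero)

lemma augmentation_add:
  "a \<in> car A \<Longrightarrow> b \<in> car A \<Longrightarrow> augmentation A (a + b) = augmentation A a + augmentation A b"
  by (rule augmentation_eqI) (auto simp: car_add hcomp_add scale_unit_augmentation scale_left_distrib)

text \<open>By additivity the factors may be taken homogeneous, and then both sides vanish unless
  both degrees are 0.\<close>

lemma hcomp_0_mult:
  assumes "a \<in> car A" and b: "b \<in> car A"
  shows "hcomp A 0 (mult A a b) = mult A (hcomp A 0 a) (hcomp A 0 b)"
  using assms(1)
proof (induction rule: car_induct)
  case (homogeneous m x)
  note xc = gr_car[OF homogeneous]
  show ?case using b
  proof (induction rule: car_induct)
    case (homogeneous n y)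
    note yc = gr_car[OF homogeneous]
    have "mult A x y \<in> gr A (m + n)" using mult_comp \<open>x \<in> gr A m\<close> homogeneous by blast
    then show ?case using \<open>x \<in> gr A m\<close> homogeneous xc yc
      by (auto simp: hcomp_homogeneous mult_zero mult_zero_left car_zero)
  next
    case (add y z)
    then show ?case using xc by (simp add: distrib_left hcomp_add mult_car hcomp_car)
  qed
next
  case (add x y)
  then show ?case using b by (simp add: distrib_right hcomp_add mult_car hcomp_car)
qed

lemma augmentation_mult:
  assumes "a \<in> car A" "b \<in> car A"
  shows "augmentation A (mult A a b) = augmentation A a * augmentation A b"
proof (rule augmentation_eqI[OF mult_car[OF assms]])
  show "hcomp A 0 (mult A a b) = scl A (augmentation A a * augmentation A b) (unit A)"
    unfolding hcomp_0_mult[OF assms] scale_unit_augmentation[OF assms(1)] scale_unit_augmentation[OF assms(2)]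
    by (simp add: scale_mult_left scale_mult_right unit_car car_scale unit_left)
qed

text \<open>A sum over the fixed set \<open>X\<close> instead of the support of \<open>p\<close> is
  additive term by term, and the same formula makes sense over another algebra.\<close>

lemma hom_to_field_expand_finite:
  assumes e: "hom_to_field A 0 X e" and p: "p \<in> free_car A X" and X: "finite X"
  shows "e p = (\<Sum>x\<in>X. augmentation A (p x) * e (gen A x))"
  unfolding hom_to_field_expand[OF e p]
  by (rule sum.mono_neutral_left[OF X]) (use free_carD(4)[OF p] in \<open>auto simp: augmentation_zero\<close>)

end

section \<open>Extensions of an algebra by words\<close>

text \<open>This isolates the structure of the twisted product on which the homological argument
  rests: \<open>\<iota>\<close> embeds \<open>A\<close>, and \<open>coef w\<close> reads off the
  left \<open>A\<close>-coordinate at the word \<open>w\<close>. The conditions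
  \<open>letter'_iota\<close> and \<open>letter''_iota\<close> are the form taken by separability.
  They concern degree 1, and \<open>generated\<close> extends their consequences to all of
  \<open>A\<close>.\<close>

locale free_word_extension =
  A: connected_graded_algebra A + C: connected_graded_algebra C
  for A :: "('k::field, 'a::ab_group_add) galg" and C :: "('k, 'c::ab_group_add) galg" +
  fixes \<iota> :: "'a \<Rightarrow> 'c" and S' S'' :: "'l set" and letter :: "'l \<Rightarrow> 'c"
    and coef :: "'l list \<Rightarrow> 'c \<Rightarrow> 'a"
  assumes iota_add: "x \<in> car A \<Longrightarrow> y \<in> car A \<Longrightarrow> \<iota> (x + y) = \<iota> x + \<iota> y"
    and iota_scale: "x \<in> car A \<Longrightarrow> \<iota> (scl A k x) = scl C k (\<iota> x)"
    and iota_mult: "x \<in> car A \<Longrightarrow> y \<in> car A \<Longrightarrow> \<iota> (mult A x y) = mult C (\<iota> x) (\<iota> y)"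
    and iota_unit: "\<iota> (unit A) = unit C"
    and iota_gr: "x \<in> gr A n \<Longrightarrow> \<iota> x \<in> gr C n"
    and letters_disjoint: "S' \<inter> S'' = {}"
    and letter_gr: "s \<in> S' \<union> S'' \<Longrightarrow> letter s \<in> gr C 1"
    and coef_add: "c \<in> car C \<Longrightarrow> c' \<in> car C \<Longrightarrow> coef w (c + c') = coef w c + coef w c'"
    and coef_car: "c \<in> car C \<Longrightarrow> coef w c \<in> car A"
    and coef_mult: "a \<in> car A \<Longrightarrow> c \<in> car C \<Longrightarrow> coef w (mult C (\<iota> a) c) = mult A a (coef w c)"
    and coef_foldr: "w \<in> lists (S' \<union> S'') \<Longrightarrow>
          coef v (foldr (\<lambda>s. mult C (letter s)) w (unit C)) = (if v = w then unit A else 0)"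
    and coef_finite: "c \<in> car C \<Longrightarrow> finite {w. coef w c \<noteq> 0}"
    and coef_lists: "c \<in> car C \<Longrightarrow> coef w c \<noteq> 0 \<Longrightarrow> w \<in> lists (S' \<union> S'')"
    and coef_expand: "c \<in> car C \<Longrightarrow>
          c = (\<Sum>w\<in>{w. coef w c \<noteq> 0}. mult C (\<iota> (coef w c)) (foldr (\<lambda>s. mult C (letter s)) w (unit C)))"
    and generated: "gr A (Suc n) \<subseteq> A.span {mult A u v | u v. u \<in> gr A n \<and> v \<in> gr A 1}"
    and letter'_iota: "\<lbrakk>s \<in> S'; a \<in> gr A 1; coef w (mult C (letter s) (\<iota> a)) \<noteq> 0\<rbrakk>
          \<Longrightarrow> w = [] \<or> (\<exists>t\<in>S'. w = [t])"
    and letter''_iota: "\<lbrakk>s \<in> S''; a \<in> gr A 1; coef w (mult C (letter s) (\<iota> a)) \<noteq> 0\<rbrakk>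
          \<Longrightarrow> \<exists>v. \<exists>t\<in>S''. w = v @ [t]"
begin

section \<open>Words, their coordinates over \<open>A\<close>, and supports\<close>

abbreviation S :: "'l set" where "S \<equiv> S' \<union> S''"

abbreviation prod_C :: "'c \<Rightarrow> 'c \<Rightarrow> 'c" (infixl "\<cdot>" 72) where "x \<cdot> y \<equiv> mult C x y"

definition word :: "'l list \<Rightarrow> 'c" where
  "word w = foldr (\<lambda>s. mult C (letter s)) w (unit C)"

lemma iota_car: "x \<in> car A \<Longrightarrow> \<iota> x \<in> car C"
  by (induction rule: A.car_induct) (auto intro: C.gr_car[OF iota_gr] simp: iota_add C.car_add)

lemma iota_zero: "\<iota> 0 = 0"
  using iota_add[of 0 0] A.car_zero by simp

lemma iota_sum: "(\<And>i. i \<in> I \<Longrightarrow> g i \<in> car A) \<Longrightarrow> \<iota> (sum g I) = (\<Sum>i\<in>I. \<iota> (g i))"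
  by (induction I rule: infinite_finite_induct) (auto simp: iota_zero iota_add A.car_sum)

lemma hcomp_iota: "x \<in> car A \<Longrightarrow> hcomp C n (\<iota> x) = \<iota> (hcomp A n x)"
  by (induction rule: A.car_induct)
    (auto simp: C.hcomp_homogeneous[OF iota_gr] A.hcomp_homogeneous iota_zero iota_add C.hcomp_add
      A.hcomp_add A.hcomp_car iota_car)

lemma letter_car: "s \<in> S \<Longrightarrow> letter s \<in> car C"
  using C.gr_car[OF letter_gr] .

lemma word_Nil: "word [] = unit C"
  and word_Cons: "word (s # w) = letter s \<cdot> word w"
  by (simp_all add: word_def)

lemma word_car: "w \<in> lists S \<Longrightarrow> word w \<in> car C"
  by (induction w) (auto simp: word_Nil word_Cons C.unit_car intro!: C.mult_car letter_car)

lemma word_append: "v \<in> lists S \<Longrightarrow> w \<in> lists S \<Longrightarrow> word (v @ w) = word v \<cdot> word w"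
  by (induction v) (auto simp: word_Nil word_Cons C.unit_left word_car C.mult_assoc letter_car)

lemma word_single: "s \<in> S \<Longrightarrow> word [s] = letter s"
  by (simp add: word_Nil word_Cons C.unit_right letter_car)

lemma coef_zero: "coef w 0 = 0"
  using coef_add[of 0 0 w] C.car_zero by simp

lemma coef_minus: "c \<in> car C \<Longrightarrow> coef w (- c) = - coef w c"
  using coef_add[of c "- c" w] C.car_minus[of c] by (simp add: coef_zero eq_neg_iff_add_eq_0 add.commute)

lemma coef_sum: "(\<And>i. i \<in> I \<Longrightarrow> g i \<in> car C) \<Longrightarrow> coef w (sum g I) = (\<Sum>i\<in>I. coef w (g i))"
  by (induction I rule: infinite_finite_induct) (auto simp: coef_zero coef_add C.car_sum)

lemma coef_monomial:
  "a \<in> car A \<Longrightarrow> w \<in> lists S \<Longrightarrow> coef v (\<iota> a \<cdot> word w) = (if v = w then a else 0)"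
  using coef_foldr[of w v] by (auto simp: coef_mult word_car A.unit_right A.mult_zero word_def[symmetric])

lemma coef_iota: "a \<in> car A \<Longrightarrow> coef v (\<iota> a) = (if v = [] then a else 0)"
  using coef_monomial[of a "[]" v] by (simp add: word_Nil C.unit_right iota_car)

lemma monomial_car: "a \<in> car A \<Longrightarrow> w \<in> lists S \<Longrightarrow> \<iota> a \<cdot> word w \<in> car C"
  by (intro C.mult_car iota_car word_car)

text \<open>The left \<open>A\<close>-submodule of \<open>C\<close> spanned by the words in
  \<open>W\<close>. The set \<open>W\<close> may contain lists with entries outside
  \<open>S\<close>; by \<open>coef_lists\<close> they contribute nothing.\<close>

definition supp_in :: "'l list set \<Rightarrow> 'c set" where
  "supp_in W = {c \<in> car C. \<forall>w. coef w c \<noteq> 0 \<longrightarrow> w \<in> W}"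

lemma supp_in_car: "c \<in> supp_in W \<Longrightarrow> c \<in> car C"
  by (simp add: supp_in_def)

lemma supp_inD: "c \<in> supp_in W \<Longrightarrow> coef w c \<noteq> 0 \<Longrightarrow> w \<in> W"
  by (simp add: supp_in_def)

lemma supp_in_UNIV: "c \<in> car C \<Longrightarrow> c \<in> supp_in UNIV"
  by (simp add: supp_in_def)

lemma supp_in_mono: "c \<in> supp_in W \<Longrightarrow> W \<inter> lists S \<subseteq> W' \<Longrightarrow> c \<in> supp_in W'"
  using coef_lists by (fastforce simp: supp_in_def)

lemma supp_in_zero: "0 \<in> supp_in W"
  by (simp add: supp_in_def C.car_zero coef_zero)

lemma supp_in_add: "c \<in> supp_in W \<Longrightarrow> c' \<in> supp_in W \<Longrightarrow> c + c' \<in> supp_in W"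
  unfolding supp_in_def by (auto simp: C.car_add coef_add) (metis add.right_neutral)

lemma supp_in_iota_mult: "a \<in> car A \<Longrightarrow> c \<in> supp_in W \<Longrightarrow> \<iota> a \<cdot> c \<in> supp_in W"
  unfolding supp_in_def by (auto simp: C.mult_car iota_car coef_mult) (metis A.mult_zero)

lemma supp_in_monomial:
  "a \<in> car A \<Longrightarrow> w \<in> lists S \<Longrightarrow> w \<in> W \<Longrightarrow> \<iota> a \<cdot> word w \<in> supp_in W"
  unfolding supp_in_def by (auto simp: monomial_car coef_monomial split: if_splits)

lemma supp_in_word: "w \<in> lists S \<Longrightarrow> w \<in> W \<Longrightarrow> word w \<in> supp_in W"
  using supp_in_monomial[OF A.unit_car, of w W] by (simp add: iota_unit C.unit_left word_car)

lemma supp_in_scale: "c \<in> supp_in W \<Longrightarrow> scl C k c \<in> supp_in W"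
  using supp_in_iota_mult[OF A.car_scale[OF A.unit_car], of c W k]
  by (simp add: iota_scale A.unit_car iota_unit C.scale_mult_left C.unit_car C.unit_left supp_in_car)

text \<open>Induction along the partial sums of \<open>coef_expand\<close>; the monomials that occur
  there have their words in \<open>W\<close>.\<close>

lemma supp_in_induct [consumes 1, case_names zero add monomial]:
  assumes c: "c \<in> supp_in W" and zero: "P 0"
    and add: "\<And>c c'. \<lbrakk>c \<in> car C; c' \<in> car C; P c; P c'\<rbrakk> \<Longrightarrow> P (c + c')"
    and monomial: "\<And>a w. \<lbrakk>a \<in> car A; w \<in> lists S; w \<in> W\<rbrakk> \<Longrightarrow> P (\<iota> a \<cdot> word w)"
  shows "P c"
proof -
  have cc: "c \<in> car C" using supp_in_car[OF c] .
  have m: "coef w c \<in> car A \<and> w \<in> lists S \<and> w \<in> W" if "w \<in> {w. coef w c \<noteq> 0}" for w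
    using that coef_car[OF cc] coef_lists[OF cc] supp_inD[OF c] by blast
  have "P (\<Sum>w\<in>I. \<iota> (coef w c) \<cdot> word w)" if I: "finite I" "I \<subseteq> {w. coef w c \<noteq> 0}" for I
    using I
  proof (induction I rule: finite_induct)
    case (insert w I)
    have "(\<Sum>w\<in>I. \<iota> (coef w c) \<cdot> word w) \<in> car C"
      by (rule C.car_sum, rule monomial_car) (use m insert in auto)
    then show ?case using insert m[of w] monomial monomial_car by (auto intro!: add)
  qed (use zero in auto)
  from this[OF coef_finite[OF cc] subset_refl] show ?thesis
    using coef_expand[OF cc] by (simp add: word_def)
qed

lemma coef_eq_zero: "c \<in> car C \<Longrightarrow> (\<And>w. coef w c = 0) \<Longrightarrow> c = 0"
  using coef_expand[of c] by simp

text \<open>On the right of a left \<open>A\<close>-expansion a letter is only appended to the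
  words, without any rewriting, so coordinates are merely relocated. This makes leading terms
  readable in \<open>correction_unique\<close>.\<close>

lemma coef_mult_letter:
  assumes c: "c \<in> car C" and s: "s \<in> S"
  shows "coef v (c \<cdot> letter s) = (if v \<noteq> [] \<and> last v = s then coef (butlast v) c else 0)"
  using supp_in_UNIV[OF c]
proof (induction rule: supp_in_induct)
  case zero
  then show ?case by (simp add: C.mult_zero_left letter_car[OF s] coef_zero)
next
  case (add c c')
  then show ?case by (simp add: C.distrib_right letter_car[OF s] coef_add C.mult_car)
next
  case (monomial a w)
  have "\<iota> a \<cdot> word w \<cdot> letter s = \<iota> a \<cdot> word (w @ [s])"
    using monomial s by (simp add: C.mult_assoc iota_car word_car letter_car word_append word_single)
  moreover have "v = w @ [s] \<longleftrightarrow> v \<noteq> [] \<and> last v = s \<and> butlast v = w"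
    by (metis append_butlast_last_id butlast_snoc last_snoc snoc_eq_iff_butlast)
  ultimately show ?case using monomial s by (simp add: coef_monomial)
qed

lemma supp_in_mult_letter:
  assumes c: "c \<in> supp_in W" and s: "s \<in> S" and W: "\<And>v. v \<in> W \<Longrightarrow> v @ [s] \<in> W'"
  shows "c \<cdot> letter s \<in> supp_in W'"
proof -
  have "w \<in> W'" if "coef w (c \<cdot> letter s) \<noteq> 0" for w
    using that W supp_inD[OF c, of "butlast w"]
    unfolding coef_mult_letter[OF supp_in_car[OF c] s]
    by (metis append_butlast_last_id)
  then show ?thesis using c s by (simp add: supp_in_def C.mult_car letter_car)
qed

lemma supp_in_mult_left:
  assumes x: "x \<in> car C" and c: "c \<in> supp_in W"
    and m: "\<And>a w. \<lbrakk>a \<in> car A; w \<in> lists S; w \<in> W\<rbrakk> \<Longrightarrow> x \<cdot> (\<iota> a \<cdot> word w) \<in> supp_in W'"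
  shows "x \<cdot> c \<in> supp_in W'"
  using c by (induction rule: supp_in_induct)
    (simp_all add: m C.mult_zero x supp_in_zero C.distrib_left supp_in_add)

text \<open>In contrast to \<open>supp_in_mult_left\<close>, bare words can be tested here: the
  coefficient stays on the far left, where \<open>supp_in\<close> is closed under multiplication by
  \<open>A\<close>.\<close>

lemma supp_in_mult_right:
  assumes x: "x \<in> car C" and c: "c \<in> supp_in W"
    and m: "\<And>w. \<lbrakk>w \<in> lists S; w \<in> W\<rbrakk> \<Longrightarrow> word w \<cdot> x \<in> supp_in W'"
  shows "c \<cdot> x \<in> supp_in W'"
  using c
proof (induction rule: supp_in_induct)
  case (monomial a w)
  have "\<iota> a \<cdot> (word w \<cdot> x) \<in> supp_in W'"
    by (rule supp_in_iota_mult[OF monomial(1) m[OF monomial(2,3)]])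
  then show ?case using monomial x by (simp add: C.mult_assoc iota_car word_car)
qed (simp_all add: C.mult_zero_left x supp_in_zero C.distrib_right supp_in_add)

lemma supp_in_mult_word:
  assumes c: "c \<in> supp_in W" and w: "w \<in> lists S" and W: "\<And>v. v \<in> W \<Longrightarrow> v @ w \<in> W'"
  shows "c \<cdot> word w \<in> supp_in W'"
proof (rule supp_in_mult_right[OF word_car[OF w] c])
  fix v assume v: "v \<in> lists S" "v \<in> W"
  show "word v \<cdot> word w \<in> supp_in W'"
    unfolding word_append[OF v(1) w, symmetric] by (rule supp_in_word) (use v w W in auto)
qed

text \<open>Stability under \<open>gr A 1\<close> passes to products because \<open>A\<close> is
  generated in degree 1. It matters that \<open>step\<close> is quantified over all
  \<open>c\<close>: for a product \<open>u v\<close> it is applied to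
  \<open>c \<cdot> \<iota> u\<close>, which the induction has already placed in
  \<open>supp_in W\<close>.\<close>

lemma supp_in_mult_iota:
  assumes step: "\<And>c v. c \<in> supp_in W \<Longrightarrow> v \<in> gr A 1 \<Longrightarrow> c \<cdot> \<iota> v \<in> supp_in W"
    and c: "c \<in> supp_in W" and a: "a \<in> car A"
  shows "c \<cdot> \<iota> a \<in> supp_in W"
proof -
  note cc = supp_in_car[OF c]
  define T where "T = {a \<in> car A. c \<cdot> \<iota> a \<in> supp_in W}"
  have T: "A.subspace T"
    unfolding T_def using cc
    by (intro A.subspaceI)
      (auto simp: A.car_zero A.car_add A.car_scale iota_zero iota_add iota_scale iota_car C.mult_zero
        C.distrib_left C.scale_mult_right intro: supp_in_zero supp_in_add supp_in_scale)
  have gr: "gr A n \<subseteq> T" for n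
  proof (induction n)
    case 0
    have "unit A \<in> T" using c cc by (simp add: T_def A.unit_car iota_unit C.unit_right)
    then show ?case unfolding A.connected using A.subspace_scale[OF T] by blast
  next
    case (Suc n)
    have "{mult A u v |u v. u \<in> gr A n \<and> v \<in> gr A 1} \<subseteq> T"
    proof clarify
      fix u v assume u: "u \<in> gr A n" and v: "v \<in> gr A 1"
      note uv = A.gr_car[OF u] A.gr_car[OF v]
      have "c \<cdot> \<iota> u \<cdot> \<iota> v \<in> supp_in W" using step[OF _ v, of "c \<cdot> \<iota> u"] u Suc by (auto simp: T_def)
      then show "mult A u v \<in> T"
        using uv cc by (simp add: T_def A.mult_car iota_mult C.mult_assoc iota_car)
    qed
    then show ?case using generated[of n] A.span_minimal[OF _ T] by blast
  qed
  have "a \<in> T" using a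
    by (induction rule: A.car_induct) (use gr A.subspace_add[OF T] in blast)+
  then show ?thesis by (simp add: T_def)
qed

text \<open>The span of the empty word and the single letters of \<open>S'\<close> is stable under
  right multiplication by \<open>gr A 1\<close>: the empty word stays empty, and a letter is covered
  by \<open>letter'_iota\<close>.\<close>

lemma letter'_mult:
  assumes s: "s \<in> S'" and a: "a \<in> car A"
  shows "letter s \<cdot> \<iota> a \<in> supp_in ({[]} \<union> {[t] | t. t \<in> S'})" (is "_ \<in> supp_in ?W")
proof (rule supp_in_mult_iota[OF _ _ a])
  have base: "letter t \<cdot> \<iota> v \<in> supp_in ?W" if "t \<in> S'" "v \<in> gr A 1" for t v
    using letter'_iota[OF that] that
    by (auto simp: supp_in_def C.mult_car letter_car iota_car A.gr_car)
  show "letter s \<in> supp_in ?W"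
    using supp_in_word[of "[s]" ?W] s word_single[of s] by auto
  fix c v assume c: "c \<in> supp_in ?W" and v: "v \<in> gr A 1"
  note vc = A.gr_car[OF v]
  show "c \<cdot> \<iota> v \<in> supp_in ?W"
  proof (rule supp_in_mult_right[OF iota_car[OF vc] c])
    fix w assume w: "w \<in> lists S" "w \<in> ?W"
    show "word w \<cdot> \<iota> v \<in> supp_in ?W"
    proof (cases "w = []")
      case True
      then show ?thesis using supp_in_monomial[of v "[]" ?W] vc
        by (simp add: word_Nil C.unit_left C.unit_right iota_car)
    next
      case False
      then obtain t where "t \<in> S'" "w = [t]" using w by auto
      then show ?thesis using base[OF _ v] word_single[of t] by simp
    qed
  qed
qed

text \<open>Left multiplication rewrites only what stands before the last letter of a word, so a
  last letter in \<open>S''\<close> survives.\<close>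

lemma letter''_left_ideal:
  assumes x: "x \<in> car C" and c: "c \<in> supp_in {v @ [t] | v t. t \<in> S''}" (is "_ \<in> supp_in ?W")
  shows "x \<cdot> c \<in> supp_in ?W"
proof (rule supp_in_mult_left[OF x c])
  fix a w assume a: "a \<in> car A" and w: "w \<in> lists S" "w \<in> ?W"
  then obtain v t where vt: "w = v @ [t]" "t \<in> S''" by blast
  then have v: "v \<in> lists S" using w by auto
  have "x \<cdot> (\<iota> a \<cdot> word v) \<cdot> letter t \<in> supp_in ?W"
    by (rule supp_in_mult_letter[where W = UNIV])
      (use x a v vt in \<open>auto intro!: supp_in_UNIV C.mult_car iota_car word_car\<close>)
  then show "x \<cdot> (\<iota> a \<cdot> word w) \<in> supp_in ?W"
    using x a v vt by (simp add: C.mult_assoc C.mult_car iota_car word_car letter_car word_append word_single)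
qed

text \<open>For a word \<open>u @ [t]\<close> with \<open>t\<close> in \<open>S''\<close>, moving
  \<open>t\<close> past degree 1 gives words ending in \<open>S''\<close>, and the left ideal
  property allows the prefix \<open>u\<close> to be put back.\<close>

lemma letter''_mult:
  assumes s: "s \<in> S''" and a: "a \<in> car A"
  shows "letter s \<cdot> \<iota> a \<in> supp_in {v @ [t] | v t. t \<in> S''}" (is "_ \<in> supp_in ?W")
proof (rule supp_in_mult_iota[OF _ _ a])
  have base: "letter t \<cdot> \<iota> v \<in> supp_in ?W" if "t \<in> S''" "v \<in> gr A 1" for t v
    using letter''_iota[OF that] that
    by (fastforce simp: supp_in_def C.mult_car letter_car iota_car A.gr_car)
  show "letter s \<in> supp_in ?W"
    using supp_in_word[of "[s]" ?W] s word_single[of s] by auto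
  fix c v assume c: "c \<in> supp_in ?W" and v: "v \<in> gr A 1"
  note vc = A.gr_car[OF v]
  show "c \<cdot> \<iota> v \<in> supp_in ?W"
  proof (rule supp_in_mult_right[OF iota_car[OF vc] c])
    fix w assume w: "w \<in> lists S" "w \<in> ?W"
    then obtain u t where ut: "w = u @ [t]" "t \<in> S''" by blast
    then have u: "u \<in> lists S" using w by auto
    have "word u \<cdot> (letter t \<cdot> \<iota> v) \<in> supp_in ?W"
      by (rule letter''_left_ideal[OF word_car[OF u] base[OF ut(2) v]])
    then show "word w \<cdot> \<iota> v \<in> supp_in ?W"
      using u ut vc by (simp add: C.mult_assoc iota_car word_car letter_car word_append word_single)
  qed
qed

text \<open>
  \<open>trail\<close> is the measure for rewriting \<open>s e\<^sub>x\<close> to \<open>L s x\<close> below: commuting a word past an element of \<open>A\<close>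
  does not increase its number of trailing letters from \<open>S'\<close>, and the rewriting removes one of them.
\<close>

definition trail :: "'l list \<Rightarrow> nat" where
  "trail w = length (takeWhile (\<lambda>s. s \<in> S') (rev w))"

lemma trail_snoc: "trail (w @ [s]) = (if s \<in> S' then Suc (trail w) else 0)"
  by (simp add: trail_def)

lemma trail_append: "trail (v @ w) = (if set w \<subseteq> S' then trail v + length w else trail w)"
proof (cases "set w \<subseteq> S'")
  case True
  then show ?thesis
    unfolding trail_def rev_append by (subst takeWhile_append2) auto
next
  case False
  then obtain x where "x \<in> set (rev w)" "x \<notin> S'" by auto
  then show ?thesis using False
    unfolding trail_def rev_append by (subst takeWhile_append1[of x]) auto
qed

text \<open>The first clause makes the relation inductive: a letter prepended to a word can lengthen
  the trailing block exactly when the whole word lies in \<open>S'\<close>, so this property has to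
  be tracked in both directions.\<close>

definition reduces_to :: "'l list \<Rightarrow> 'l list \<Rightarrow> bool" where
  "reduces_to u w \<longleftrightarrow> (set w \<subseteq> S' \<longleftrightarrow> set u \<subseteq> S') \<and> trail w \<le> trail u"

text \<open>The last letter of the word is moved past \<open>a\<close> first. Each further letter
  \<open>s\<close> then meets terms \<open>b w\<close>; only \<open>s \<cdot> \<iota> b\<close> has
  to be rewritten, and the words it yields are put in front of \<open>w\<close>.\<close>

lemma word_mult_iota:
  assumes "u \<in> lists S" and a: "a \<in> car A"
  shows "word u \<cdot> \<iota> a \<in> supp_in {w. reduces_to u w}"
  using assms(1)
proof (induction u)
  case Nil
  then show ?case using supp_in_monomial[of a "[]" "{w. reduces_to [] w}"] a
    by (simp add: word_Nil C.unit_left C.unit_right iota_car reduces_to_def)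
next
  case (Cons s u)
  then have s: "s \<in> S" and u: "u \<in> lists S" by auto
  let ?R = "{w. reduces_to (s # u) w}"
  have tr: "trail (x # v) = (if set v \<subseteq> S' then trail [x] + length v else trail v)" for x v
    using trail_append[of "[x]" v] by simp
  have tr1: "trail [x] = (if x \<in> S' then 1 else 0)" for x by (simp add: trail_def)
  have all: "set v \<subseteq> S' \<Longrightarrow> trail v = length v" for v
    using trail_append[of "[]" v] by (simp add: trail_def)
  have "letter s \<cdot> (word u \<cdot> \<iota> a) \<in> supp_in ?R"
  proof (rule supp_in_mult_left[OF letter_car[OF s] Cons.IH])
    fix b w assume b: "b \<in> car A" and w: "w \<in> lists S" "w \<in> {w. reduces_to u w}"
    have red: "set w \<subseteq> S' \<longleftrightarrow> set u \<subseteq> S'" "trail w \<le> trail u" using w by (auto simp: reduces_to_def)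
    have "letter s \<cdot> \<iota> b \<cdot> word w \<in> supp_in ?R"
    proof (cases "s \<in> S'")
      case True
      show ?thesis
      proof (rule supp_in_mult_word[OF letter'_mult[OF True b] w(1)])
        fix v assume v: "v \<in> {[]} \<union> {[t] |t. t \<in> S'}"
        \<comment> \<open>The prefix is empty or one letter of \<open>S'\<close>, so it adds at most
          the one trailing letter that \<open>s\<close> adds to \<open>u\<close>.\<close>
        show "v @ w \<in> ?R" using red v True tr[of s u] all[of w] all[of u] tr1[of s]
          by (auto simp: reduces_to_def trail_append tr1 trail_def[of "[]"] split: if_splits)
      qed
    next
      case False
      then have s'': "s \<in> S''" using s by simp
      show ?thesis
      proof (rule supp_in_mult_word[OF letter''_mult[OF s'' b] w(1)])
        fix v assume "v \<in> {v @ [t] |v t. t \<in> S''}"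
        then obtain v' t where v: "v = v' @ [t]" "t \<in> S''" by blast
        then have t: "t \<notin> S'" using letters_disjoint by auto
        \<comment> \<open>A prefix ending in \<open>S''\<close> adds no trailing letter and keeps
          the whole word from lying in \<open>S'\<close>, just as \<open>s\<close> does for
          \<open>u\<close>.\<close>
        have "trail v = 0" using v t by (simp add: trail_snoc)
        then show "v @ w \<in> ?R" using red v t False tr[of s u] tr[of t w] all[of w] all[of u] tr1[of s]
          by (auto simp: reduces_to_def trail_append split: if_splits)
      qed
    qed
    then show "letter s \<cdot> (\<iota> b \<cdot> word w) \<in> supp_in ?R"
      using s b w by (simp add: C.mult_assoc letter_car iota_car word_car)
  qed
  then show ?case using s u a by (simp add: word_Cons C.mult_assoc letter_car iota_car word_car)
qed

lemma supp_in_mult_iota_reduces: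
  assumes c: "c \<in> supp_in V" and a: "a \<in> car A"
  shows "c \<cdot> \<iota> a \<in> supp_in {w. \<exists>v\<in>V. reduces_to v w}"
proof (rule supp_in_mult_right[OF iota_car[OF a] c])
  fix w assume w: "w \<in> lists S" "w \<in> V"
  show "word w \<cdot> \<iota> a \<in> supp_in {w. \<exists>v\<in>V. reduces_to v w}"
    by (rule supp_in_mono[OF word_mult_iota[OF w(1) a]]) (use w in auto)
qed

section \<open>The correction maps and the decomposition of \<open>C^X\<close>\<close>

definition iota_fun :: "('x \<Rightarrow> 'a) \<Rightarrow> 'x \<Rightarrow> 'c" where
  "iota_fun p = (\<lambda>x. \<iota> (p x))"

lemma iota_fun_car: "p \<in> free_car A X \<Longrightarrow> iota_fun p \<in> free_car C X"
  by (auto simp: free_car_def iota_fun_def iota_car iota_zero elim: finite_subset[rotated])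

lemma iota_fun_comp: "p \<in> free_comp A i X n \<Longrightarrow> iota_fun p \<in> free_comp C i X n"
  using iota_fun_car[of p X]
  by (auto simp: free_comp_def iota_gr iota_zero iota_fun_def split: if_splits)

lemma iota_fun_add:
  "p \<in> free_car A X \<Longrightarrow> q \<in> free_car A X \<Longrightarrow> iota_fun (p + q) = iota_fun p + iota_fun q"
  by (auto simp: iota_fun_def fun_eq_iff iota_add A.free_carD(2))

lemma iota_fun_zero: "iota_fun 0 = 0"
  by (auto simp: iota_fun_def fun_eq_iff iota_zero)

text \<open>\<open>coef []\<close> is a left inverse of \<open>\<iota>\<close>.\<close>

lemma iota_fun_inj:
  assumes "p \<in> free_car A X" "iota_fun p = 0"
  shows "p = 0"
proof
  fix x
  have "\<iota> (p x) = 0" using fun_cong[OF assms(2), of x] by (simp add: iota_fun_def)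
  then show "p x = 0 x" using coef_iota[OF A.free_carD(2)[OF assms(1)], of "[]" x] by (simp add: coef_zero)
qed

text \<open>
  \<open>correction L\<close> is the map \<open>C\<^bsup>S \<times> X\<^esup> \<rightarrow> C\<^bsup>X\<^esup>\<close> with \<open>e\<^bsub>s,x\<^esub> \<mapsto> s e\<^sub>x - L s x\<close>.
\<close>

definition correction_gen :: "('l \<Rightarrow> 'x \<Rightarrow> 'x \<Rightarrow> 'a) \<Rightarrow> 'l \<times> 'x \<Rightarrow> 'x \<Rightarrow> 'c" where
  "correction_gen L = (\<lambda>(s, x). act C (letter s) (gen C x) - iota_fun (L s x))"

definition correction :: "('l \<Rightarrow> 'x \<Rightarrow> 'x \<Rightarrow> 'a) \<Rightarrow> ('l \<times> 'x \<Rightarrow> 'c) \<Rightarrow> 'x \<Rightarrow> 'c" where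
  "correction L = free_ext C (correction_gen L)"

text \<open>The degree condition makes \<open>correction L\<close> homogeneous. Vanishing on
  \<open>S''\<close> confines the rewriting to last letters from \<open>S'\<close>, whose removal
  lowers \<open>trail\<close>.\<close>

definition admissible :: "nat \<Rightarrow> 'x set \<Rightarrow> ('l \<Rightarrow> 'x \<Rightarrow> 'x \<Rightarrow> 'a) \<Rightarrow> bool" where
  "admissible i X L \<longleftrightarrow>
    (\<forall>s\<in>S. \<forall>x\<in>X. L s x \<in> free_comp A i X (Suc i)) \<and> (\<forall>s\<in>S''. \<forall>x\<in>X. L s x = 0)"

lemma admissibleD:
  assumes "admissible i X L" "x \<in> X"
  shows "s \<in> S \<Longrightarrow> L s x \<in> free_comp A i X (Suc i)" and "s \<in> S'' \<Longrightarrow> L s x = 0"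
    and "s \<in> S \<Longrightarrow> L s x \<in> free_car A X" and "s \<in> S \<Longrightarrow> L s x y \<in> car A"
proof -
  show c: "s \<in> S \<Longrightarrow> L s x \<in> free_comp A i X (Suc i)" and "s \<in> S'' \<Longrightarrow> L s x = 0"
    using assms unfolding admissible_def by blast+
  show d: "L s x \<in> free_car A X" if "s \<in> S"
    using A.free_comp_car[OF c[OF that]] .
  show "L s x y \<in> car A" if "s \<in> S"
    using A.free_carD(2)[OF d[OF that]] .
qed

lemma correction_gens:
  assumes "admissible i X L"
  shows "linear_gens C i (S \<times> X) X (correction_gen L)"
  unfolding linear_gens_def
proof
  fix z assume "z \<in> S \<times> X"
  then obtain s x where z: "z = (s, x)" "s \<in> S" "x \<in> X" by blast
  have "act C (letter s) (gen C x) \<in> free_comp C i X (1 + i)"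
    by (intro C.act_free_comp letter_gr C.gen_free_comp z)
  moreover have "iota_fun (L s x) \<in> free_comp C i X (Suc i)"
    by (rule iota_fun_comp[OF admissibleD(1)[OF assms z(3,2)]])
  ultimately show "correction_gen L z \<in> free_comp C i X (Suc i)"
    unfolding z correction_gen_def by (simp add: C.free_comp_diff)
qed

lemmas correction_car = C.free_ext_car[OF correction_gens, folded correction_def]
  and correction_add = C.free_ext_add[OF correction_gens, folded correction_def]
  and correction_act = C.free_ext_act[OF correction_gens, folded correction_def]
  and correction_minus = C.free_ext_minus[OF correction_gens, folded correction_def]
  and correction_on_gen = C.free_ext_gen[OF correction_gens, folded correction_def]
  and correction_comp = C.free_ext_comp[OF correction_gens, folded correction_def]

lemma correction_zero: "correction L 0 = 0"
  unfolding correction_def by (rule C.free_ext_zero)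

lemma correction_apply:
  assumes L: "admissible i X L" and q: "q \<in> free_car C (S \<times> X)"
  shows "correction L q y =
    (\<Sum>z\<in>{z. q z \<noteq> 0}. q z \<cdot> ((if y = snd z then letter (fst z) else 0) - \<iota> (L (fst z) (snd z) y)))"
proof -
  note qD = C.free_carD[OF q]
  have "correction L q y = (\<Sum>z\<in>{z. q z \<noteq> 0}. q z \<cdot> correction_gen L z y)"
    unfolding correction_def
    by (rule C.free_ext_apply[OF correction_gens[OF L] qD(1)]) (use qD(4) in auto)
  also have "\<dots> = (\<Sum>z\<in>{z. q z \<noteq> 0}. q z \<cdot> ((if y = snd z then letter (fst z) else 0) - \<iota> (L (fst z) (snd z) y)))"
  proof (rule sum.cong[OF refl])
    fix z assume "z \<in> {z. q z \<noteq> 0}"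
    then obtain s x where z: "z = (s, x)" "s \<in> S" "x \<in> X" using qD(4) by blast
    note lc = letter_car[OF z(2)]
    show "q z \<cdot> correction_gen L z y = q z \<cdot> ((if y = snd z then letter (fst z) else 0) - \<iota> (L (fst z) (snd z) y))"
      using lc by (simp add: z correction_gen_def iota_fun_def act_def gen_def C.unit_right C.mult_zero)
  qed
  finally show ?thesis .
qed

lemma coef_correction_term:
  assumes L: "admissible i X L" and q: "c \<in> car C" and z: "t \<in> S" "x \<in> X"
  shows "coef w (c \<cdot> ((if y = x then letter t else 0) - \<iota> (L t x y)))
    = (if y = x then coef w (c \<cdot> letter t) else 0) - coef w (c \<cdot> \<iota> (L t x y))"
    and "c \<cdot> ((if y = x then letter t else 0) - \<iota> (L t x y)) \<in> car C"
proof -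
  note l = admissibleD(4)[OF L z(2,1), of y]
  note lc = letter_car[OF z(1)]
  have m: "c \<cdot> (u - v) = c \<cdot> u - c \<cdot> v" if "u \<in> car C" "v \<in> car C" for u v
    using C.distrib_left[OF q that(1) C.car_minus[OF that(2)]] C.mult_minus_right[OF q that(2)] by simp
  have d: "coef w (u - v) = coef w u - coef w v" if "u \<in> car C" "v \<in> car C" for u v
    using coef_add[OF that(1) C.car_minus[OF that(2)]] coef_minus[OF that(2)] by simp
  show "coef w (c \<cdot> ((if y = x then letter t else 0) - \<iota> (L t x y)))
    = (if y = x then coef w (c \<cdot> letter t) else 0) - coef w (c \<cdot> \<iota> (L t x y))"
    using lc l q by (auto simp: m d C.car_zero iota_car C.mult_car C.mult_zero coef_zero)
  show "c \<cdot> ((if y = x then letter t else 0) - \<iota> (L t x y)) \<in> car C"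
    using lc l q by (auto intro!: C.mult_car C.car_diff C.car_minus iota_car simp: C.car_zero)
qed

text \<open>
  The coefficients of \<open>q\<close> at the words \<open>w s\<close> with the largest number of trailing letters from
  \<open>S'\<close> cannot be cancelled by the terms \<open>q(s, x) L s x\<close>.
\<close>

lemma correction_unique:
  assumes L: "admissible i X L" and a: "a \<in> free_car A X" and q: "q \<in> free_car C (S \<times> X)"
    and eq: "iota_fun a + correction L q = 0"
  shows "a = 0" and "q = 0"
proof -
  note qD = C.free_carD[OF q]
  note aD = A.free_carD[OF a]
  show q0: "q = 0"
  proof (rule ccontr)
    assume "q \<noteq> 0"
    \<comment> \<open>A pair consists of a generator \<open>z = (s, x)\<close> and a word
      \<open>w\<close> occurring in \<open>q z\<close>. Its leading word is \<open>w @ [s]\<close>,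
      and a pair with maximal \<open>trail\<close> of this word is examined.\<close>
    define T where "T = (SIGMA z:{z. q z \<noteq> 0}. {w. coef w (q z) \<noteq> 0})"
    have "finite T" unfolding T_def using qD(1) coef_finite[OF qD(2)] by blast
    moreover have "T \<noteq> {}"
    proof -
      obtain z where "q z \<noteq> 0" using \<open>q \<noteq> 0\<close> by (auto simp: fun_eq_iff)
      then show ?thesis using coef_eq_zero[OF qD(2), of z] by (auto simp: T_def)
    qed
    ultimately obtain z w where zw: "(z, w) \<in> T"
      and max: "\<And>z' w'. (z', w') \<in> T \<Longrightarrow> trail (w' @ [fst z']) \<le> trail (w @ [fst z])"
    proof -
      assume fin: "finite T" and ne: "T \<noteq> {}"
      let ?f = "\<lambda>(z, w). trail (w @ [fst z])"
      have "Max (?f ` T) \<in> ?f ` T" using fin ne by (intro Max_in) auto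
      then obtain z w where zw: "(z, w) \<in> T" "Max (?f ` T) = trail (w @ [fst z])" by auto
      have "trail (w' @ [fst z']) \<le> trail (w @ [fst z])" if "(z', w') \<in> T" for z' w'
        unfolding zw(2)[symmetric] by (rule Max_ge) (use fin that in \<open>force+\<close>)
      then show ?thesis using that zw(1) by blast
    qed
    obtain s x where z: "z = (s, x)" "s \<in> S" "x \<in> X" using zw qD(4)[of z] by (cases z) (auto simp: T_def)
    have nz: "coef w (q (s, x)) \<noteq> 0" "q (s, x) \<noteq> 0" using zw by (auto simp: T_def z)
    \<comment> \<open>In coordinate \<open>x\<close> the letter term of another generator
      \<open>(t, x)\<close> ends in a letter \<open>t \<noteq> s\<close>, and generators
      \<open>(t, y)\<close> with \<open>y \<noteq> x\<close> have no letter term. So the coefficient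
      at this word isolates \<open>q (s, x)\<close>.\<close>
    let ?w = "w @ [s]"
    have summand: "coef ?w (q z' \<cdot> ((if x = snd z' then letter (fst z') else 0) - \<iota> (L (fst z') (snd z') x)))
        = (if z' = (s, x) then coef w (q (s, x)) else 0)" if z'I: "z' \<in> {z. q z \<noteq> 0}" for z'
    proof -
      obtain t y where z': "z' = (t, y)" "t \<in> S" "y \<in> X" using z'I qD(4) by blast
      note l = admissibleD(4)[OF L z'(3,2), of x]
      have "coef ?w (q (t, y) \<cdot> \<iota> (L t y x)) = 0"
      proof (cases "t \<in> S'")
        case True
        have "q (t, y) \<in> supp_in {v. trail (v @ [t]) \<le> trail ?w}"
          using max[of z'] qD(2) z'I unfolding supp_in_def T_def z' z by auto
        \<comment> \<open>Each word of this product has \<open>trail\<close> at most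
          \<open>trail v\<close> for some \<open>v\<close> with
          \<open>trail (v @ [t]) \<le> trail ?w\<close>. As \<open>t\<close> lies in
          \<open>S'\<close>, \<open>trail v\<close> is strictly below \<open>trail ?w\<close>, so
          \<open>?w\<close> does not occur.\<close>
        from supp_in_mult_iota_reduces[OF this l] show ?thesis
        proof (rule contrapos_pp)
          assume ne: "coef ?w (q (t, y) \<cdot> \<iota> (L t y x)) \<noteq> 0"
          show "q (t, y) \<cdot> \<iota> (L t y x) \<notin> supp_in {w. \<exists>v\<in>{v. trail (v @ [t]) \<le> trail ?w}. reduces_to v w}"
          proof
            assume "q (t, y) \<cdot> \<iota> (L t y x) \<in> supp_in {w. \<exists>v\<in>{v. trail (v @ [t]) \<le> trail ?w}. reduces_to v w}"
            from supp_inD[OF this ne] obtain v where "trail (v @ [t]) \<le> trail ?w" "trail ?w \<le> trail v"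
              by (auto simp: reduces_to_def)
            then show False using True by (simp add: trail_snoc)
          qed
        qed
      next
        case False
        then have "L t y = 0" using admissibleD(2)[OF L z'(3)] z'(2) by blast
        then show ?thesis by (simp add: iota_zero C.mult_zero qD(2) coef_zero)
      qed
      then show ?thesis
        unfolding z' fst_conv snd_conv coef_correction_term(1)[OF L qD(2) z'(2,3)]
        using coef_mult_letter[OF qD(2) z'(2), of ?w "(t, y)"] by auto
    qed
    note cc = correction_car[OF L q]
    have "coef ?w (correction L q x) = (\<Sum>z'\<in>{z. q z \<noteq> 0}. if z' = (s, x) then coef w (q (s, x)) else 0)"
      unfolding correction_apply[OF L q]
    proof (subst coef_sum)
      fix z' assume "z' \<in> {z. q z \<noteq> 0}"
      then have "fst z' \<in> S" "snd z' \<in> X" using qD(4)[of z'] by auto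
      then show "q z' \<cdot> ((if x = snd z' then letter (fst z') else 0) - \<iota> (L (fst z') (snd z') x)) \<in> car C"
        by (rule coef_correction_term(2)[OF L qD(2)])
    qed (rule sum.cong[OF refl summand])
    also have "\<dots> = coef w (q (s, x))" using qD(1) nz by simp
    \<comment> \<open>The summand \<open>iota_fun a\<close> is supported on the empty word and hence
      invisible at the nonempty word \<open>?w\<close>.\<close>
    finally have "coef ?w (iota_fun a x + correction L q x) = coef w (q (s, x))"
      using aD(2) C.free_carD(2)[OF cc] by (simp add: coef_add iota_fun_def iota_car coef_iota)
    moreover have "iota_fun a x + correction L q x = 0" using fun_cong[OF eq, of x] by simp
    ultimately show False using nz by (simp add: coef_zero)
  qed
  have "iota_fun a = 0" using eq unfolding q0 correction_zero by simp
  then show "a = 0" by (rule iota_fun_inj[OF a])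
qed

text \<open>The parameter \<open>B\<close> restricts the \<open>A\<close>-component. With
  \<open>free_car A X\<close> membership means that a decomposition exists; with \<open>{0}\<close>
  it means lying in the image of the correction.\<close>

definition split_set :: "('l \<Rightarrow> 'x \<Rightarrow> 'x \<Rightarrow> 'a) \<Rightarrow> 'x set \<Rightarrow> ('x \<Rightarrow> 'a) set \<Rightarrow> ('x \<Rightarrow> 'c) set" where
  "split_set L X B = {p. \<exists>b q. b \<in> B \<and> q \<in> free_car C (S \<times> X) \<and> p = iota_fun b + correction L q}"

text \<open>Closure under sums suffices because coefficients from \<open>A\<close> are treated
  inside the monomials, which are then only added up.\<close>

definition additive_set :: "'x set \<Rightarrow> ('x \<Rightarrow> 'a) set \<Rightarrow> bool" where
  "additive_set X B \<longleftrightarrow> B \<subseteq> free_car A X \<and> 0 \<in> B \<and> (\<forall>b\<in>B. \<forall>b'\<in>B. b + b' \<in> B)"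

lemma split_setI:
  "b \<in> B \<Longrightarrow> q \<in> free_car C (S \<times> X) \<Longrightarrow> p = iota_fun b + correction L q \<Longrightarrow> p \<in> split_set L X B"
  unfolding split_set_def by (intro CollectI exI conjI)

lemma split_setE:
  assumes "p \<in> split_set L X B"
  obtains b q where "b \<in> B" "q \<in> free_car C (S \<times> X)" "p = iota_fun b + correction L q"
  using assms unfolding split_set_def by (elim CollectE exE conjE) (rule that)

lemma additive_setD:
  assumes "additive_set X B"
  shows "b \<in> B \<Longrightarrow> b \<in> free_car A X" and "0 \<in> B" and "b \<in> B \<Longrightarrow> b' \<in> B \<Longrightarrow> b + b' \<in> B"
  using assms unfolding additive_set_def by blast+

lemma split_set_zero: "additive_set X B \<Longrightarrow> 0 \<in> split_set L X B"
  by (rule split_setI[OF additive_setD(2) C.free_car_zero])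
    (simp_all only: iota_fun_zero correction_zero add_0_left)

lemma split_set_add:
  assumes L: "admissible i X L" and B: "additive_set X B"
    and p: "p \<in> split_set L X B" and p': "p' \<in> split_set L X B"
  shows "p + p' \<in> split_set L X B"
proof -
  obtain b q where bq: "b \<in> B" "q \<in> free_car C (S \<times> X)" "p = iota_fun b + correction L q"
    using p by (rule split_setE)
  obtain b' q' where bq': "b' \<in> B" "q' \<in> free_car C (S \<times> X)" "p' = iota_fun b' + correction L q'"
    using p' by (rule split_setE)
  show ?thesis
  proof (rule split_setI[OF additive_setD(3)[OF B bq(1) bq'(1)] C.free_car_add[OF bq(2) bq'(2)]])
    show "p + p' = iota_fun (b + b') + correction L (q + q')"
      unfolding bq(3) bq'(3) correction_add[OF L bq(2) bq'(2)]
        iota_fun_add[OF additive_setD(1)[OF B bq(1)] additive_setD(1)[OF B bq'(1)]]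
      by (simp only: ac_simps)
  qed
qed

text \<open>Reduction to monomials on a single generator. The bound \<open>W\<close> on the supports
  is there so that an induction hypothesis about certain words can be supplied as
  \<open>mon\<close>.\<close>

lemma split_setI_supp_in:
  assumes L: "admissible i X L" and B: "additive_set X B"
    and mon: "\<And>a w x. \<lbrakk>a \<in> car A; w \<in> lists S; w \<in> W; x \<in> X\<rbrakk> \<Longrightarrow> act C (\<iota> a \<cdot> word w) (gen C x) \<in> split_set L X B"
    and p: "p \<in> free_car C X" and W: "\<And>x. p x \<in> supp_in W"
  shows "p \<in> split_set L X B"
proof -
  have single: "act C c (gen C x) \<in> split_set L X B" if c: "c \<in> supp_in W" and x: "x \<in> X" for c x
    using c
  proof (induction rule: supp_in_induct)
    case zero
    have "act C 0 (gen C x) = 0"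
      by (auto simp: act_def gen_def fun_eq_iff C.mult_zero_left C.unit_car C.car_zero)
    then show ?case using split_set_zero[OF B] by metis
  next
    case (add c1 c2)
    have "act C (c1 + c2) (gen C x) = act C c1 (gen C x) + act C c2 (gen C x)"
      using add by (auto simp: act_def gen_def fun_eq_iff C.distrib_right C.unit_car C.mult_zero C.car_add)
    then show ?case using split_set_add[OF L B add(3,4)] by metis
  next
    case (monomial b v)
    then show ?case using mon x by blast
  qed
  have sum: "sum f I \<in> split_set L X B" if "\<And>i. i \<in> I \<Longrightarrow> f i \<in> split_set L X B"
    for f :: "'b \<Rightarrow> 'b \<Rightarrow> 'c" and I
    using that
  proof (induction I rule: infinite_finite_induct)
    case (insert i I)
    have i: "f i \<in> split_set L X B" and I: "sum f I \<in> split_set L X B"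
      using insert by blast+
    show ?case unfolding sum.insert[OF insert.hyps] by (rule split_set_add[OF L B i I])
  qed (simp_all only: sum.infinite sum.empty split_set_zero[OF B] not_False_eq_True)
  show ?thesis
    by (subst C.free_car_decompose[OF p], rule sum, rule single[OF W]) (use C.free_carD(4)[OF p] in blast)
qed

text \<open>For \<open>w = u @ [s]\<close>, the monomial \<open>a w e_x\<close> is the correction of
  \<open>a u e_(s,x)\<close> plus the remainder \<open>a u (L s x)\<close>. The remainder is 0 for
  \<open>s\<close> in \<open>S''\<close>; for \<open>s\<close> in \<open>S'\<close> its words have
  smaller \<open>trail\<close> and the induction applies.\<close>

lemma split_set_monomial:
  assumes L: "admissible i X L" and "x \<in> X" "w \<in> lists S" "a \<in> car A"
  shows "act C (\<iota> a \<cdot> word w) (gen C x) \<in> split_set L X (free_car A X)"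
  using assms(2-4)
proof (induction "trail w" arbitrary: w x a rule: less_induct)
  case less
  have B: "additive_set X (free_car A X)"
    unfolding additive_set_def using A.free_car_zero A.free_car_add by blast
  show ?case
  proof (cases w rule: rev_cases)
    case Nil
    \<comment> \<open>The rewriting ends here: \<open>a e_x\<close> already lies in the
      \<open>A\<close>-summand.\<close>
    show ?thesis
    proof (rule split_setI[OF A.act_free_car[OF less.prems(3) A.gen_free_car[OF less.prems(1)]] C.free_car_zero])
      show "act C (\<iota> a \<cdot> word w) (gen C x) = iota_fun (act A a (gen A x)) + correction L 0"
        unfolding correction_zero using less.prems
        by (auto simp: Nil word_Nil act_def gen_def fun_eq_iff iota_fun_def
            C.unit_right iota_car C.mult_zero A.mult_zero A.unit_right iota_zero)
    qed
  next
    case (snoc u s)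
    then have u: "u \<in> lists S" and s: "s \<in> S" using less.prems by auto
    let ?c = "\<iota> a \<cdot> word u"
    have c: "?c \<in> car C" using monomial_car less.prems u by blast
    define l where "l = act C ?c (iota_fun (L s x))"
    note Lc = admissibleD(3)[OF L less.prems(1) s]
    have lc: "l \<in> free_car C X" unfolding l_def by (rule C.act_free_car[OF c iota_fun_car[OF Lc]])
    have lM: "l \<in> split_set L X (free_car A X)"
    proof (cases "s \<in> S'")
      case False
      then have "L s x = 0" using admissibleD(2)[OF L less.prems(1)] s by blast
      then have "l = 0" using c by (auto simp: l_def iota_fun_def act_def fun_eq_iff iota_zero C.mult_zero)
      then show ?thesis using split_set_zero[OF B] by metis
    next
      case True
      show ?thesis
      proof (rule split_setI_supp_in[OF L B _ lc])
        fix y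
        have "?c \<in> supp_in {u}" using less.prems u by (intro supp_in_monomial) auto
        then have "?c \<cdot> \<iota> (L s x y) \<in> supp_in {w. \<exists>v\<in>{u}. reduces_to v w}"
          by (rule supp_in_mult_iota_reduces[OF _ A.free_carD(2)[OF Lc]])
        \<comment> \<open>Dropping the last letter \<open>s\<close> lowers \<open>trail\<close> by
          one, and moving \<open>u\<close> past \<open>L s x y\<close> does not raise it
          again.\<close>
        then show "l y \<in> supp_in {v. trail v < trail w}" unfolding l_def act_def iota_fun_def
          by (rule supp_in_mono) (use True in \<open>auto simp: reduces_to_def snoc trail_snoc\<close>)
      qed (rule less.hyps, simp_all only: mem_Collect_eq)
    qed
    have z: "(s, x) \<in> S \<times> X" using s less.prems by blast
    note gc = C.act_free_car[OF c C.gen_free_car[OF z]]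
    have "correction L (act C ?c (gen C (s, x))) + l = act C ?c (correction_gen L (s, x)) + l"
      unfolding correction_act[OF L c C.gen_free_car[OF z]] correction_on_gen[OF L z] ..
    also have "\<dots> = act C (\<iota> a \<cdot> word w) (gen C x)"
    proof
      fix y
      have "?c \<cdot> (letter s \<cdot> gen C x y - \<iota> (L s x y)) + ?c \<cdot> \<iota> (L s x y) = ?c \<cdot> (letter s \<cdot> gen C x y)"
        using C.distrib_left[OF c, of "letter s \<cdot> gen C x y - \<iota> (L s x y)" "\<iota> (L s x y)"]
          letter_car[OF s] A.free_carD(2)[OF Lc] C.free_carD(2)[OF C.gen_free_car[OF less.prems(1)]]
        by (simp add: C.car_diff C.mult_car iota_car)
      moreover have "\<iota> a \<cdot> word w = ?c \<cdot> letter s"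
        using less.prems u s by (simp add: snoc word_append word_single C.mult_assoc iota_car word_car letter_car)
      ultimately show "(act C ?c (correction_gen L (s, x)) + l) y = act C (\<iota> a \<cdot> word w) (gen C x) y"
        using c letter_car[OF s] C.free_carD(2)[OF C.gen_free_car[OF less.prems(1)]]
        by (simp add: l_def act_def correction_gen_def iota_fun_def C.mult_assoc)
    qed
    finally have E: "act C (\<iota> a \<cdot> word w) (gen C x)
        = (iota_fun 0 + correction L (act C ?c (gen C (s, x)))) + l"
      by (simp add: iota_fun_zero)
    show ?thesis unfolding E
      by (rule split_set_add[OF L B split_setI[OF A.free_car_zero gc refl] lM])
  qed
qed

lemma correction_exists:
  assumes L: "admissible i X L" and p: "p \<in> free_car C X"
  obtains b q where "b \<in> free_car A X" "q \<in> free_car C (S \<times> X)" "p = iota_fun b + correction L q"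
proof -
  have B: "additive_set X (free_car A X)"
    unfolding additive_set_def using A.free_car_zero A.free_car_add by blast
  have "p \<in> split_set L X (free_car A X)"
    by (rule split_setI_supp_in[OF L B _ p, of UNIV])
      (use split_set_monomial[OF L] supp_in_UNIV C.free_carD(2)[OF p] in auto)
  then show ?thesis by (rule split_setE) (rule that)
qed

text \<open>Any decomposition can be cut down to components. Since \<open>correction L\<close>
  raises the degree of entries by one, entries of degree \<open>n\<close> are kept in
  \<open>q\<close> and entries of degree \<open>Suc n\<close> in \<open>b\<close>.\<close>

lemma correction_exists_homogeneous:
  assumes L: "admissible i X L" and p: "p \<in> free_comp C i X (i + Suc n)"
  obtains b q where "b \<in> free_comp A i X (i + Suc n)" "q \<in> free_comp C (Suc i) (S \<times> X) (Suc i + n)"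
    "p = iota_fun b + correction L q"
proof -
  obtain b q where bq: "b \<in> free_car A X" "q \<in> free_car C (S \<times> X)" "p = iota_fun b + correction L q"
    using correction_exists[OF L C.free_comp_car[OF p]] .
  define b' where "b' = (\<lambda>x. hcomp A (Suc n) (b x))"
  define q' where "q' = (\<lambda>z. hcomp C n (q z))"
  have "p = iota_fun b' + correction L q'"
  proof
    fix x
    have "p x = hcomp C (Suc n) (p x)" using fun_cong[OF C.hcomp_free_comp[OF p], of x] by simp
    also have "\<dots> = hcomp C (Suc n) (\<iota> (b x)) + hcomp C (Suc n) (correction L q x)"
      using A.free_carD(2)[OF bq(1)] C.free_carD(2)[OF correction_car[OF L bq(2)]]
      by (simp add: bq(3) iota_fun_def C.hcomp_add iota_car)
    also have "\<dots> = \<iota> (b' x) + correction L q' x"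
      unfolding correction_def q'_def b'_def
      by (simp only: hcomp_iota[OF A.free_carD(2)[OF bq(1)]]
          C.free_ext_hcomp(1)[OF correction_gens[OF L] bq(2)])
    finally show "p x = (iota_fun b' + correction L q') x" by (simp add: iota_fun_def)
  qed
  moreover have "b' \<in> free_comp A i X (i + Suc n)" unfolding b'_def by (rule A.free_comp_hcomp[OF bq(1)])
  moreover have "q' \<in> free_comp C (Suc i) (S \<times> X) (Suc i + n)" unfolding q'_def by (rule C.free_comp_hcomp[OF bq(2)])
  ultimately show ?thesis using that by blast
qed

text \<open>For \<open>t\<close> in \<open>S''\<close> the generator \<open>(t, x)\<close> is sent
  to \<open>t e_x\<close> without remainder, so a word ending in \<open>t\<close> is reached in one
  step.\<close>

lemma correction_exists_letter'':
  assumes L: "admissible i X L" and p: "p \<in> free_car C X"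
    and W: "\<And>x. p x \<in> supp_in {v @ [t] | v t. t \<in> S''}"
  obtains q where "q \<in> free_car C (S \<times> X)" "p = correction L q"
proof -
  have B: "additive_set X {0}"
    unfolding additive_set_def using A.free_car_zero by auto
  have "p \<in> split_set L X {0}"
  proof (rule split_setI_supp_in[OF L B _ p W])
    fix a w x assume a: "a \<in> car A" and w: "w \<in> lists S" "w \<in> {v @ [t] | v t. t \<in> S''}" and x: "x \<in> X"
    obtain v t where vt: "w = v @ [t]" "t \<in> S''" using w by blast
    then have v: "v \<in> lists S" and t: "t \<in> S" and z: "(t, x) \<in> S \<times> X" using w x by auto
    have c: "\<iota> a \<cdot> word v \<in> car C" using monomial_car a v by blast
    show "act C (\<iota> a \<cdot> word w) (gen C x) \<in> split_set L X {0}"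
    proof (rule split_setI[of 0])
      show "act C (\<iota> a \<cdot> word v) (gen C (t, x)) \<in> free_car C (S \<times> X)"
        by (rule C.act_free_car[OF c C.gen_free_car[OF z]])
      have "\<iota> a \<cdot> word w = \<iota> a \<cdot> word v \<cdot> letter t"
        using a v t by (simp add: vt(1) word_append word_single C.mult_assoc iota_car word_car letter_car)
      moreover have "iota_fun (L t x) = 0" unfolding admissibleD(2)[OF L x vt(2)] by (rule iota_fun_zero)
      ultimately show "act C (\<iota> a \<cdot> word w) (gen C x)
          = iota_fun 0 + correction L (act C (\<iota> a \<cdot> word v) (gen C (t, x)))"
        unfolding correction_act[OF L c C.gen_free_car[OF z]] correction_on_gen[OF L z] iota_fun_zero
        using c letter_car[OF t] C.free_carD(2)[OF C.gen_free_car[OF x]]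
        by (simp add: correction_gen_def act_def C.mult_assoc fun_eq_iff)
    qed simp
  qed
  then obtain b q where "b \<in> {0}" and q: "q \<in> free_car C (S \<times> X)" and p: "p = iota_fun b + correction L q"
    by (rule split_setE)
  then have "b = 0" by (simp only: singleton_iff)
  show ?thesis by (rule that[OF q]) (simp only: p \<open>b = 0\<close> iota_fun_zero add_0_left)
qed

end

section \<open>Lifting a resolution\<close>

context free_word_extension
begin

definition lift_gen :: "(('x \<Rightarrow> 'a) \<Rightarrow> 'y \<Rightarrow> 'a) \<Rightarrow> 'x \<Rightarrow> 'y \<Rightarrow> 'c" where
  "lift_gen \<delta> x = iota_fun (\<delta> (gen A x))"

text \<open>The base change of \<open>\<delta>\<close> along \<open>\<iota>\<close>: its matrix read
  over \<open>C\<close>.\<close>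

definition lift_hom :: "(('x \<Rightarrow> 'a) \<Rightarrow> 'y \<Rightarrow> 'a) \<Rightarrow> ('x \<Rightarrow> 'c) \<Rightarrow> 'y \<Rightarrow> 'c" where
  "lift_hom \<delta> = free_ext C (lift_gen \<delta>)"

lemma lift_gens: "free_hom A (Suc i) X i Y \<delta> \<Longrightarrow> linear_gens C i X Y (lift_gen \<delta>)"
  unfolding linear_gens_def lift_gen_def
  by (intro ballI iota_fun_comp) (rule A.linear_gensD(1)[OF A.free_hom_gens])

lemmas lift_hom_car = C.free_ext_car[OF lift_gens, folded lift_hom_def]
  and lift_hom_add = C.free_ext_add[OF lift_gens, folded lift_hom_def]
  and lift_hom_act = C.free_ext_act[OF lift_gens, folded lift_hom_def]
  and lift_hom_minus = C.free_ext_minus[OF lift_gens, folded lift_hom_def]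
  and lift_hom_gen = C.free_ext_gen[OF lift_gens, folded lift_hom_def, unfolded lift_gen_def]
  and lift_hom_comp = C.free_ext_comp[OF lift_gens, folded lift_hom_def]

lemma lift_hom_iota:
  assumes h: "free_hom A (Suc i) X i Y \<delta>" and p: "p \<in> free_car A X"
  shows "lift_hom \<delta> (iota_fun p) = iota_fun (\<delta> p)"
proof
  fix y
  note pD = A.free_carD[OF p]
  let ?F = "{x. p x \<noteq> 0}"
  have D: "\<delta> (gen A x) y \<in> car A" if "x \<in> ?F" for x
    by (rule A.linear_gensD(4)[OF A.free_hom_gens[OF h] pD(4)]) (use that in simp)
  have "lift_hom \<delta> (iota_fun p) y = (\<Sum>x\<in>?F. iota_fun p x \<cdot> iota_fun (\<delta> (gen A x)) y)"
    unfolding lift_hom_def lift_gen_def[symmetric]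
    by (rule C.free_ext_apply[OF lift_gens[OF h]]) (use pD(1,4) in \<open>auto simp: iota_fun_def iota_zero\<close>)
  also have "\<dots> = (\<Sum>x\<in>?F. \<iota> (mult A (p x) (\<delta> (gen A x) y)))"
    by (rule sum.cong[OF refl]) (simp only: iota_fun_def iota_mult[OF pD(2) D])
  also have "\<dots> = \<iota> (\<Sum>x\<in>?F. mult A (p x) (\<delta> (gen A x) y))"
    by (rule iota_sum[symmetric], rule A.mult_car[OF pD(2) D])
  also have "(\<Sum>x\<in>?F. mult A (p x) (\<delta> (gen A x) y)) = \<delta> p y"
    unfolding A.free_hom_expand(1)[OF h p] sum_apply act_def ..
  finally show "lift_hom \<delta> (iota_fun p) y = iota_fun (\<delta> p) y" by (simp only: iota_fun_def)
qed

text \<open>The composite is \<open>C\<close>-linear, and on generators it is the image under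
  \<open>iota_fun\<close> of the composite over \<open>A\<close>.\<close>

lemma lift_hom_lift_hom:
  assumes h: "free_hom A (Suc i) X i Y \<delta>" and h': "free_hom A (Suc (Suc i)) Z (Suc i) X \<delta>'"
    and zero: "\<And>p. p \<in> free_car A Z \<Longrightarrow> \<delta> (\<delta>' p) = 0" and p: "p \<in> free_car C Z"
  shows "lift_hom \<delta> (lift_hom \<delta>' p) = 0"
proof (rule C.free_hom_eqI[where X = Z and F = "\<lambda>p. lift_hom \<delta> (lift_hom \<delta>' p)" and G = "\<lambda>_. 0", OF _ _ _ _ _ p])
  fix p q assume p: "p \<in> free_car C Z" and q: "q \<in> free_car C Z"
  show "lift_hom \<delta> (lift_hom \<delta>' (p + q)) = lift_hom \<delta> (lift_hom \<delta>' p) + lift_hom \<delta> (lift_hom \<delta>' q)"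
    unfolding lift_hom_add[OF h' p q] by (rule lift_hom_add[OF h lift_hom_car[OF h' p] lift_hom_car[OF h' q]])
next
  fix a p assume a: "a \<in> car C" and p: "p \<in> free_car C Z"
  show "lift_hom \<delta> (lift_hom \<delta>' (act C a p)) = act C a (lift_hom \<delta> (lift_hom \<delta>' p))"
    unfolding lift_hom_act[OF h' a p] by (rule lift_hom_act[OF h a lift_hom_car[OF h' p]])
next
  fix x assume x: "x \<in> Z"
  note g = A.gen_free_car[OF x]
  show "lift_hom \<delta> (lift_hom \<delta>' (gen C x)) = 0"
    unfolding lift_hom_gen[OF h' x] lift_hom_iota[OF h A.free_hom_expand(2)[OF h' g]] zero[OF g] iota_fun_zero ..
qed (auto simp: act_def fun_eq_iff C.mult_zero)

text \<open>The matrix \<open>g\<close> gives the map induced between the sources of the two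
  corrections. All maps are \<open>C\<close>-linear, so the square commutes once it does so on
  generators.\<close>

lemma lift_hom_correction:
  assumes h: "free_hom A (Suc i) X i Y \<delta>" and L: "admissible i Y L" and L': "admissible (Suc i) X L'"
    and g: "linear_gens C j (S \<times> X) (S \<times> Y) g"
      "\<And>z. z \<in> S \<times> X \<Longrightarrow> lift_hom \<delta> (correction_gen L' z) = correction L (g z)"
    and q: "q \<in> free_car C (S \<times> X)"
  shows "lift_hom \<delta> (correction L' q) = correction L (free_ext C g q)"
proof (rule C.free_hom_eqI[where X = "S \<times> X" and F = "\<lambda>q. lift_hom \<delta> (correction L' q)" and
      G = "\<lambda>q. correction L (free_ext C g q)", OF _ _ _ _ _ q])
  fix p q assume p: "p \<in> free_car C (S \<times> X)" and q: "q \<in> free_car C (S \<times> X)"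
  show "lift_hom \<delta> (correction L' (p + q)) = lift_hom \<delta> (correction L' p) + lift_hom \<delta> (correction L' q)"
    unfolding correction_add[OF L' p q]
    by (rule lift_hom_add[OF h correction_car[OF L' p] correction_car[OF L' q]])
  have E: "free_ext C g (p + q) = free_ext C g p + free_ext C g q"
    by (rule C.free_ext_add[OF g(1) p q])
  show "correction L (free_ext C g (p + q)) = correction L (free_ext C g p) + correction L (free_ext C g q)"
    unfolding E
    by (rule correction_add[OF L C.free_ext_car[OF g(1) p] C.free_ext_car[OF g(1) q]])
next
  fix a q assume a: "a \<in> car C" and q: "q \<in> free_car C (S \<times> X)"
  show "lift_hom \<delta> (correction L' (act C a q)) = act C a (lift_hom \<delta> (correction L' q))"
    unfolding correction_act[OF L' a q] by (rule lift_hom_act[OF h a correction_car[OF L' q]])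
  have E: "free_ext C g (act C a q) = act C a (free_ext C g q)"
    by (rule C.free_ext_act[OF g(1) a q])
  show "correction L (free_ext C g (act C a q)) = act C a (correction L (free_ext C g q))"
    unfolding E
    by (rule correction_act[OF L a C.free_ext_car[OF g(1) q]])
next
  fix z assume z: "z \<in> S \<times> X"
  have E: "free_ext C g (gen C z) = g z"
    by (rule C.free_ext_gen[OF g(1) z])
  show "lift_hom \<delta> (correction L' (gen C z)) = correction L (free_ext C g (gen C z))"
    unfolding E correction_on_gen[OF L' z] by (rule g(2)[OF z])
qed

text \<open>
  The image of \<open>correction L\<close> makes \<open>A\<^bsup>X n\<^esup>\<close> a \<open>C\<close>-module; \<open>liftable\<close> says that the letters then map
  the generators \<open>d n e\<^sub>x\<close> of the next syzygy back into that syzygy.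
\<close>

definition liftable :: "(nat \<Rightarrow> 'x set) \<Rightarrow> (nat \<Rightarrow> ('x \<Rightarrow> 'a) \<Rightarrow> 'x \<Rightarrow> 'a) \<Rightarrow> nat
    \<Rightarrow> ('l \<Rightarrow> 'x \<Rightarrow> 'x \<Rightarrow> 'a) \<Rightarrow> bool" where
  "liftable X d n L \<longleftrightarrow> admissible n (X n) L \<and>
    (\<forall>s\<in>S. \<forall>x\<in>X (Suc n). \<forall>b\<in>free_comp A n (X n) (Suc (Suc n)). \<forall>q\<in>free_car C (S \<times> X n).
      act C (letter s) (iota_fun (d n (gen A x))) = iota_fun b + correction L q
      \<longrightarrow> b \<in> d n ` free_car A (X (Suc n)))"

lemma letter_lift_gen_comp:
  assumes "free_hom A (Suc n) X n Y \<delta>" "s \<in> S" "x \<in> X"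
  shows "act C (letter s) (iota_fun (\<delta> (gen A x))) \<in> free_comp C n Y (Suc (Suc n))"
  using C.act_free_comp[OF letter_gr[OF assms(2)] C.linear_gensD(1)[OF lift_gens[OF assms(1)] assms(3)]]
  by (simp add: lift_gen_def)

text \<open>Every \<open>b\<close> of positive degree is killed by the augmentation and therefore
  lies in the image of \<open>d 0\<close>, so the letters may act by zero.\<close>

lemma liftable_0:
  assumes res: "linear_free_resolution A X d e"
  shows "liftable X d 0 (\<lambda>_ _. 0)"
proof -
  have e: "hom_to_field A 0 (X 0) e"
    and ex: "{p \<in> free_car A (X 0). e p = 0} = d 0 ` free_car A (X (Suc 0))"
    using res by (simp_all add: linear_free_resolution_def)
  have z: "0 \<in> free_comp A 0 (X 0) (Suc 0)"
    by (auto simp: free_comp_def A.free_car_zero A.gr_zero)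
  have "b \<in> d 0 ` free_car A (X (Suc 0))" if b: "b \<in> free_comp A 0 (X 0) (Suc (Suc 0))" for b
    unfolding ex[symmetric] using A.free_comp_car[OF b] A.hom_to_fieldD(3)[OF e _ b] by simp
  then show ?thesis using z unfolding liftable_def admissible_def by blast
qed

text \<open>By \<open>liftable\<close> the component \<open>b\<close> of \<open>s (d e_x)\<close> is
  a boundary \<open>d m\<close>, so the lifted differential sends \<open>s e_x - m\<close> into the
  image of the correction. Thus \<open>m\<close> is the next value of \<open>L\<close>, and
  \<open>g\<close> records a preimage.\<close>

lemma liftable_step_letter:
  assumes h: "free_hom A (Suc n) (X (Suc n)) n (X n) (d n)" and L: "liftable X d n L"
    and s: "s \<in> S" and x: "x \<in> X (Suc n)"
  shows "\<exists>m g. m \<in> free_comp A (Suc n) (X (Suc n)) (Suc (Suc n)) \<and> (s \<in> S'' \<longrightarrow> m = 0) \<and>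
    g \<in> free_comp C (Suc n) (S \<times> X n) (Suc (Suc n)) \<and>
    lift_hom (d n) (act C (letter s) (gen C x) - iota_fun m) = correction L g"
proof -
  let ?p = "act C (letter s) (iota_fun (d n (gen A x)))"
  have ad: "admissible n (X n) L" using L unfolding liftable_def by (rule conjunct1)
  \<comment> \<open>Entries have degree 2, one from the letter and one from \<open>d n\<close>;
    hence \<open>q\<close> has entries of degree 1.\<close>
  have pc: "?p \<in> free_comp C n (X n) (n + Suc 1)" using letter_lift_gen_comp[OF h s x] by simp
  obtain b q where bq: "b \<in> free_comp A n (X n) (n + Suc 1)"
      "q \<in> free_comp C (Suc n) (S \<times> X n) (Suc n + 1)" "?p = iota_fun b + correction L q"
    using correction_exists_homogeneous[OF ad pc] .
  note bc = A.free_comp_car[OF bq(1)] and qc = C.free_comp_car[OF bq(2)]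
  have b2: "b \<in> free_comp A n (X n) (Suc (Suc n))" using bq(1) by simp
  have bd: "b \<in> d n ` free_car A (X (Suc n))"
    using L s x b2 qc bq(3) unfolding liftable_def by blast
  \<comment> \<open>The left ideal of words ending in \<open>S''\<close> provides a second
    decomposition, with \<open>A\<close>-component 0; uniqueness transfers this to
    \<open>b\<close>.\<close>
  have b0: "b = 0" if s'': "s \<in> S''"
  proof -
    have "?p y \<in> supp_in {v @ [t] | v t. t \<in> S''}" for y
      unfolding act_def iota_fun_def
      by (rule letter''_mult[OF s'' A.linear_gensD(4)[OF A.free_hom_gens[OF h] x]])
    then obtain q' where q': "q' \<in> free_car C (S \<times> X n)" "?p = correction L q'"
      by (rule correction_exists_letter''[OF ad C.free_comp_car[OF pc]])
    have "correction L (q + - q') = correction L q + - correction L q'"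
      unfolding correction_minus[OF ad q'(1), symmetric]
      by (rule correction_add[OF ad qc C.free_car_minus[OF q'(1)]])
    then have "iota_fun b + correction L (q + - q') = (iota_fun b + correction L q) + - correction L q'"
      by (simp only: add.assoc)
    also have "\<dots> = 0" unfolding bq(3)[symmetric] q'(2)[symmetric] by (rule right_minus)
    finally show ?thesis
      by (rule correction_unique(1)[OF ad bc C.free_car_add[OF qc C.free_car_minus[OF q'(1)]]])
  qed
  have "\<exists>m. m \<in> free_comp A (Suc n) (X (Suc n)) (Suc (Suc n)) \<and> (s \<in> S'' \<longrightarrow> m = 0) \<and> b = d n m"
  proof (cases "s \<in> S''")
    case True
    \<comment> \<open>An arbitrary preimage of \<open>b = 0\<close> would not do, since
      \<open>admissible\<close> demands the value 0 here.\<close>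
    have "0 \<in> free_comp A (Suc n) (X (Suc n)) (Suc (Suc n))"
      by (auto simp: free_comp_def A.free_car_zero A.gr_zero)
    then show ?thesis using b0[OF True] A.free_hom_0[OF h] by metis
  next
    case False
    obtain m where "m \<in> free_comp A (Suc n) (X (Suc n)) (Suc n + 1)" "b = d n m"
      by (rule A.free_hom_image_homogeneous[OF h bq(1) bd])
    then show ?thesis using False by (intro exI[of _ m]) simp
  qed
  then obtain m where m: "m \<in> free_comp A (Suc n) (X (Suc n)) (Suc (Suc n))" "s \<in> S'' \<longrightarrow> m = 0" "b = d n m"
    by (elim exE conjE)
  note mc = A.free_comp_car[OF m(1)]
  note gc = C.gen_free_car[OF x] and lc = letter_car[OF s]
  have "lift_hom (d n) (act C (letter s) (gen C x) + - iota_fun m)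
      = act C (letter s) (lift_hom (d n) (gen C x)) + - lift_hom (d n) (iota_fun m)"
    unfolding lift_hom_act[OF h lc gc, symmetric] lift_hom_minus[OF h iota_fun_car[OF mc], symmetric]
    by (rule lift_hom_add[OF h C.act_free_car[OF lc gc] C.free_car_minus[OF iota_fun_car[OF mc]]])
  also have "\<dots> = ?p + - iota_fun b"
    unfolding lift_hom_gen[OF h x] lift_hom_iota[OF h mc] m(3) ..
  also have "\<dots> = correction L q" unfolding bq(3) by simp
  finally have "lift_hom (d n) (act C (letter s) (gen C x) - iota_fun m) = correction L q"
    by (simp only: diff_conv_add_uminus)
  moreover have "q \<in> free_comp C (Suc n) (S \<times> X n) (Suc (Suc n))" using bq(2) by simp
  ultimately show ?thesis using m(1,2) by blast
qed

text \<open>The new \<open>L'\<close> is again \<open>liftable\<close> by uniqueness one level down: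
  the lifted differential turns a decomposition of \<open>s (d e_x)\<close> into one of 0, whose
  \<open>A\<close>-component \<open>d n b\<close> must vanish. Exactness over \<open>A\<close> then
  provides the preimage of \<open>b\<close>.\<close>

lemma liftable_step:
  assumes res: "linear_free_resolution A X d e" and L: "liftable X d n L"
  shows "\<exists>L'. liftable X d (Suc n) L' \<and>
    (\<exists>g. linear_gens C (Suc n) (S \<times> X (Suc n)) (S \<times> X n) g \<and>
      (\<forall>z\<in>S \<times> X (Suc n). lift_hom (d n) (correction_gen L' z) = correction L (g z)))"
proof -
  have h: "free_hom A (Suc n) (X (Suc n)) n (X n) (d n)" for n
    using res by (simp add: linear_free_resolution_def)
  have ex: "{p \<in> free_car A (X (Suc n)). d n p = 0} = d (Suc n) ` free_car A (X (Suc (Suc n)))"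
    using res by (simp add: linear_free_resolution_def)
  have ad: "admissible n (X n) L" using L unfolding liftable_def by (rule conjunct1)
  \<comment> \<open>The value \<open>m\<close> and its companion \<open>g\<close> are chosen as a
    pair, because \<open>g\<close> depends on \<open>m\<close>.\<close>
  have "\<forall>z\<in>S \<times> X (Suc n). \<exists>mg. fst mg \<in> free_comp A (Suc n) (X (Suc n)) (Suc (Suc n)) \<and>
      (fst z \<in> S'' \<longrightarrow> fst mg = 0) \<and> snd mg \<in> free_comp C (Suc n) (S \<times> X n) (Suc (Suc n)) \<and>
      lift_hom (d n) (act C (letter (fst z)) (gen C (snd z)) - iota_fun (fst mg)) = correction L (snd mg)"
  proof
    fix z assume "z \<in> S \<times> X (Suc n)"
    then have z: "fst z \<in> S" "snd z \<in> X (Suc n)" by auto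
    obtain m g where "m \<in> free_comp A (Suc n) (X (Suc n)) (Suc (Suc n)) \<and> (fst z \<in> S'' \<longrightarrow> m = 0) \<and>
        g \<in> free_comp C (Suc n) (S \<times> X n) (Suc (Suc n)) \<and>
        lift_hom (d n) (act C (letter (fst z)) (gen C (snd z)) - iota_fun m) = correction L g"
      using liftable_step_letter[OF h L z] by (elim exE)
    then show "\<exists>mg. fst mg \<in> free_comp A (Suc n) (X (Suc n)) (Suc (Suc n)) \<and>
      (fst z \<in> S'' \<longrightarrow> fst mg = 0) \<and> snd mg \<in> free_comp C (Suc n) (S \<times> X n) (Suc (Suc n)) \<and>
      lift_hom (d n) (act C (letter (fst z)) (gen C (snd z)) - iota_fun (fst mg)) = correction L (snd mg)"
      by (intro exI[of _ "(m, g)"]) (unfold fst_conv snd_conv)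
  qed
  then obtain f where f: "\<forall>z\<in>S \<times> X (Suc n). fst (f z) \<in> free_comp A (Suc n) (X (Suc n)) (Suc (Suc n)) \<and>
      (fst z \<in> S'' \<longrightarrow> fst (f z) = 0) \<and> snd (f z) \<in> free_comp C (Suc n) (S \<times> X n) (Suc (Suc n)) \<and>
      lift_hom (d n) (act C (letter (fst z)) (gen C (snd z)) - iota_fun (fst (f z))) = correction L (snd (f z))"
    by (rule bchoice[THEN exE])
  define L' where "L' s x = fst (f (s, x))" for s x
  define g where "g z = snd (f z)" for z
  have ad': "admissible (Suc n) (X (Suc n)) L'"
    using f unfolding admissible_def L'_def by auto
  have g: "linear_gens C (Suc n) (S \<times> X (Suc n)) (S \<times> X n) g"
    using f unfolding linear_gens_def g_def by blast
  have Lg: "lift_hom (d n) (correction_gen L' z) = correction L (g z)" if "z \<in> S \<times> X (Suc n)" for z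
    using f that unfolding g_def L'_def correction_gen_def by (auto simp only: case_prod_beta prod.collapse)
  have "b \<in> d (Suc n) ` free_car A (X (Suc (Suc n)))"
    if s: "s \<in> S" and x: "x \<in> X (Suc (Suc n))" and b: "b \<in> free_comp A (Suc n) (X (Suc n)) (Suc (Suc (Suc n)))"
      and q: "q \<in> free_car C (S \<times> X (Suc n))"
      and eq: "act C (letter s) (iota_fun (d (Suc n) (gen A x))) = iota_fun b + correction L' q"
    for s x b q
  proof -
    note bc = A.free_comp_car[OF b]
    note gx = A.gen_free_car[OF x]
    note v = A.free_hom_expand(2)[OF h[of "Suc n"] gx]
    have "d n (d (Suc n) (gen A x)) = 0" using ex gx by blast
    then have "lift_hom (d n) (act C (letter s) (iota_fun (d (Suc n) (gen A x)))) = act C (letter s) 0"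
      unfolding lift_hom_act[OF h letter_car[OF s] iota_fun_car[OF v]] lift_hom_iota[OF h v]
      by (simp only: iota_fun_zero)
    also have "act C (letter s) 0 = 0" by (auto simp: act_def fun_eq_iff C.mult_zero letter_car[OF s])
    finally have "lift_hom (d n) (iota_fun b + correction L' q) = 0" unfolding eq .
    then have "iota_fun (d n b) + lift_hom (d n) (correction L' q) = 0"
      unfolding lift_hom_add[OF h iota_fun_car[OF bc] correction_car[OF ad' q]] lift_hom_iota[OF h bc] .
    moreover have "lift_hom (d n) (correction L' q) = correction L (free_ext C g q)"
      by (rule lift_hom_correction[OF h ad ad' g Lg q])
    ultimately have "iota_fun (d n b) + correction L (free_ext C g q) = 0" by (simp only:)
    then have "d n b = 0"
      by (rule correction_unique(1)[OF ad A.free_hom_expand(2)[OF h bc] C.free_ext_car[OF g q]])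
    then show ?thesis unfolding ex[symmetric] using bc by simp
  qed
  then have "liftable X d (Suc n) L'" using ad' unfolding liftable_def by blast
  then show ?thesis using g Lg by blast
qed

text \<open>Dependent choice is made on \<open>L\<close> alone: the relation between consecutive
  terms only asserts that some \<open>g\<close> exists, and the maps \<open>g n\<close> are picked
  once the whole sequence is fixed.\<close>

lemma corrections_exist:
  assumes res: "linear_free_resolution A X d e"
  obtains L g where "\<And>n. admissible n (X n) (L n)"
    "\<And>n. linear_gens C (Suc n) (S \<times> X (Suc n)) (S \<times> X n) (g n)"
    "\<And>n z. z \<in> S \<times> X (Suc n) \<Longrightarrow> lift_hom (d n) (correction_gen (L (Suc n)) z) = correction (L n) (g n z)"
proof -
  have "\<exists>L. \<forall>n. liftable X d n (L n) \<and> (\<exists>g. linear_gens C (Suc n) (S \<times> X (Suc n)) (S \<times> X n) g \<and>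
      (\<forall>z\<in>S \<times> X (Suc n). lift_hom (d n) (correction_gen (L (Suc n)) z) = correction (L n) (g z)))"
    by (rule dependent_nat_choice) (use liftable_0[OF res] liftable_step[OF res] in blast)+
  then obtain L where L: "\<And>n. liftable X d n (L n)"
    and ex: "\<forall>n. \<exists>g. linear_gens C (Suc n) (S \<times> X (Suc n)) (S \<times> X n) g \<and>
      (\<forall>z\<in>S \<times> X (Suc n). lift_hom (d n) (correction_gen (L (Suc n)) z) = correction (L n) (g z))" by blast
  from choice[OF ex] obtain g where "\<forall>n. linear_gens C (Suc n) (S \<times> X (Suc n)) (S \<times> X n) (g n) \<and>
      (\<forall>z\<in>S \<times> X (Suc n). lift_hom (d n) (correction_gen (L (Suc n)) z) = correction (L n) (g n z))" by blast
  then show ?thesis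
    by (intro that[of L g]) (use L in \<open>unfold liftable_def, blast\<close>)+
qed

end

section \<open>The cone resolution\<close>

context connected_graded_algebra
begin

lemma free_car_sum_iff:
  "p \<in> free_car A (Inl ` X \<union> Inr ` Z) \<longleftrightarrow> (\<lambda>x. p (Inl x)) \<in> free_car A X \<and> (\<lambda>z. p (Inr z)) \<in> free_car A Z"
proof -
  have "{y. p y \<noteq> 0} = Inl ` {x. p (Inl x) \<noteq> 0} \<union> Inr ` {z. p (Inr z) \<noteq> 0}" (is "_ = ?L \<union> ?R")
  proof (rule set_eqI)
    show "y \<in> {y. p y \<noteq> 0} \<longleftrightarrow> y \<in> ?L \<union> ?R" for y by (cases y) auto
  qed
  then have "finite {y. p y \<noteq> 0} \<longleftrightarrow> finite {x. p (Inl x) \<noteq> 0} \<and> finite {z. p (Inr z) \<noteq> 0}"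
    by (simp add: finite_image_iff)
  moreover have "(\<forall>y. p y \<in> car A) \<longleftrightarrow> (\<forall>x. p (Inl x) \<in> car A) \<and> (\<forall>z. p (Inr z) \<in> car A)"
    by (metis sum.exhaust)
  moreover have "(\<forall>y. y \<notin> Inl ` X \<union> Inr ` Z \<longrightarrow> p y = 0) \<longleftrightarrow>
      (\<forall>x. x \<notin> X \<longrightarrow> p (Inl x) = 0) \<and> (\<forall>z. z \<notin> Z \<longrightarrow> p (Inr z) = 0)"
  proof -
    have "(\<forall>y. y \<notin> Inl ` X \<union> Inr ` Z \<longrightarrow> p y = 0) \<longleftrightarrow>
      (\<forall>x. Inl x \<notin> Inl ` X \<union> Inr ` Z \<longrightarrow> p (Inl x) = 0) \<and> (\<forall>z. Inr z \<notin> Inl ` X \<union> Inr ` Z \<longrightarrow> p (Inr z) = 0)"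
      by (metis sum.exhaust)
    also have "\<dots> \<longleftrightarrow> (\<forall>x. x \<notin> X \<longrightarrow> p (Inl x) = 0) \<and> (\<forall>z. z \<notin> Z \<longrightarrow> p (Inr z) = 0)" by auto
    finally show ?thesis .
  qed
  ultimately show ?thesis unfolding free_car_def mem_Collect_eq by blast
qed

lemma free_comp_sum_iff:
  "p \<in> free_comp A i (Inl ` X \<union> Inr ` Z) n \<longleftrightarrow>
    (\<lambda>x. p (Inl x)) \<in> free_comp A i X n \<and> (\<lambda>z. p (Inr z)) \<in> free_comp A i Z n"
proof -
  have "(\<forall>y. p y \<in> T) \<longleftrightarrow> (\<forall>x. p (Inl x) \<in> T) \<and> (\<forall>z. p (Inr z) \<in> T)" for T
    by (metis sum.exhaust)
  then show ?thesis unfolding free_comp_def mem_Collect_eq free_car_sum_iff by blast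
qed

end

context free_word_extension
begin

text \<open>
  The cone of the maps \<open>correction (L n)\<close>: in degree \<open>n + 1\<close> the resolution of \<open>C\<close> is
  \<open>C\<^bsup>X (n+1)\<^esup> \<oplus> C\<^bsup>S \<times> X n\<^esup>\<close> with differential \<open>(p, q) \<mapsto> (d p + correction q, - g q)\<close>.
\<close>

lemma koszul_if_koszul:
  assumes "koszul A"
  shows "koszul C"
proof -
  obtain X :: "nat \<Rightarrow> nat set" and d e where res: "linear_free_resolution A X d e"
    using assms unfolding koszul_def by blast
  have h: "free_hom A (Suc n) (X (Suc n)) n (X n) (d n)" for n
    using res by (simp add: linear_free_resolution_def)
  have e: "hom_to_field A 0 (X 0) e" and es: "e ` free_car A (X 0) = UNIV"
    and ex0: "{p \<in> free_car A (X 0). e p = 0} = d 0 ` free_car A (X (Suc 0))"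
    using res by (simp_all add: linear_free_resolution_def)
  have ex: "{p \<in> free_car A (X (Suc n)). d n p = 0} = d (Suc n) ` free_car A (X (Suc (Suc n)))" for n
    using res by (simp add: linear_free_resolution_def)
  have X0: "finite (X 0)" by (rule A.linear_free_resolution_finite[OF res])
  obtain L g where ad: "\<And>n. admissible n (X n) (L n)"
    and g: "\<And>n. linear_gens C (Suc n) (S \<times> X (Suc n)) (S \<times> X n) (g n)"
    and Lg: "\<And>n z. z \<in> S \<times> X (Suc n) \<Longrightarrow> lift_hom (d n) (correction_gen (L (Suc n)) z) = correction (L n) (g n z)"
    using corrections_exist[OF res] by blast
  define G where "G n = free_ext C (g n)" for n
  note Gcar = C.free_ext_car[OF g, folded G_def] and Gadd = C.free_ext_add[OF g, folded G_def]
    and Gact = C.free_ext_act[OF g, folded G_def] and Gminus = C.free_ext_minus[OF g, folded G_def]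
    and Gcomp = C.free_ext_comp[OF g, folded G_def]
  have LG: "lift_hom (d n) (correction (L (Suc n)) q) = correction (L n) (G n q)"
    if "q \<in> free_car C (S \<times> X (Suc n))" for n q
    unfolding G_def by (rule lift_hom_correction[OF h ad ad g Lg that])
  have dd: "d n (d (Suc n) p) = 0" if "p \<in> free_car A (X (Suc (Suc n)))" for n p
    using ex[of n] that by blast
  have ll: "lift_hom (d n) (lift_hom (d (Suc n)) p) = 0" if "p \<in> free_car C (X (Suc (Suc n)))" for n p
    by (rule lift_hom_lift_hom[OF h h dd that])
  \<comment> \<open>Injectivity of \<open>correction (L n)\<close> lets \<open>G\<close> inherit
    from the lifted differentials that consecutive maps compose to 0.\<close>
  have GG: "G n (G (Suc n) q) = 0" if q: "q \<in> free_car C (S \<times> X (Suc (Suc n)))" for n q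
  proof -
    have "iota_fun 0 + correction (L n) (G n (G (Suc n) q)) = 0"
      unfolding LG[OF Gcar[OF q], symmetric] LG[OF q, symmetric] iota_fun_zero
        ll[OF correction_car[OF ad q]] by (rule add_0_left)
    then show ?thesis by (rule correction_unique(2)[OF ad A.free_car_zero Gcar[OF Gcar[OF q]]])
  qed

  \<comment> \<open>The second summand of the cone is shifted by one, hence empty in degree 0;
    accordingly \<open>K 0\<close> is the zero map.\<close>
  define Z where "Z n = (case n of 0 \<Rightarrow> {} | Suc m \<Rightarrow> S \<times> X m)" for n
  define Y where "Y n = Inl ` X n \<union> Inr ` Z n" for n
  \<comment> \<open>The sign makes the two contributions of \<open>correction\<close> to
    \<open>D n (D (Suc n) u)\<close> cancel.\<close>
  define K where "K n q = (case n of 0 \<Rightarrow> 0 | Suc m \<Rightarrow> - G m q)" for n q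
  define l where "l p = (\<lambda>x. p (Inl x))" for p :: "nat + 'l \<times> nat \<Rightarrow> 'c"
  define r where "r p = (\<lambda>z. p (Inr z))" for p :: "nat + 'l \<times> nat \<Rightarrow> 'c"
  define V where "V n p = lift_hom (d n) (l p) + correction (L n) (r p)" for n p
  define D where "D n p = case_sum (V n p) (K n (r p))" for n p
  have ZSuc: "Z (Suc n) = S \<times> X n" for n by (simp add: Z_def)
  have Ycar: "p \<in> free_car C (Y n) \<longleftrightarrow> l p \<in> free_car C (X n) \<and> r p \<in> free_car C (Z n)" for p n
    unfolding Y_def C.free_car_sum_iff l_def r_def ..
  have Ycomp: "p \<in> free_comp C i (Y n) m \<longleftrightarrow> l p \<in> free_comp C i (X n) m \<and> r p \<in> free_comp C i (Z n) m" for i p n m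
    unfolding Y_def C.free_comp_sum_iff l_def r_def ..
  have lr: "l (case_sum u v) = u" "r (case_sum u v) = v" for u v by (simp_all add: l_def r_def)
  have lr_eq: "p = q" if "l p = l q" "r p = r q" for p q
  proof
    fix y
    show "p y = q y" using fun_cong[OF that(1)] fun_cong[OF that(2)] by (cases y) (simp_all add: l_def r_def)
  qed
  have lr_add: "l (p + q) = l p + l q" "r (p + q) = r p + r q" for p q
    by (simp_all add: l_def r_def fun_eq_iff)
  have lr_act: "l (act C c p) = act C c (l p)" "r (act C c p) = act C c (r p)" for c p
    by (simp_all add: l_def r_def act_def)
  have lr_zero: "l 0 = 0" "r 0 = 0" by (simp_all add: l_def r_def fun_eq_iff)
  have Kcar: "K n q \<in> free_car C (Z n)" if "q \<in> free_car C (S \<times> X n)" for n q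
    using that C.free_car_zero C.free_car_minus[OF Gcar] by (cases n) (simp_all only: K_def Z_def nat.case)
  have Kadd: "K n (p + q) = K n p + K n q" if "p \<in> free_car C (S \<times> X n)" "q \<in> free_car C (S \<times> X n)" for n p q
    using that by (cases n) (simp_all only: K_def nat.case Gadd minus_add_distrib add_0_left)
  have Kact: "K n (act C c q) = act C c (K n q)" if "c \<in> car C" "q \<in> free_car C (S \<times> X n)" for n c q
  proof (cases n)
    case 0
    then show ?thesis using that by (auto simp: K_def act_def fun_eq_iff C.mult_zero)
  next
    case (Suc m)
    then have q: "q \<in> free_car C (S \<times> X (Suc m))" using that by simp
    show ?thesis unfolding Suc K_def nat.case Gact[OF that(1) q] C.act_minus[OF that(1) Gcar[OF q]] ..
  qed
  have Kcomp: "K n q \<in> free_comp C n (Z n) m" if "q \<in> free_comp C (Suc n) (S \<times> X n) m" for n m q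
  proof (cases n)
    case 0
    then show ?thesis by (auto simp: K_def free_comp_def C.free_car_zero C.gr_zero)
  next
    case (Suc k)
    then show ?thesis using C.free_comp_minus[OF Gcomp, of q k m] that by (simp only: K_def Z_def nat.case)
  qed
  have lc: "l p \<in> free_car C (X n)" "r p \<in> free_car C (Z n)" if "p \<in> free_car C (Y n)" for p n
    using that unfolding Ycar by blast+
  have rc: "r p \<in> free_car C (S \<times> X n)" if "p \<in> free_car C (Y (Suc n))" for p n
    using lc(2)[OF that] unfolding ZSuc .
  have Vcar: "V n p \<in> free_car C (X n)" if "p \<in> free_car C (Y (Suc n))" for n p
    unfolding V_def
    by (rule C.free_car_add[OF lift_hom_car[OF h lc(1)[OF that]] correction_car[OF ad rc[OF that]]])
  have Dcar: "D n p \<in> free_car C (Y n)" if "p \<in> free_car C (Y (Suc n))" for n p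
    unfolding D_def Ycar lr by (rule conjI[OF Vcar[OF that] Kcar[OF rc[OF that]]])
  have Vadd: "V n (p + q) = V n p + V n q"
    if p: "p \<in> free_car C (Y (Suc n))" and q: "q \<in> free_car C (Y (Suc n))" for n p q
    unfolding V_def lr_add lift_hom_add[OF h lc(1)[OF p] lc(1)[OF q]] correction_add[OF ad rc[OF p] rc[OF q]]
    by (simp only: ac_simps)
  have Vact: "V n (act C c p) = act C c (V n p)"
    if c: "c \<in> car C" and p: "p \<in> free_car C (Y (Suc n))" for n c p
    unfolding V_def lr_act lift_hom_act[OF h c lc(1)[OF p]] correction_act[OF ad c rc[OF p]]
    by (rule C.act_add[OF c lift_hom_car[OF h lc(1)[OF p]] correction_car[OF ad rc[OF p]], symmetric])
  have Dhom: "free_hom C (Suc n) (Y (Suc n)) n (Y n) (D n)" for n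
    unfolding free_hom_def
  proof (intro conjI ballI allI)
    fix p q assume p: "p \<in> free_car C (Y (Suc n))" and q: "q \<in> free_car C (Y (Suc n))"
    show "D n (p + q) = D n p + D n q"
      by (rule lr_eq) (simp_all only: D_def lr lr_add Vadd[OF p q] Kadd[OF rc[OF p] rc[OF q]])
  next
    fix c p assume c: "c \<in> car C" and p: "p \<in> free_car C (Y (Suc n))"
    show "D n (act C c p) = act C c (D n p)"
      by (rule lr_eq) (simp_all only: D_def lr lr_act Vact[OF c p] Kact[OF c rc[OF p]])
  next
    fix m
    show "D n ` free_comp C (Suc n) (Y (Suc n)) m \<subseteq> free_comp C n (Y n) m"
    proof (rule image_subsetI)
      fix p assume "p \<in> free_comp C (Suc n) (Y (Suc n)) m"
      then have p: "l p \<in> free_comp C (Suc n) (X (Suc n)) m" "r p \<in> free_comp C (Suc n) (S \<times> X n) m"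
        unfolding Ycomp ZSuc by blast+
      show "D n p \<in> free_comp C n (Y n) m"
        unfolding Ycomp D_def lr V_def
        by (intro conjI C.free_comp_add lift_hom_comp[OF h p(1)] correction_comp[OF ad p(2)] Kcomp[OF p(2)])
    qed
  qed

  \<comment> \<open>It suffices to look for preimages whose first component comes from
    \<open>A\<close>: the decomposition lets \<open>q\<close> absorb everything else.\<close>
  have cover: "\<exists>p. p \<in> free_car C (Y (Suc n)) \<and> D n p = u"
    if u: "u \<in> free_car C (Y n)" and a: "a \<in> free_car A (X (Suc n))" and q: "q \<in> free_car C (S \<times> X n)"
      and lu: "l u = iota_fun (d n a) + correction (L n) q" and ru: "r u = K n q" for n u a q
  proof (intro exI conjI)
    show "case_sum (iota_fun a) q \<in> free_car C (Y (Suc n))"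
      unfolding Ycar lr ZSuc using iota_fun_car[OF a] q by blast
    show "D n (case_sum (iota_fun a) q) = u"
      by (rule lr_eq) (simp_all only: D_def V_def lr lift_hom_iota[OF h a] lu ru)
  qed
  have exact: "{p \<in> free_car C (Y (Suc n)). D n p = 0} = D (Suc n) ` free_car C (Y (Suc (Suc n)))" for n
  proof (intro equalityI subsetI)
    fix p assume "p \<in> {p \<in> free_car C (Y (Suc n)). D n p = 0}"
    then have p: "p \<in> free_car C (Y (Suc n))" and D0: "D n p = 0" by blast+
    have V0: "V n p = 0" using arg_cong[OF D0, of l] unfolding D_def lr lr_zero .
    obtain b q where bq: "b \<in> free_car A (X (Suc n))" "q \<in> free_car C (S \<times> X (Suc n))"
        "l p = iota_fun b + correction (L (Suc n)) q"
      using correction_exists[OF ad lc(1)[OF p]] .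
    have "V n p = iota_fun (d n b) + (correction (L n) (G n q) + correction (L n) (r p))"
      unfolding V_def bq(3) lift_hom_add[OF h iota_fun_car[OF bq(1)] correction_car[OF ad bq(2)]]
        lift_hom_iota[OF h bq(1)] LG[OF bq(2)] by (rule add.assoc)
    \<comment> \<open>By uniqueness the vanishing of the differential splits into
      \<open>d n b = 0\<close>, to which exactness over \<open>A\<close> applies, and
      \<open>G n q + r p = 0\<close>, which identifies \<open>r p\<close> with the second component
      of the differential of \<open>q\<close>.\<close>
    then have eq: "iota_fun (d n b) + correction (L n) (G n q + r p) = 0"
      unfolding V0 correction_add[OF ad Gcar[OF bq(2)] rc[OF p]] by (rule sym)
    note uniq = correction_unique[OF ad A.free_hom_expand(2)[OF h bq(1)] C.free_car_add[OF Gcar[OF bq(2)] rc[OF p]] eq]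
    have "b \<in> d (Suc n) ` free_car A (X (Suc (Suc n)))" unfolding ex[symmetric] using bq(1) uniq(1) by blast
    then obtain a where a: "a \<in> free_car A (X (Suc (Suc n)))" "b = d (Suc n) a" by blast
    have "r p = K (Suc n) q" unfolding K_def nat.case using uniq(2) by (simp only: eq_neg_iff_add_eq_0 add.commute)
    then show "p \<in> D (Suc n) ` free_car C (Y (Suc (Suc n)))"
      using cover[OF p a(1) bq(2)] bq(3) unfolding a(2) by blast
  next
    fix p assume "p \<in> D (Suc n) ` free_car C (Y (Suc (Suc n)))"
    then obtain u where u: "u \<in> free_car C (Y (Suc (Suc n)))" "p = D (Suc n) u" by blast
    note lu = lc(1)[OF u(1)] and ru = rc[OF u(1)]
    have p: "p \<in> free_car C (Y (Suc n))" unfolding u(2) by (rule Dcar[OF u(1)])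
    have "V n p = (0 + correction (L n) (G n (r u))) + - correction (L n) (G n (r u))"
      unfolding u(2) V_def D_def lr K_def nat.case correction_minus[OF ad Gcar[OF ru]]
        lift_hom_add[OF h lift_hom_car[OF h lu] correction_car[OF ad ru]] ll[OF lu] LG[OF ru] ..
    also have "\<dots> = 0" by (simp only: add_0_left right_minus)
    finally have V0: "V n p = 0" .
    have rp: "r p = - G n (r u)" unfolding u(2) D_def lr K_def nat.case ..
    have K0: "K n (r p) = 0"
    proof (cases n)
      case 0
      then show ?thesis by (simp only: K_def nat.case)
    next
      case (Suc m)
      have ru': "r u \<in> free_car C (S \<times> X (Suc (Suc m)))" using ru unfolding Suc .
      show ?thesis
        unfolding rp Suc K_def nat.case Gminus[OF Gcar[OF ru']] GG[OF ru'] by (simp only: neg_0_equal_iff_equal minus_zero)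
    qed
    have "D n p = 0" by (rule lr_eq) (simp_all only: D_def lr lr_zero V0 K0)
    then show "p \<in> {p \<in> free_car C (Y (Suc n)). D n p = 0}" using p by blast
  qed

  \<comment> \<open>The extension of \<open>e\<close> to \<open>C\<close>: coordinates are augmented
    and weighted by the values of \<open>e\<close> on generators. The sum is finite because
    \<open>X 0\<close> is.\<close>
  define \<epsilon> where "\<epsilon> u = (\<Sum>x\<in>X 0. augmentation C (u x) * e (gen A x))" for u :: "nat \<Rightarrow> 'c"
  define E where "E p = \<epsilon> (l p)" for p
  have aug_iota: "augmentation C (\<iota> a) = augmentation A a" if "a \<in> car A" for a
    by (rule C.augmentation_eqI[OF iota_car[OF that]])
      (simp only: hcomp_iota[OF that] A.scale_unit_augmentation[OF that] iota_scale[OF A.unit_car] iota_unit)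
  have \<epsilon>_iota: "\<epsilon> (iota_fun p) = e p" if p: "p \<in> free_car A (X 0)" for p
    unfolding \<epsilon>_def iota_fun_def aug_iota[OF A.free_carD(2)[OF p]] A.hom_to_field_expand_finite[OF e p X0] ..
  have \<epsilon>_add: "\<epsilon> (p + q) = \<epsilon> p + \<epsilon> q" if "p \<in> free_car C (X 0)" "q \<in> free_car C (X 0)" for p q
    unfolding \<epsilon>_def
    by (simp add: C.augmentation_add C.free_carD(2)[OF that(1)] C.free_carD(2)[OF that(2)] distrib_right sum.distrib)
  have \<epsilon>_act: "\<epsilon> (act C c p) = augmentation C c * \<epsilon> p" if "c \<in> car C" "p \<in> free_car C (X 0)" for c p
    unfolding \<epsilon>_def act_def
    by (simp add: C.augmentation_mult that(1) C.free_carD(2)[OF that(2)] sum_distrib_left mult.assoc)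
  have \<epsilon>_zero: "\<epsilon> p = 0" if "p \<in> free_car C (X 0)" "\<And>x. hcomp C 0 (p x) = 0" for p
    unfolding \<epsilon>_def by (rule sum.neutral) (simp add: C.augmentation_eq_zero C.free_carD(2)[OF that(1)] that(2))
  \<comment> \<open>A matrix with entries of degree 1 produces coordinates without a part of degree
    0, which is all that \<open>\<epsilon>\<close> sees. The lifted differential is treated in the
    same way.\<close>
  have \<epsilon>_correction: "\<epsilon> (correction (L 0) q) = 0" if "q \<in> free_car C (S \<times> X 0)" for q
  proof (rule \<epsilon>_zero[OF correction_car[OF ad that]])
    show "hcomp C 0 (correction (L 0) q x) = 0" for x
      unfolding correction_def
      by (rule C.free_ext_hcomp(2)[OF correction_gens[OF ad] that])
  qed
  have \<epsilon>_lift: "\<epsilon> (lift_hom (d 0) p) = 0" if "p \<in> free_car C (X (Suc 0))" for p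
  proof (rule \<epsilon>_zero[OF lift_hom_car[OF h that]])
    show "hcomp C 0 (lift_hom (d 0) p x) = 0" for x
      unfolding lift_hom_def
      by (rule C.free_ext_hcomp(2)[OF lift_gens[OF h] that])
  qed
  have "linear_free_resolution C Y D E"
    unfolding linear_free_resolution_def
  proof (intro conjI allI Dhom exact)
    show "hom_to_field C 0 (Y 0) E"
      unfolding hom_to_field_def
    proof (intro conjI ballI allI impI)
      fix p q assume "p \<in> free_car C (Y 0)" "q \<in> free_car C (Y 0)"
      then show "E (p + q) = E p + E q" unfolding E_def lr_add by (intro \<epsilon>_add lc)
    next
      fix c p assume "c \<in> car C" "p \<in> free_car C (Y 0)"
      then show "E (act C c p) = augmentation C c * E p" unfolding E_def lr_act by (intro \<epsilon>_act lc)
    next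
      fix n :: nat assume n: "n > 0"
      show "E ` free_comp C 0 (Y 0) n \<subseteq> {0}"
      proof (rule image_subsetI)
        fix p assume "p \<in> free_comp C 0 (Y 0) n"
        then have p: "l p \<in> free_comp C 0 (X 0) n" unfolding Ycomp by blast
        have gr: "l p x \<in> gr C n" for x using C.free_compD(1)[OF p, of x] by simp
        have "hcomp C 0 (l p x) = 0" for x using n C.hcomp_homogeneous[OF gr, of 0 x] by simp
        then show "E p \<in> {0}" unfolding E_def using \<epsilon>_zero[OF C.free_comp_car[OF p]] by blast
      qed
    qed
    show "E ` free_car C (Y 0) = UNIV"
    proof (intro equalityI subsetI UNIV_I)
      fix k :: 'k
      have "k \<in> e ` free_car A (X 0)" unfolding es by (rule UNIV_I)
      then obtain p where p: "p \<in> free_car A (X 0)" "k = e p" by (rule imageE)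
      have c: "case_sum (iota_fun p) 0 \<in> free_car C (Y 0)"
        unfolding Ycar lr using iota_fun_car[OF p(1)] C.free_car_zero by blast
      have "k = E (case_sum (iota_fun p) 0)" unfolding E_def lr \<epsilon>_iota[OF p(1)] by (rule p(2))
      then show "k \<in> E ` free_car C (Y 0)" by (rule image_eqI[OF _ c])
    qed
    show "{p \<in> free_car C (Y 0). E p = 0} = D 0 ` free_car C (Y 1)"
      unfolding One_nat_def
    proof (intro equalityI subsetI)
      fix p assume "p \<in> {p \<in> free_car C (Y 0). E p = 0}"
      then have p: "p \<in> free_car C (Y 0)" and E0: "\<epsilon> (l p) = 0" unfolding E_def by blast+
      obtain b q where bq: "b \<in> free_car A (X 0)" "q \<in> free_car C (S \<times> X 0)"
          "l p = iota_fun b + correction (L 0) q"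
        using correction_exists[OF ad lc(1)[OF p]] .
      have "e b = 0"
        using E0 unfolding bq(3) \<epsilon>_add[OF iota_fun_car[OF bq(1)] correction_car[OF ad bq(2)]]
          \<epsilon>_iota[OF bq(1)] \<epsilon>_correction[OF bq(2)] by simp
      then have "b \<in> d 0 ` free_car A (X (Suc 0))" unfolding ex0[symmetric] using bq(1) by blast
      then obtain a where a: "a \<in> free_car A (X (Suc 0))" "b = d 0 a" by blast
      have "r p x = 0" for x
        using C.free_carD(3)[OF lc(2)[OF p], of x] by (simp add: Z_def)
      \<comment> \<open>Both sides are 0, as \<open>Z 0\<close> is empty and \<open>K 0\<close> is
        zero; so the \<open>q\<close> of the decomposition fits \<open>cover\<close>.\<close>
      then have "r p = K 0 q" unfolding K_def nat.case by (simp add: fun_eq_iff)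
      then show "p \<in> D 0 ` free_car C (Y (Suc 0))"
        using cover[OF p a(1) bq(2)] bq(3) unfolding a(2) by blast
    next
      fix p assume "p \<in> D 0 ` free_car C (Y (Suc 0))"
      then obtain u where u: "u \<in> free_car C (Y (Suc 0))" "p = D 0 u" by blast
      have "E p = 0"
        unfolding E_def u(2) D_def lr V_def
          \<epsilon>_add[OF lift_hom_car[OF h lc(1)[OF u(1)]] correction_car[OF ad rc[OF u(1)]]]
          \<epsilon>_lift[OF lc(1)[OF u(1)]] \<epsilon>_correction[OF rc[OF u(1)]] by simp
      then show "p \<in> {p \<in> free_car C (Y 0). E p = 0}" using Dcar[OF u(1)] u(2) by blast
    qed
  qed
  \<comment> \<open>The generators have the sum type \<open>nat + 'l \<times> nat\<close>;
    \<open>koszulI\<close> accepts any index type.\<close>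
  then show ?thesis by (rule C.koszulI)
qed

end

section \<open>Linear maps on tensor products\<close>

lemma scl_tensor [simp]: "scl (V \<otimes> W) = fscale"
  by (simp add: tensor_def)

lemma vector_space_scl_tensor: "vector_space (scl (V \<otimes> W))"
  by (simp add: vector_space_fscale)

lemma pure_zero_left: "pure V W 0 w = 0"
  using pure_add_left[of V W 0 0 w] by simp

lemma pure_zero_right: "pure V W v 0 = 0"
  using pure_add_right[of V W v 0 0] by simp

lemma pure_sum_right: "finite I \<Longrightarrow> pure V W v (sum f I) = (\<Sum>i\<in>I. pure V W v (f i))"
  by (induction I rule: finite_induct) (simp_all add: pure_zero_right pure_add_right)

lemma linear_onD:
  assumes "linear_on S s1 s2 f"
  shows "x \<in> S \<Longrightarrow> y \<in> S \<Longrightarrow> f (x + y) = f x + f y" and "x \<in> S \<Longrightarrow> f (s1 c x) = s2 c (f x)"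
  using assms unfolding linear_on_def by blast+

lemma linear_on_zero:
  assumes "vector_space s1" "vector_space s2" "linear_on S s1 s2 f" "x \<in> S"
  shows "f 0 = 0"
proof -
  interpret a: vector_space s1 by fact
  interpret b: vector_space s2 by fact
  show ?thesis using linear_onD(2)[OF assms(3,4), of 0] by simp
qed

text \<open>A scalar is absorbed into the left factor, so sums of pure tensors exhaust the
  span.\<close>

lemma tensor_sub_induct [consumes 2, case_names zero add pure]:
  fixes V :: "('k::field, 'v::ab_group_add, 'x) gspace_scheme"
    and W :: "('k, 'w::ab_group_add, 'y) gspace_scheme"
  assumes t: "t \<in> tensor_sub V W S T" and S: "\<And>c v. v \<in> S \<Longrightarrow> scl V c v \<in> S"
    and zero: "P 0"
    and add: "\<And>s t. \<lbrakk>s \<in> tensor_sub V W S T; t \<in> tensor_sub V W S T; P s; P t\<rbrakk> \<Longrightarrow> P (s + t)"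
    and pure: "\<And>v w. \<lbrakk>v \<in> S; w \<in> T\<rbrakk> \<Longrightarrow> P (pure V W v w)"
  shows "P t"
proof -
  interpret T: vector_space "fscale :: 'k \<Rightarrow> ('k, 'v, 'w) tensor \<Rightarrow> _" by (rule vector_space_fscale)
  let ?G = "{pure V W v w | v w. v \<in> S \<and> w \<in> T}"
  have "t \<in> T.span ?G" using t unfolding tensor_sub_def .
  then have "t \<in> T.span ?G \<and> P t"
  proof (induction rule: T.span_induct_alt)
    case base
    show ?case using zero T.span_zero by (rule conjI[rotated])
  next
    case (step c x y)
    then obtain v w where vw: "x = pure V W v w" "v \<in> S" "w \<in> T" by blast
    have x: "fscale c x = pure V W (scl V c v) w" unfolding vw(1) pure_scale_left ..
    have xs: "fscale c x \<in> T.span ?G" unfolding x by (rule T.span_base) (use vw S in blast)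
    have "P (fscale c x + y)"
      by (rule add) (use xs step pure[OF S[OF vw(2)] vw(3)] in \<open>unfold tensor_sub_def x, blast+\<close>)
    then show ?case using T.span_add[OF xs] step by blast
  qed
  then show ?thesis ..
qed

lemma pure_tensor_sub:
  fixes V :: "('k::field, 'v::ab_group_add, 'x) gspace_scheme"
    and W :: "('k, 'w::ab_group_add, 'y) gspace_scheme"
  assumes "v \<in> S" "w \<in> T"
  shows "pure V W v w \<in> tensor_sub V W S T"
proof -
  interpret T: vector_space "fscale :: 'k \<Rightarrow> ('k, 'v, 'w) tensor \<Rightarrow> _" by (rule vector_space_fscale)
  show ?thesis unfolding tensor_sub_def by (rule T.span_base) (use assms in blast)
qed

lemma subspace_tensor_sub:
  fixes V :: "('k::field, 'v::ab_group_add, 'x) gspace_scheme"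
    and W :: "('k, 'w::ab_group_add, 'y) gspace_scheme"
  shows "module.subspace fscale (tensor_sub V W S T)"
proof -
  interpret T: vector_space "fscale :: 'k \<Rightarrow> ('k, 'v, 'w) tensor \<Rightarrow> _" by (rule vector_space_fscale)
  show ?thesis unfolding tensor_sub_def by (rule T.subspace_span)
qed

lemma subspace_gr_tensor:
  fixes V :: "('k::field, 'v::ab_group_add, 'x) gspace_scheme"
    and W :: "('k, 'w::ab_group_add, 'y) gspace_scheme"
  shows "module.subspace fscale (gr (V \<otimes> W) n)"
proof -
  interpret T: vector_space "fscale :: 'k \<Rightarrow> ('k, 'v, 'w) tensor \<Rightarrow> _" by (rule vector_space_fscale)
  show ?thesis unfolding tensor_def gspace.simps by (rule T.subspace_span)
qed

lemma pure_gr_tensor: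
  fixes V :: "('k::field, 'v::ab_group_add, 'x) gspace_scheme"
    and W :: "('k, 'w::ab_group_add, 'y) gspace_scheme"
  assumes "v \<in> gr V k" "w \<in> gr W l"
  shows "pure V W v w \<in> gr (V \<otimes> W) (k + l)"
proof -
  interpret T: vector_space "fscale :: 'k \<Rightarrow> ('k, 'v, 'w) tensor \<Rightarrow> _" by (rule vector_space_fscale)
  have "pure V W v w \<in> tensor_sub V W (gr V k) (gr W (k + l - k))"
    by (rule pure_tensor_sub) (use assms in simp_all)
  then show ?thesis unfolding tensor_def gspace.simps
    by (intro T.span_base) (use le_add1 in blast)
qed

lemma gr_tensor_induct [consumes 2, case_names zero add pure]:
  fixes V :: "('k::field, 'v::ab_group_add, 'x) gspace_scheme"
    and W :: "('k, 'w::ab_group_add, 'y) gspace_scheme"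
  assumes t: "t \<in> gr (V \<otimes> W) n" and S: "\<And>k c v. v \<in> gr V k \<Longrightarrow> scl V c v \<in> gr V k"
    and zero: "P 0"
    and add: "\<And>s t. \<lbrakk>s \<in> gr (V \<otimes> W) n; t \<in> gr (V \<otimes> W) n; P s; P t\<rbrakk> \<Longrightarrow> P (s + t)"
    and pure: "\<And>k l v w. \<lbrakk>v \<in> gr V k; w \<in> gr W l; k + l = n\<rbrakk> \<Longrightarrow> P (pure V W v w)"
  shows "P t"
proof -
  interpret T: vector_space "fscale :: 'k \<Rightarrow> ('k, 'v, 'w) tensor \<Rightarrow> _" by (rule vector_space_fscale)
  note sub = subspace_gr_tensor[of V W n]
  let ?G = "\<Union>k\<le>n. tensor_sub V W (gr V k) (gr W (n - k))"
  \<comment> \<open>Membership is carried along with \<open>P\<close>, because \<open>add\<close>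
    applies only to elements of degree \<open>n\<close>.\<close>
  have in_gr: "s \<in> gr (V \<otimes> W) n \<and> P s" if k: "k \<le> n" and s: "s \<in> tensor_sub V W (gr V k) (gr W (n - k))" for s k
  proof (rule tensor_sub_induct[OF s])
    show "scl V c v \<in> gr V k" if "v \<in> gr V k" for c v
      using S[OF that] .
    show "0 \<in> gr (V \<otimes> W) n \<and> P 0"
      using zero T.subspace_0[OF sub] by blast
    show "x + y \<in> gr (V \<otimes> W) n \<and> P (x + y)"
      if "x \<in> gr (V \<otimes> W) n \<and> P x" "y \<in> gr (V \<otimes> W) n \<and> P y" for x y
      using that add T.subspace_add[OF sub] by blast
    show "pure V W v w \<in> gr (V \<otimes> W) n \<and> P (pure V W v w)"
      if "v \<in> gr V k" "w \<in> gr W (n - k)" for v w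
      using pure[OF that] pure_gr_tensor[OF that] k by simp
  qed
  have "t \<in> T.span ?G" using t unfolding tensor_def gspace.simps .
  then have "t \<in> gr (V \<otimes> W) n \<and> P t"
  proof (induction rule: T.span_induct_alt)
    case base
    show ?case using zero T.subspace_0[OF sub] by blast
  next
    case (step c x y)
    then obtain k where k: "k \<le> n" "x \<in> tensor_sub V W (gr V k) (gr W (n - k))" by blast
    have "fscale c x \<in> tensor_sub V W (gr V k) (gr W (n - k))"
      by (rule T.subspace_scale[OF subspace_tensor_sub k(2)])
    from in_gr[OF k(1) this] show ?case using step add T.subspace_add[OF sub] by blast
  qed
  then show ?thesis ..
qed

text \<open>Bilinearity on the carriers, which is the hypothesis of \<open>tensor_universal\<close>;
  the multiplication of a graded algebra is only assumed bilinear there.\<close>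

definition bilinear_on ::
    "('k::field, 'v::ab_group_add, 'x) gspace_scheme \<Rightarrow> ('k, 'w::ab_group_add, 'y) gspace_scheme
     \<Rightarrow> ('k, 'u::ab_group_add, 'z) gspace_scheme \<Rightarrow> ('v \<Rightarrow> 'w \<Rightarrow> 'u) \<Rightarrow> bool" where
  "bilinear_on V W Z h \<longleftrightarrow>
    (\<forall>w\<in>car W. linear_on (car V) (scl V) (scl Z) (\<lambda>v. h v w)) \<and>
    (\<forall>v\<in>car V. linear_on (car W) (scl W) (scl Z) (h v))"

lemma bilinear_onI:
  assumes "\<And>w. w \<in> car W \<Longrightarrow> linear_on (car V) (scl V) (scl Z) (\<lambda>v. h v w)"
    and "\<And>v. v \<in> car V \<Longrightarrow> linear_on (car W) (scl W) (scl Z) (\<lambda>w. h v w)"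
  shows "bilinear_on V W Z h"
  using assms unfolding bilinear_on_def by blast

locale tensor_pair =
  fixes V :: "('k::field, 'v::ab_group_add, 'x) gspace_scheme"
    and W :: "('k, 'w::ab_group_add, 'y) gspace_scheme"
  assumes vs: "vector_space (scl V)" "vector_space (scl W)"
begin

lemma car_pure: "v \<in> car V \<Longrightarrow> w \<in> car W \<Longrightarrow> pure V W v w \<in> car (V \<otimes> W)"
  unfolding car_tensor[OF vs] by (rule pure_tensor_sub)

lemma car_induct [consumes 1, case_names zero add pure]:
  assumes t: "t \<in> car (V \<otimes> W)" and zero: "P 0"
    and add: "\<And>s t. \<lbrakk>s \<in> car (V \<otimes> W); t \<in> car (V \<otimes> W); P s; P t\<rbrakk> \<Longrightarrow> P (s + t)"
    and pure: "\<And>v w. \<lbrakk>v \<in> car V; w \<in> car W\<rbrakk> \<Longrightarrow> P (pure V W v w)"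
  shows "P t"
proof (rule tensor_sub_induct[of t V W "car V" "car W" P])
  interpret V: vector_space "scl V" by (rule vs)
  show "scl V c v \<in> car V" if "v \<in> car V" for c v
    using V.subspace_scale[OF car_subspace[OF vs(1)] that] .
qed (use assms in \<open>simp_all only: car_tensor[OF vs]\<close>)

lemma linear_on_pure_left: "linear_on T (scl V) fscale (\<lambda>v. pure V W v w)"
  and linear_on_pure_right: "linear_on T' (scl W) fscale (pure V W v)"
  by (simp_all add: linear_on_def pure_add_left pure_add_right pure_scale_left pure_scale_right)

lemma lift_linear:
  assumes "vector_space (scl Z)" "bilinear_on V W Z h"
  shows "linear_on T fscale (scl Z) (tensor_lift V W Z h)"
  using tensor_universal(1)[OF vs assms(1)] assms(2) unfolding bilinear_on_def
  by (intro linear_on_if_linear) blast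

lemma lift_pure:
  assumes "vector_space (scl Z)" "bilinear_on V W Z h" "v \<in> car V" "w \<in> car W"
  shows "tensor_lift V W Z h (pure V W v w) = h v w"
  using tensor_universal(2)[OF vs assms(1)] assms(2-4) unfolding bilinear_on_def by blast

lemma linear_on_eqI:
  assumes "vector_space s" "linear_on (car (V \<otimes> W)) fscale s f" "linear_on (car (V \<otimes> W)) fscale s g"
    and "\<And>v w. \<lbrakk>v \<in> car V; w \<in> car W\<rbrakk> \<Longrightarrow> f (pure V W v w) = g (pure V W v w)"
    and "t \<in> car (V \<otimes> W)"
  shows "f t = g t"
  using tensor_eqI[OF vs assms] .

text \<open>For nested lifts as in \<open>middle_map\<close> the inner lift has to depend linearly
  on the outer variables, although each lift is obtained by choice. The choices agree on pure
  tensors, hence on the carrier.\<close>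

lemma lift_linear_param:
  fixes Z :: "('k, 'u::ab_group_add, 'z) gspace_scheme" and U :: "('k, 'p::ab_group_add, 'q) gspace_scheme"
  assumes Z: "vector_space (scl Z)" and U: "vector_space (scl U)"
    and h: "\<And>p. p \<in> car U \<Longrightarrow> bilinear_on V W Z (h p)"
    and lin: "\<And>v w. \<lbrakk>v \<in> car V; w \<in> car W\<rbrakk> \<Longrightarrow> linear_on (car U) (scl U) (scl Z) (\<lambda>p. h p v w)"
    and t: "t \<in> car (V \<otimes> W)"
  shows "linear_on (car U) (scl U) (scl Z) (\<lambda>p. tensor_lift V W Z (h p) t)"
proof -
  interpret U: vector_space "scl U" by fact
  interpret Z: vector_space "scl Z" by fact
  note sub = car_subspace[OF U]
  note L = linear_onD[OF lift_linear[OF Z h, where T = UNIV]]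
  show ?thesis
    unfolding linear_on_def
  proof (intro conjI ballI allI)
    fix x y assume x: "x \<in> car U" and y: "y \<in> car U"
    note xy = U.subspace_add[OF sub x y]
    show "tensor_lift V W Z (h (x + y)) t = tensor_lift V W Z (h x) t + tensor_lift V W Z (h y) t"
      using Z lift_linear[OF Z h[OF xy]] _ _ t
    proof (rule linear_on_eqI)
      show "linear_on (car (V \<otimes> W)) fscale (scl Z) (\<lambda>t. tensor_lift V W Z (h x) t + tensor_lift V W Z (h y) t)"
        using L(1)[OF x] L(2)[OF x] L(1)[OF y] L(2)[OF y]
        by (simp add: linear_on_def Z.scale_right_distrib)
      show "tensor_lift V W Z (h (x + y)) (pure V W v w)
          = tensor_lift V W Z (h x) (pure V W v w) + tensor_lift V W Z (h y) (pure V W v w)"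
        if "v \<in> car V" "w \<in> car W" for v w
        using linear_onD(1)[OF lin[OF that] x y]
        by (simp only: lift_pure[OF Z h[OF xy] that] lift_pure[OF Z h[OF x] that] lift_pure[OF Z h[OF y] that])
    qed
  next
    fix c x assume x: "x \<in> car U"
    note cx = U.subspace_scale[OF sub x, of c]
    show "tensor_lift V W Z (h (scl U c x)) t = scl Z c (tensor_lift V W Z (h x) t)"
      using Z lift_linear[OF Z h[OF cx]] _ _ t
    proof (rule linear_on_eqI)
      show "linear_on (car (V \<otimes> W)) fscale (scl Z) (\<lambda>t. scl Z c (tensor_lift V W Z (h x) t))"
        using L(1)[OF x] L(2)[OF x] by (simp add: linear_on_def Z.scale_right_distrib mult.commute)
      show "tensor_lift V W Z (h (scl U c x)) (pure V W v w) = scl Z c (tensor_lift V W Z (h x) (pure V W v w))"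
        if "v \<in> car V" "w \<in> car W" for v w
        using linear_onD(2)[OF lin[OF that] x]
        by (simp only: lift_pure[OF Z h[OF cx] that] lift_pure[OF Z h[OF x] that])
    qed
  qed
qed

lemma bilinear_on_pure:
  assumes "linear_on (car V) (scl V) (scl V') f" "linear_on (car W) (scl W) (scl W') g"
  shows "bilinear_on V W (V' \<otimes> W') (\<lambda>v w. pure V' W' (f v) (g w))"
  using assms
  by (simp add: bilinear_on_def linear_on_def pure_add_left pure_add_right pure_scale_left pure_scale_right)

lemma tensor_map_linear:
  assumes "linear_on (car V) (scl V) (scl V') f" "linear_on (car W) (scl W) (scl W') g"
  shows "linear_on T fscale fscale (tensor_map V W V' W' f g)"
  using lift_linear[OF vector_space_scl_tensor bilinear_on_pure[OF assms]]
  unfolding tensor_map_def scl_tensor .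

lemma tensor_map_pure:
  assumes "linear_on (car V) (scl V) (scl V') f" "linear_on (car W) (scl W) (scl W') g"
    and "v \<in> car V" "w \<in> car W"
  shows "tensor_map V W V' W' f g (pure V W v w) = pure V' W' (f v) (g w)"
  unfolding tensor_map_def by (rule lift_pure[OF vector_space_scl_tensor bilinear_on_pure[OF assms(1,2)] assms(3,4)])

end

section \<open>Evaluation of the middle map on pure tensors\<close>

lemma linear_on_compose:
  assumes "linear_on S s1 s2 f" "linear_on T s2 s3 g" "f ` S \<subseteq> T"
  shows "linear_on S s1 s3 (\<lambda>x. g (f x))"
  using assms unfolding linear_on_def by (auto simp: image_subset_iff)

context
  fixes X :: "('k::field, 'x::ab_group_add, 'x0) gspace_scheme"
    and Y :: "('k, 'y::ab_group_add, 'y0) gspace_scheme"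
    and Z :: "('k, 'z::ab_group_add, 'z0) gspace_scheme"
    and W :: "('k, 'w::ab_group_add, 'w0) gspace_scheme"
    and Y' :: "('k, 'y'::ab_group_add, 'y1) gspace_scheme"
    and Z' :: "('k, 'z'::ab_group_add, 'z1) gspace_scheme"
    and f :: "('k, 'y, 'z) tensor \<Rightarrow> ('k, 'y', 'z') tensor"
  assumes vs: "vector_space (scl X)" "vector_space (scl Y)" "vector_space (scl Z)"
      "vector_space (scl W)" "vector_space (scl Y')" "vector_space (scl Z')"
    and f: "linear_on (car (Y \<otimes> Z)) fscale fscale f" "f ` car (Y \<otimes> Z) \<subseteq> car (Y' \<otimes> Z')"
begin

interpretation XY: tensor_pair X Y by (rule tensor_pair.intro; rule vs)
interpretation YZ: tensor_pair Y Z by (rule tensor_pair.intro; rule vs)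
interpretation ZW: tensor_pair Z W by (rule tensor_pair.intro; rule vs)
interpretation YZ': tensor_pair Y' Z' by (rule tensor_pair.intro; rule vs)
interpretation XYZW: tensor_pair "X \<otimes> Y" "Z \<otimes> W" by (rule tensor_pair.intro; rule vector_space_scl_tensor)

private abbreviation "T \<equiv> (X \<otimes> Y') \<otimes> (Z' \<otimes> W)"

text \<open>\<open>J\<close> and \<open>K\<close> are the two innermost of the nested lifts in
  \<open>middle_map\<close>. A lift can be evaluated only once bilinearity is known at its level, so
  the levels are treated from the inside out.\<close>

private definition "J x w = tensor_lift Y' Z' T (\<lambda>y' z'. pure (X \<otimes> Y') (Z' \<otimes> W) (pure X Y' x y') (pure Z' W z' w))"
private definition "K x y = tensor_lift Z W T (\<lambda>z w. J x w (f (pure Y Z y z)))"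

private lemma T: "vector_space (scl T)"
  by (rule vector_space_scl_tensor)

private lemmas pures = pure_add_left pure_add_right pure_scale_left pure_scale_right
  pure_scale_left[of "_ \<otimes> _", unfolded scl_tensor] pure_scale_right[of _ "_ \<otimes> _", unfolded scl_tensor]

private lemma J_bilinear: "bilinear_on Y' Z' T (\<lambda>y' z'. pure (X \<otimes> Y') (Z' \<otimes> W) (pure X Y' x y') (pure Z' W z' w))"
  by (simp add: bilinear_on_def linear_on_def pures)

private lemma J_linear: "linear_on S fscale fscale (J x w)"
  unfolding J_def using YZ'.lift_linear[OF T J_bilinear] unfolding scl_tensor .

private lemma J_linear_x:
  assumes "p \<in> car (Y' \<otimes> Z')"
  shows "linear_on (car X) (scl X) fscale (\<lambda>x. J x w p)"
  unfolding J_def scl_tensor[of "X \<otimes> Y'" "Z' \<otimes> W", symmetric]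
  by (rule YZ'.lift_linear_param[OF T vs(1) J_bilinear _ assms]) (simp add: linear_on_def pures)

private lemma J_linear_w:
  assumes "p \<in> car (Y' \<otimes> Z')"
  shows "linear_on (car W) (scl W) fscale (\<lambda>w. J x w p)"
  unfolding J_def scl_tensor[of "X \<otimes> Y'" "Z' \<otimes> W", symmetric]
  by (rule YZ'.lift_linear_param[OF T vs(4) J_bilinear _ assms]) (simp add: linear_on_def pures)

private lemma f_pure: "y \<in> car Y \<Longrightarrow> z \<in> car Z \<Longrightarrow> f (pure Y Z y z) \<in> car (Y' \<otimes> Z')"
  using f(2) YZ.car_pure by blast

private lemma Jf_linear:
  shows "y \<in> car Y \<Longrightarrow> linear_on (car Z) (scl Z) fscale (\<lambda>z. J x w (f (pure Y Z y z)))"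
    and "z \<in> car Z \<Longrightarrow> linear_on (car Y) (scl Y) fscale (\<lambda>y. J x w (f (pure Y Z y z)))"
proof -
  note fJ = linear_on_compose[OF f(1) J_linear[of UNIV x w] subset_UNIV]
  show "linear_on (car Z) (scl Z) fscale (\<lambda>z. J x w (f (pure Y Z y z)))" if "y \<in> car Y"
    by (rule linear_on_compose[OF YZ.linear_on_pure_right fJ]) (use YZ.car_pure that in blast)
  show "linear_on (car Y) (scl Y) fscale (\<lambda>y. J x w (f (pure Y Z y z)))" if "z \<in> car Z"
    by (rule linear_on_compose[OF YZ.linear_on_pure_left fJ]) (use YZ.car_pure that in blast)
qed

private lemma K_bilinear:
  assumes "y \<in> car Y"
  shows "bilinear_on Z W T (\<lambda>z w. J x w (f (pure Y Z y z)))"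
  by (rule bilinear_onI; unfold scl_tensor) (rule Jf_linear(1)[OF assms] J_linear_w f_pure[OF assms] | assumption)+

private lemma K_linear: "y \<in> car Y \<Longrightarrow> linear_on S fscale fscale (K x y)"
  unfolding K_def using ZW.lift_linear[OF T K_bilinear] unfolding scl_tensor .

private lemma K_bilinear_xy:
  assumes t: "t \<in> car (Z \<otimes> W)"
  shows "bilinear_on X Y T (\<lambda>x y. K x y t)"
proof (rule bilinear_onI)
  fix y assume y: "y \<in> car Y"
  show "linear_on (car X) (scl X) (scl T) (\<lambda>x. K x y t)"
    unfolding K_def
    by (rule ZW.lift_linear_param[OF T vs(1) K_bilinear[OF y] _ t])
      (unfold scl_tensor, rule J_linear_x, rule f_pure[OF y])
next
  fix x assume x: "x \<in> car X"
  show "linear_on (car Y) (scl Y) (scl T) (\<lambda>y. K x y t)"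
    unfolding K_def
    by (rule ZW.lift_linear_param[OF T vs(2) K_bilinear _ t])
      (assumption, unfold scl_tensor, rule Jf_linear(2))
qed

private lemma middle_bilinear:
  "bilinear_on (X \<otimes> Y) (Z \<otimes> W) T (\<lambda>s t. tensor_lift X Y T (\<lambda>x y. K x y t) s)"
proof (rule bilinear_onI)
  fix t assume t: "t \<in> car (Z \<otimes> W)"
  show "linear_on (car (X \<otimes> Y)) (scl (X \<otimes> Y)) (scl T) (tensor_lift X Y T (\<lambda>x y. K x y t))"
    unfolding scl_tensor(1)[of X Y] by (rule XY.lift_linear[OF T K_bilinear_xy[OF t]])
next
  fix s assume s: "s \<in> car (X \<otimes> Y)"
  show "linear_on (car (Z \<otimes> W)) (scl (Z \<otimes> W)) (scl T) (\<lambda>t. tensor_lift X Y T (\<lambda>x y. K x y t) s)"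
    by (rule XY.lift_linear_param[OF T vector_space_scl_tensor K_bilinear_xy _ s])
      (assumption, unfold scl_tensor, rule K_linear)
qed

private lemma middle_map_eq:
  "middle_map X Y Z W Y' Z' f = tensor_lift (X \<otimes> Y) (Z \<otimes> W) T (\<lambda>s t. tensor_lift X Y T (\<lambda>x y. K x y t) s)"
  unfolding middle_map_def Let_def K_def J_def ..

lemma middle_map_linear: "linear_on S fscale fscale (middle_map X Y Z W Y' Z' f)"
  unfolding middle_map_eq using XYZW.lift_linear[OF T middle_bilinear] unfolding scl_tensor .

lemma middle_map_pure:
  assumes "x \<in> car X" "y \<in> car Y" "z \<in> car Z" "w \<in> car W"
  shows "middle_map X Y Z W Y' Z' f (pure (X \<otimes> Y) (Z \<otimes> W) (pure X Y x y) (pure Z W z w)) =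
    tensor_lift Y' Z' ((X \<otimes> Y') \<otimes> (Z' \<otimes> W))
      (\<lambda>y' z'. pure (X \<otimes> Y') (Z' \<otimes> W) (pure X Y' x y') (pure Z' W z' w)) (f (pure Y Z y z))"
  unfolding middle_map_eq XYZW.lift_pure[OF T middle_bilinear XY.car_pure[OF assms(1,2)] ZW.car_pure[OF assms(3,4)]]
    XY.lift_pure[OF T K_bilinear_xy[OF ZW.car_pure[OF assms(3,4)]] assms(1,2)]
  unfolding K_def ZW.lift_pure[OF T K_bilinear[OF assms(2)] assms(3,4)]
  unfolding J_def ..

text \<open>The lift left over in \<open>middle_map_pure\<close>, in a form that can be evaluated
  outside this context.\<close>

lemma middle_lift:
  "linear_on S fscale fscale (tensor_lift Y' Z' ((X \<otimes> Y') \<otimes> (Z' \<otimes> W))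
      (\<lambda>y' z'. pure (X \<otimes> Y') (Z' \<otimes> W) (pure X Y' x y') (pure Z' W z' w)))"
  "\<lbrakk>y' \<in> car Y'; z' \<in> car Z'\<rbrakk> \<Longrightarrow> tensor_lift Y' Z' ((X \<otimes> Y') \<otimes> (Z' \<otimes> W))
      (\<lambda>y' z'. pure (X \<otimes> Y') (Z' \<otimes> W) (pure X Y' x y') (pure Z' W z' w)) (pure Y' Z' y' z') =
    pure (X \<otimes> Y') (Z' \<otimes> W) (pure X Y' x y') (pure Z' W z' w)"
  using J_linear[of S x w] YZ'.lift_pure[OF T J_bilinear] unfolding J_def by blast+

end

section \<open>The twisted tensor product algebra\<close>

text \<open>Tensors are functions; without this the simplifier evaluates sums of tensors pointwise.\<close>

declare plus_fun_apply [simp del] zero_fun_apply [simp del]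

context connected_graded_algebra
begin

lemma tensor_pair_self: "tensor_pair A A"
  by (rule tensor_pair.intro; rule vector_space)

lemma mult_linear:
  shows "x \<in> car A \<Longrightarrow> linear_on (car A) (scl A) (scl A) (mult A x)"
    and "y \<in> car A \<Longrightarrow> linear_on (car A) (scl A) (scl A) (\<lambda>x. mult A x y)"
  by (simp_all add: linear_on_def distrib_left distrib_right scale_mult_left scale_mult_right)

lemma mult_bilinear: "bilinear_on A A A (mult A)"
  using mult_linear unfolding bilinear_on_def by blast

lemma mu_linear: "linear_on T fscale (scl A) (mu A)"
  unfolding mu_def by (rule tensor_pair.lift_linear[OF tensor_pair_self vector_space mult_bilinear])

lemma mu_pure: "x \<in> car A \<Longrightarrow> y \<in> car A \<Longrightarrow> mu A (pure A A x y) = mult A x y"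
  unfolding mu_def by (rule tensor_pair.lift_pure[OF tensor_pair_self vector_space mult_bilinear])

lemmas mu_add = linear_onD(1)[OF mu_linear UNIV_I UNIV_I]
  and mu_zero = linear_on_zero[OF vector_space_fscale vector_space mu_linear UNIV_I]

lemma hcomp_linear: "linear_on (car A) (scl A) (scl A) (hcomp A n)"
  by (simp add: linear_on_def hcomp_add hcomp_scale)

lemma mu_car: "t \<in> car (A \<otimes> A) \<Longrightarrow> mu A t \<in> car A"
  by (induction t rule: tensor_pair.car_induct[OF tensor_pair_self, consumes 1])
    (simp_all add: mu_zero car_zero mu_add car_add mu_pure mult_car)

end

locale twisted_product =
  A: connected_graded_algebra A + B: connected_graded_algebra B
  for A :: "('k::field, 'a::ab_group_add) galg" and B :: "('k, 'b::ab_group_add) galg" +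
  fixes \<tau> :: "('k, 'b, 'a) tensor \<Rightarrow> ('k, 'a, 'b) tensor"
  assumes twisting: "graded_twisting_map A B \<tau>"
begin

sublocale AB: tensor_pair A B by (rule tensor_pair.intro; rule A.vector_space B.vector_space)
sublocale BA: tensor_pair B A by (rule tensor_pair.intro; rule A.vector_space B.vector_space)
sublocale AA: tensor_pair A A by (rule A.tensor_pair_self)
sublocale BB: tensor_pair B B by (rule B.tensor_pair_self)
sublocale AABB: tensor_pair "A \<otimes> A" "B \<otimes> B" by (rule tensor_pair.intro; rule vector_space_scl_tensor)
sublocale BABA: tensor_pair "B \<otimes> A" "B \<otimes> A" by (rule tensor_pair.intro; rule vector_space_scl_tensor)
sublocale BBAA: tensor_pair "B \<otimes> B" "A \<otimes> A" by (rule tensor_pair.intro; rule vector_space_scl_tensor)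

sublocale V: vector_space "fscale :: 'k \<Rightarrow> ('k, 'a, 'b) tensor \<Rightarrow> _" by (rule vector_space_fscale)

abbreviation C :: "('k, ('k, 'a, 'b) tensor) galg" where "C \<equiv> twisted_tensor A B \<tau>"

abbreviation prod_C (infixl "\<cdot>" 72) where "s \<cdot> t \<equiv> mult C s t"

abbreviation pr (infix "\<diamondop>" 74) where "a \<diamondop> b \<equiv> pure A B a b"

abbreviation "AB \<equiv> A \<otimes> B"

lemma tau_linear: "linear_on (car (B \<otimes> A)) fscale fscale \<tau>"
  and tau_gr: "t \<in> gr (B \<otimes> A) n \<Longrightarrow> \<tau> t \<in> gr AB n"
  and tau_unit_left: "a \<in> car A \<Longrightarrow> \<tau> (pure B A (unit B) a) = a \<diamondop> unit B"
  and tau_unit_right: "b \<in> car B \<Longrightarrow> \<tau> (pure B A b (unit A)) = unit A \<diamondop> b"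
  using twisting unfolding graded_twisting_map_def graded_linear_def scl_tensor by blast+

lemma gr_car_AB: "t \<in> gr AB n \<Longrightarrow> t \<in> car AB"
  unfolding car_def scl_tensor by (rule V.span_base) blast

lemma car_subspace_AB: "V.subspace (car AB)"
  unfolding car_def scl_tensor by (rule V.subspace_span)

lemma tau_car: "t \<in> car (B \<otimes> A) \<Longrightarrow> \<tau> t \<in> car AB"
proof -
  assume t: "t \<in> car (B \<otimes> A)"
  interpret U: vector_space "fscale :: 'k \<Rightarrow> ('k, 'b, 'a) tensor \<Rightarrow> _" by (rule vector_space_fscale)
  have sub: "U.subspace {t \<in> car (B \<otimes> A). \<tau> t \<in> car AB}"
  proof (rule U.subspaceI)
    have c: "U.subspace (car (B \<otimes> A))" unfolding car_def scl_tensor by (rule U.subspace_span)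
    show "0 \<in> {t \<in> car (B \<otimes> A). \<tau> t \<in> car AB}"
      using linear_on_zero[OF vector_space_fscale vector_space_fscale tau_linear t]
        U.subspace_0[OF c] V.subspace_0[OF car_subspace_AB] by simp
    show "x + y \<in> {t \<in> car (B \<otimes> A). \<tau> t \<in> car AB}"
      if "x \<in> {t \<in> car (B \<otimes> A). \<tau> t \<in> car AB}" "y \<in> {t \<in> car (B \<otimes> A). \<tau> t \<in> car AB}" for x y
      using that linear_onD(1)[OF tau_linear] U.subspace_add[OF c] V.subspace_add[OF car_subspace_AB] by simp
    show "fscale k x \<in> {t \<in> car (B \<otimes> A). \<tau> t \<in> car AB}"
      if "x \<in> {t \<in> car (B \<otimes> A). \<tau> t \<in> car AB}" for k x
      using that linear_onD(2)[OF tau_linear] U.subspace_scale[OF c] V.subspace_scale[OF car_subspace_AB] by simp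
  qed
  have "gr (B \<otimes> A) n \<subseteq> {t \<in> car (B \<otimes> A). \<tau> t \<in> car AB}" for n
    using tau_gr gr_car_AB unfolding car_def[of "B \<otimes> A"] scl_tensor by (auto intro: U.span_base)
  then have "car (B \<otimes> A) \<subseteq> {t \<in> car (B \<otimes> A). \<tau> t \<in> car AB}"
    unfolding car_def[of "B \<otimes> A"] scl_tensor by (intro U.span_minimal UN_least sub[unfolded car_def[of "B \<otimes> A"] scl_tensor])
  then show ?thesis using t by blast
qed

lemma tau_pure_car: "b \<in> car B \<Longrightarrow> a \<in> car A \<Longrightarrow> \<tau> (pure B A b a) \<in> car AB"
  by (rule tau_car[OF BA.car_pure])

text \<open>The action of the outer factors in
  \<open>(a \<diamondop> b) \<cdot> (a' \<diamondop> b')\<close> on the twisted inner pair: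
  \<open>x \<otimes> y\<close> goes to \<open>a x \<otimes> y b\<close>.\<close>

definition two_sided :: "'a \<Rightarrow> 'b \<Rightarrow> ('k, 'a, 'b) tensor \<Rightarrow> ('k, 'a, 'b) tensor" where
  "two_sided a b = tensor_map A B A B (mult A a) (\<lambda>y. mult B y b)"

lemma two_sided_linear: "a \<in> car A \<Longrightarrow> b \<in> car B \<Longrightarrow> linear_on S fscale fscale (two_sided a b)"
  unfolding two_sided_def by (rule AB.tensor_map_linear[OF A.mult_linear(1) B.mult_linear(2)])

lemmas two_sided_add = linear_onD(1)[OF two_sided_linear UNIV_I UNIV_I]
  and two_sided_zero = linear_on_zero[OF vector_space_fscale vector_space_fscale two_sided_linear UNIV_I]

lemma two_sided_pure:
  "\<lbrakk>a \<in> car A; b \<in> car B; x \<in> car A; y \<in> car B\<rbrakk> \<Longrightarrow> two_sided a b (x \<diamondop> y) = mult A a x \<diamondop> mult B y b"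
  unfolding two_sided_def by (rule AB.tensor_map_pure[OF A.mult_linear(1) B.mult_linear(2)])

abbreviation "mu_mu \<equiv> tensor_map (A \<otimes> A) (B \<otimes> B) A B (mu A) (mu B)"
abbreviation "mid \<equiv> middle_map A B A B A B \<tau>"

lemma mu_mu_linear: "linear_on S fscale fscale mu_mu"
  by (rule AABB.tensor_map_linear; unfold scl_tensor; rule A.mu_linear B.mu_linear)

lemma mu_mu_pure:
  "\<lbrakk>a \<in> car A; x \<in> car A; y \<in> car B; b \<in> car B\<rbrakk> \<Longrightarrow>
    mu_mu (pure (A \<otimes> A) (B \<otimes> B) (pure A A a x) (pure B B y b)) = mult A a x \<diamondop> mult B y b"
  using AABB.tensor_map_pure[of A "mu A" B "mu B", unfolded scl_tensor, OF A.mu_linear B.mu_linear AA.car_pure BB.car_pure]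
  by (simp add: A.mu_pure B.mu_pure)

lemma tau_image: "\<tau> ` car (B \<otimes> A) \<subseteq> car AB"
  using tau_car by blast

lemmas vss = A.vector_space B.vector_space

lemmas mid_linear = middle_map_linear[OF vss vss vss tau_linear tau_image]
lemmas mid_pure = middle_map_pure[OF vss vss vss tau_linear tau_image]
lemmas mid_lift = middle_lift[OF vss vss vss tau_linear tau_image]

lemma mult_C: "s \<cdot> t = mu_mu (mid (pure AB AB s t))"
  by (simp add: twisted_tensor_def)

lemma mu_mu_mid_linear: "linear_on UNIV fscale fscale (\<lambda>u. mu_mu (mid u))"
  by (rule linear_on_compose[OF mid_linear mu_mu_linear subset_UNIV])

lemma mult_C_add_left: "(s + s') \<cdot> t = s \<cdot> t + s' \<cdot> t"
  and mult_C_add_right: "s \<cdot> (t + t') = s \<cdot> t + s \<cdot> t'"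
  and mult_C_scale_left: "fscale c s \<cdot> t = fscale c (s \<cdot> t)"
  and mult_C_scale_right: "s \<cdot> fscale c t = fscale c (s \<cdot> t)"
  unfolding mult_C pure_add_left pure_add_right
    pure_scale_left[of "A \<otimes> B", unfolded scl_tensor] pure_scale_right[of _ "A \<otimes> B", unfolded scl_tensor]
  by (rule linear_onD(1)[OF mu_mu_mid_linear UNIV_I UNIV_I] linear_onD(2)[OF mu_mu_mid_linear UNIV_I])+

lemma mult_C_zero_left: "0 \<cdot> t = 0" and mult_C_zero_right: "t \<cdot> 0 = 0"
  using mult_C_add_left[of 0 0 t] mult_C_add_right[of t 0 0] by simp_all

text \<open>Both sides are linear in the tensor \<open>\<tau> (pure B A b a')\<close>, so they are
  compared with a pure tensor in its place.\<close>

lemma mult_pure: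
  assumes "a \<in> car A" "b \<in> car B" "a' \<in> car A" "b' \<in> car B"
  shows "(a \<diamondop> b) \<cdot> (a' \<diamondop> b') = two_sided a b' (\<tau> (pure B A b a'))"
  unfolding mult_C mid_pure[OF assms]
  using vector_space_fscale linear_on_compose[OF mid_lift(1) mu_mu_linear subset_UNIV] two_sided_linear[OF assms(1,4)] _
    tau_pure_car[OF assms(2,3)]
proof (rule AB.linear_on_eqI)
  fix x y assume xy: "x \<in> car A" "y \<in> car B"
  show "mu_mu (tensor_lift A B ((A \<otimes> A) \<otimes> B \<otimes> B)
       (\<lambda>y' z'. pure (A \<otimes> A) (B \<otimes> B) (pure A A a y') (pure B B z' b')) (x \<diamondop> y)) = two_sided a b' (x \<diamondop> y)"
    unfolding mid_lift(2)[OF xy] mu_mu_pure[OF assms(1) xy assms(4)] two_sided_pure[OF assms(1,4) xy] ..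
qed

text \<open>The twisting axiom at four elements. Its right side depends on
  \<open>\<tau> (pure B A b' a)\<close> through a linear map \<open>H\<close>, recorded by its
  values on pure tensors. Setting \<open>a'\<close> or \<open>b\<close> to the unit gives the two
  one-sided compatibilities used for associativity.\<close>

lemma hexagon:
  assumes b: "b \<in> car B" "b' \<in> car B" and a: "a \<in> car A" "a' \<in> car A"
  shows "\<exists>H. linear_on (car AB) fscale fscale H \<and>
    (\<forall>x\<in>car A. \<forall>y\<in>car B. H (x \<diamondop> y) = \<tau> (pure B A b x) \<cdot> \<tau> (pure B A y a')) \<and>
    \<tau> (pure B A (mult B b b') (mult A a a')) = H (\<tau> (pure B A b' a))"
proof -
  let ?J = "tensor_lift A B ((B \<otimes> A) \<otimes> (B \<otimes> A)) (\<lambda>y' z'. pure (B \<otimes> A) (B \<otimes> A) (pure B A b y') (pure B A z' a'))"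
  let ?TT = "tensor_map (B \<otimes> A) (B \<otimes> A) AB AB \<tau> \<tau>"
  let ?H = "\<lambda>t. mu_mu (mid (?TT (?J t)))"
  have vs: "vector_space (scl B)" "vector_space (scl B)" "vector_space (scl A)"
      "vector_space (scl A)" "vector_space (scl A)" "vector_space (scl B)" by (rule vss)+
  note ml = middle_lift[OF vs tau_linear tau_image]
  have tl: "linear_on (car (B \<otimes> A)) (scl (B \<otimes> A)) (scl AB) \<tau>" unfolding scl_tensor by (rule tau_linear)
  have TT: "linear_on UNIV fscale fscale ?TT" by (rule BABA.tensor_map_linear[OF tl tl])
  have lin: "linear_on (car AB) fscale fscale ?H"
    by (rule linear_on_compose[OF linear_on_compose[OF ml(1) TT subset_UNIV] mu_mu_mid_linear subset_UNIV])
  have pure: "?H (x \<diamondop> y) = \<tau> (pure B A b x) \<cdot> \<tau> (pure B A y a')" if xy: "x \<in> car A" "y \<in> car B" for x y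
    unfolding ml(2)[OF xy] BABA.tensor_map_pure[OF tl tl BA.car_pure[OF b(1) xy(1)] BA.car_pure[OF xy(2) a(2)]]
      mult_C ..
  let ?t = "pure (B \<otimes> B) (A \<otimes> A) (pure B B b b') (pure A A a a')"
  have t: "?t \<in> car ((B \<otimes> B) \<otimes> (A \<otimes> A))" by (intro BBAA.car_pure BB.car_pure AA.car_pure a b)
  have hex: "\<tau> (tensor_map (B \<otimes> B) (A \<otimes> A) B A (mu B) (mu A) ?t)
      = mu_mu (mid (?TT (middle_map B B A A A B \<tau> ?t)))"
    using twisting t unfolding graded_twisting_map_def by blast
  have l: "tensor_map (B \<otimes> B) (A \<otimes> A) B A (mu B) (mu A) ?t = pure B A (mult B b b') (mult A a a')"
    using BBAA.tensor_map_pure[of B "mu B" A "mu A", unfolded scl_tensor, OF B.mu_linear A.mu_linear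
      BB.car_pure[OF b] AA.car_pure[OF a]] b a by (simp add: A.mu_pure B.mu_pure)
  have r: "middle_map B B A A A B \<tau> ?t = ?J (\<tau> (pure B A b' a))"
    by (rule middle_map_pure[OF vs tau_linear tau_image b a])
  show ?thesis
    by (intro exI[of _ ?H] conjI ballI) (fact lin pure hex[unfolded l r])+
qed

section \<open>The embeddings of the two factors, and associativity\<close>

abbreviation "\<iota> a \<equiv> a \<diamondop> unit B"
abbreviation "\<kappa> b \<equiv> unit A \<diamondop> b"

lemma iota_mult_pure:
  "\<lbrakk>a \<in> car A; x \<in> car A; y \<in> car B\<rbrakk> \<Longrightarrow> \<iota> a \<cdot> (x \<diamondop> y) = mult A a x \<diamondop> y"
  by (simp add: mult_pure B.unit_car tau_unit_left two_sided_pure B.unit_left)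

lemma pure_mult_kappa:
  "\<lbrakk>b \<in> car B; x \<in> car A; y \<in> car B\<rbrakk> \<Longrightarrow> (x \<diamondop> y) \<cdot> \<kappa> b = x \<diamondop> mult B y b"
  by (simp add: mult_pure A.unit_car tau_unit_right two_sided_pure A.unit_right)

lemma iota_mult_kappa: "\<lbrakk>a \<in> car A; b \<in> car B\<rbrakk> \<Longrightarrow> \<iota> a \<cdot> \<kappa> b = a \<diamondop> b"
  by (simp add: iota_mult_pure A.unit_car A.unit_right)

lemma pure_car: "\<lbrakk>a \<in> car A; b \<in> car B\<rbrakk> \<Longrightarrow> a \<diamondop> b \<in> car AB"
  by (rule AB.car_pure)

lemma iota_car: "a \<in> car A \<Longrightarrow> \<iota> a \<in> car AB" and kappa_car: "b \<in> car B \<Longrightarrow> \<kappa> b \<in> car AB"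
  by (simp_all add: pure_car A.unit_car B.unit_car)

lemma mult_C_linear: "linear_on S fscale fscale (\<lambda>t. s \<cdot> t)" "linear_on S fscale fscale (\<lambda>t. t \<cdot> s)"
  by (simp_all add: linear_on_def mult_C_add_left mult_C_add_right mult_C_scale_left mult_C_scale_right)

lemma two_sided_car: "\<lbrakk>a \<in> car A; b \<in> car B; t \<in> car AB\<rbrakk> \<Longrightarrow> two_sided a b t \<in> car AB"
  by (rotate_tac 2, induction rule: AB.car_induct)
    (simp_all add: two_sided_add two_sided_pure pure_car A.mult_car B.mult_car
      two_sided_zero
      V.subspace_0[OF car_subspace_AB] V.subspace_add[OF car_subspace_AB])

lemma kappa_mult_iota: "\<lbrakk>b \<in> car B; a \<in> car A\<rbrakk> \<Longrightarrow> \<kappa> b \<cdot> \<iota> a = \<tau> (pure B A b a)"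
proof -
  assume b: "b \<in> car B" and a: "a \<in> car A"
  have id: "two_sided (unit A) (unit B) t = t" if "t \<in> car AB" for t
    using that
    by (induction rule: AB.car_induct)
      (simp_all add: two_sided_add two_sided_pure A.unit_car B.unit_car
        two_sided_zero A.unit_left B.unit_right)
  show ?thesis using a b by (simp add: mult_pure A.unit_car B.unit_car id tau_pure_car)
qed

lemma mult_C_car:
  assumes s: "s \<in> car AB" and t: "t \<in> car AB"
  shows "s \<cdot> t \<in> car AB"
  using s
proof (induction rule: AB.car_induct)
  case (pure a b)
  show ?case using t
    by (induction rule: AB.car_induct)
      (simp_all add: mult_C_zero_right mult_C_add_right V.subspace_0[OF car_subspace_AB]
        V.subspace_add[OF car_subspace_AB] mult_pure pure two_sided_car tau_pure_car)
qed (simp_all add: mult_C_zero_left mult_C_add_left V.subspace_0[OF car_subspace_AB] V.subspace_add[OF car_subspace_AB])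

text \<open>Left multiplication by \<open>A\<close> acts on the outermost left factor and so
  commutes with the twisting further inside; \<open>kappa_assoc\<close> is the mirror image.\<close>

lemma iota_assoc:
  assumes a: "a \<in> car A" and t: "t \<in> car AB" and u: "u \<in> car AB"
  shows "(\<iota> a \<cdot> t) \<cdot> u = \<iota> a \<cdot> (t \<cdot> u)"
  using t
proof (induction rule: AB.car_induct)
  case (pure x y)
  show ?case using u
  proof (induction rule: AB.car_induct)
    case (pure x' y')
    note xy = \<open>x \<in> car A\<close> \<open>y \<in> car B\<close>
    have tc: "\<tau> (pure B A y x') \<in> car AB" using tau_pure_car xy pure by blast
    have "two_sided (mult A a x) y' t = \<iota> a \<cdot> two_sided x y' t" if "t \<in> car AB" for t
      using that
    proof (induction rule: AB.car_induct)
      case (pure v w)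
      then show ?case using a xy \<open>y' \<in> car B\<close>
        by (simp add: two_sided_pure A.mult_car iota_mult_pure B.mult_car A.mult_assoc)
    qed (use a xy \<open>y' \<in> car B\<close> in \<open>simp_all add: mult_C_zero_right mult_C_add_right A.mult_car
        two_sided_add
        two_sided_zero\<close>)
    then show ?case using a xy pure tc by (simp add: iota_mult_pure mult_pure A.mult_car)
  qed (simp_all add: mult_C_zero_right mult_C_add_right)
qed (simp_all add: mult_C_zero_left mult_C_zero_right mult_C_add_left mult_C_add_right)

lemma kappa_assoc:
  assumes b: "b \<in> car B" and s: "s \<in> car AB" and t: "t \<in> car AB"
  shows "(s \<cdot> t) \<cdot> \<kappa> b = s \<cdot> (t \<cdot> \<kappa> b)"
  using s
proof (induction rule: AB.car_induct)
  case (pure x y)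
  show ?case using t
  proof (induction rule: AB.car_induct)
    case (pure x' y')
    note xy = \<open>x \<in> car A\<close> \<open>y \<in> car B\<close>
    have tc: "\<tau> (pure B A y x') \<in> car AB" using tau_pure_car xy pure by blast
    have "two_sided x (mult B y' b) t = two_sided x y' t \<cdot> \<kappa> b" if "t \<in> car AB" for t
      using that
    proof (induction rule: AB.car_induct)
      case (pure v w)
      then show ?case using b xy \<open>y' \<in> car B\<close>
        by (simp add: two_sided_pure B.mult_car pure_mult_kappa A.mult_car B.mult_assoc)
    qed (use b xy \<open>y' \<in> car B\<close> in \<open>simp_all add: mult_C_zero_left mult_C_add_left B.mult_car
        two_sided_add
        two_sided_zero\<close>)
    then show ?case using b xy pure tc by (simp add: pure_mult_kappa mult_pure B.mult_car)
  qed (simp_all add: mult_C_zero_left mult_C_zero_right mult_C_add_left mult_C_add_right)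
qed (simp_all add: mult_C_zero_left mult_C_zero_right mult_C_add_left mult_C_add_right)

text \<open>With \<open>a' = 1\<close> in \<open>hexagon\<close>, the map \<open>H\<close> is left
  multiplication by \<open>\<kappa> b\<close>.\<close>

lemma kappa_mult_assoc_iota:
  assumes b: "b \<in> car B" "b' \<in> car B" and a: "a \<in> car A"
  shows "\<kappa> (mult B b b') \<cdot> \<iota> a = \<kappa> b \<cdot> (\<kappa> b' \<cdot> \<iota> a)"
proof -
  obtain H where H: "linear_on (car AB) fscale fscale H"
    "\<forall>x\<in>car A. \<forall>y\<in>car B. H (x \<diamondop> y) = \<tau> (pure B A b x) \<cdot> \<tau> (pure B A y (unit A))"
    "\<tau> (pure B A (mult B b b') (mult A a (unit A))) = H (\<tau> (pure B A b' a))"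
    using hexagon[OF b a A.unit_car] by blast
  have "H t = \<kappa> b \<cdot> t" if "t \<in> car AB" for t
    using vector_space_fscale H(1) mult_C_linear(1) _ that
  proof (rule AB.linear_on_eqI)
    fix x y assume xy: "x \<in> car A" "y \<in> car B"
    have "\<kappa> b \<cdot> (x \<diamondop> y) = \<kappa> b \<cdot> (\<iota> x \<cdot> \<kappa> y)" using xy by (simp add: iota_mult_kappa)
    also have "\<dots> = (\<kappa> b \<cdot> \<iota> x) \<cdot> \<kappa> y" using xy b by (simp add: kappa_assoc iota_car kappa_car)
    finally show "H (x \<diamondop> y) = \<kappa> b \<cdot> (x \<diamondop> y)"
      using xy b by (simp add: H(2) tau_unit_right kappa_mult_iota)
  qed
  then show ?thesis using H(3) a b by (simp add: kappa_mult_iota B.mult_car A.unit_right tau_pure_car)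
qed

text \<open>With the first element of \<open>B\<close> in \<open>hexagon\<close> equal to 1, the map
  \<open>H\<close> is right multiplication by \<open>\<iota> a'\<close>.\<close>

lemma kappa_assoc_iota_mult:
  assumes b: "b \<in> car B" and a: "a \<in> car A" "a' \<in> car A"
  shows "\<kappa> b \<cdot> \<iota> (mult A a a') = (\<kappa> b \<cdot> \<iota> a) \<cdot> \<iota> a'"
proof -
  obtain H where H: "linear_on (car AB) fscale fscale H"
    "\<forall>x\<in>car A. \<forall>y\<in>car B. H (x \<diamondop> y) = \<tau> (pure B A (unit B) x) \<cdot> \<tau> (pure B A y a')"
    "\<tau> (pure B A (mult B (unit B) b) (mult A a a')) = H (\<tau> (pure B A b a))"
    using hexagon[OF B.unit_car b a] by blast
  have "H t = t \<cdot> \<iota> a'" if "t \<in> car AB" for t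
    using vector_space_fscale H(1) mult_C_linear(2) _ that
  proof (rule AB.linear_on_eqI)
    fix x y assume xy: "x \<in> car A" "y \<in> car B"
    have "(x \<diamondop> y) \<cdot> \<iota> a' = (\<iota> x \<cdot> \<kappa> y) \<cdot> \<iota> a'" using xy by (simp add: iota_mult_kappa)
    also have "\<dots> = \<iota> x \<cdot> (\<kappa> y \<cdot> \<iota> a')" using xy a by (simp add: iota_assoc iota_car kappa_car)
    finally show "H (x \<diamondop> y) = (x \<diamondop> y) \<cdot> \<iota> a'"
      using xy a by (simp add: H(2) tau_unit_left kappa_mult_iota)
  qed
  then show ?thesis using H(3) a b by (simp add: kappa_mult_iota A.mult_car B.unit_left tau_pure_car)
qed

lemma mult_C_kappa_iota_assoc:
  assumes p: "p \<in> car AB" and b: "b \<in> car B" and a: "a \<in> car A"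
  shows "(p \<cdot> \<kappa> b) \<cdot> \<iota> a = p \<cdot> (\<kappa> b \<cdot> \<iota> a)"
  using p
proof (induction rule: AB.car_induct)
  case (pure x y)
  note cars = pure b a iota_car kappa_car mult_C_car
  have "(x \<diamondop> y) \<cdot> \<kappa> b \<cdot> \<iota> a = \<iota> x \<cdot> \<kappa> (mult B y b) \<cdot> \<iota> a"
    using pure b by (simp add: pure_mult_kappa iota_mult_kappa B.mult_car)
  also have "\<dots> = \<iota> x \<cdot> (\<kappa> y \<cdot> (\<kappa> b \<cdot> \<iota> a))"
    using cars by (simp add: iota_assoc B.mult_car kappa_mult_assoc_iota)
  also have "\<dots> = (\<iota> x \<cdot> \<kappa> y) \<cdot> (\<kappa> b \<cdot> \<iota> a)"
    using cars by (simp add: iota_assoc)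
  finally show ?case using pure by (simp add: iota_mult_kappa)
qed (simp_all add: mult_C_zero_left mult_C_add_left)

lemma kappa_iota_mult_C_assoc:
  assumes q: "q \<in> car AB" and b: "b \<in> car B" and a: "a \<in> car A"
  shows "(\<kappa> b \<cdot> \<iota> a) \<cdot> q = \<kappa> b \<cdot> (\<iota> a \<cdot> q)"
  using q
proof (induction rule: AB.car_induct)
  case (pure u v)
  note cars = pure b a iota_car kappa_car mult_C_car
  have "\<kappa> b \<cdot> (\<iota> a \<cdot> (u \<diamondop> v)) = \<kappa> b \<cdot> (\<iota> (mult A a u) \<cdot> \<kappa> v)"
    using pure a by (simp add: iota_mult_pure iota_mult_kappa A.mult_car)
  also have "\<dots> = ((\<kappa> b \<cdot> \<iota> a) \<cdot> \<iota> u) \<cdot> \<kappa> v"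
    using cars by (simp add: kappa_assoc[symmetric] A.mult_car kappa_assoc_iota_mult)
  also have "\<dots> = (\<kappa> b \<cdot> \<iota> a) \<cdot> (\<iota> u \<cdot> \<kappa> v)"
    using cars by (simp add: kappa_assoc)
  finally show ?case using pure by (simp add: iota_mult_kappa)
qed (simp_all add: mult_C_zero_right mult_C_add_right)

text \<open>Every pure tensor is \<open>\<iota> x \<cdot> \<kappa> y\<close>. Outer factors
  \<open>\<iota>\<close> on the left and \<open>\<kappa>\<close> on the right can be pulled off,
  which leaves the case of \<open>\<kappa> b\<close> on the left and \<open>\<iota> a\<close> on the
  right; there both consequences of the twisting axiom enter.\<close>

lemma mult_C_assoc:
  assumes s: "s \<in> car AB" and t: "t \<in> car AB" and u: "u \<in> car AB"
  shows "(s \<cdot> t) \<cdot> u = s \<cdot> (t \<cdot> u)"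
proof -
  have 1: "(\<kappa> b \<cdot> t) \<cdot> \<iota> a = \<kappa> b \<cdot> (t \<cdot> \<iota> a)" if b: "b \<in> car B" and a: "a \<in> car A" for a b
    using t
  proof (induction rule: AB.car_induct)
    case (pure x y)
    note cars = pure b a iota_car kappa_car mult_C_car
    have "\<kappa> b \<cdot> (x \<diamondop> y) \<cdot> \<iota> a = ((\<kappa> b \<cdot> \<iota> x) \<cdot> \<kappa> y) \<cdot> \<iota> a"
      using cars by (simp add: kappa_assoc iota_mult_kappa)
    also have "\<dots> = \<kappa> b \<cdot> (\<iota> x \<cdot> (\<kappa> y \<cdot> \<iota> a))"
      unfolding mult_C_kappa_iota_assoc[OF mult_C_car[OF kappa_car[OF b] iota_car[OF pure(1)]] pure(2) a]
      by (rule kappa_iota_mult_C_assoc[OF mult_C_car[OF kappa_car[OF pure(2)] iota_car[OF a]] b pure(1)])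
    also have "\<dots> = \<kappa> b \<cdot> ((\<iota> x \<cdot> \<kappa> y) \<cdot> \<iota> a)"
      using cars by (simp add: iota_assoc)
    finally show ?case using pure by (simp add: iota_mult_kappa)
  qed (simp_all add: mult_C_zero_left mult_C_zero_right mult_C_add_left mult_C_add_right)
  have 2: "(\<kappa> b \<cdot> t) \<cdot> u = \<kappa> b \<cdot> (t \<cdot> u)" if b: "b \<in> car B" for b
    using u
  proof (induction rule: AB.car_induct)
    case (pure x y)
    note cars = pure b t iota_car kappa_car mult_C_car
    have "\<kappa> b \<cdot> t \<cdot> (\<iota> x \<cdot> \<kappa> y) = ((\<kappa> b \<cdot> t) \<cdot> \<iota> x) \<cdot> \<kappa> y"
      using cars by (simp add: kappa_assoc)
    also have "\<dots> = \<kappa> b \<cdot> (t \<cdot> (\<iota> x \<cdot> \<kappa> y))"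
      using cars by (simp add: 1 kappa_assoc)
    finally show ?case using pure by (simp add: iota_mult_kappa)
  qed (simp_all add: mult_C_zero_right mult_C_add_right)
  show ?thesis using s
  proof (induction rule: AB.car_induct)
    case (pure x y)
    note cars = pure t u iota_car kappa_car mult_C_car
    have "\<iota> x \<cdot> \<kappa> y \<cdot> t \<cdot> u = \<iota> x \<cdot> ((\<kappa> y \<cdot> t) \<cdot> u)"
      using cars by (simp add: iota_assoc)
    also have "\<dots> = (\<iota> x \<cdot> \<kappa> y) \<cdot> (t \<cdot> u)"
      using cars by (simp add: 2 iota_assoc)
    finally show ?case using pure by (simp add: iota_mult_kappa)
  qed (simp_all add: mult_C_zero_left mult_C_add_left)
qed

section \<open>Grading, finiteness and unit of the twisted product\<close>

lemma gr_C [simp]: "gr C n = gr AB n" and scl_C [simp]: "scl C = fscale"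
  and unit_C [simp]: "unit C = unit A \<diamondop> unit B"
  by (simp_all add: twisted_tensor_def)

lemma car_C [simp]: "car C = car AB"
  by (simp add: car_def)

lemma gr_AB_zero: "0 \<in> gr AB n"
  and gr_AB_add: "s \<in> gr AB n \<Longrightarrow> t \<in> gr AB n \<Longrightarrow> s + t \<in> gr AB n"
  using V.subspace_0[OF subspace_gr_tensor] V.subspace_add[OF subspace_gr_tensor] by blast+

lemma gr_AB_induct [consumes 1, case_names zero add pure]:
  assumes "t \<in> gr AB n" "P 0"
    and "\<And>s t. \<lbrakk>s \<in> gr AB n; t \<in> gr AB n; P s; P t\<rbrakk> \<Longrightarrow> P (s + t)"
    and "\<And>k l a b. \<lbrakk>a \<in> gr A k; b \<in> gr B l; k + l = n\<rbrakk> \<Longrightarrow> P (a \<diamondop> b)"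
  shows "P t"
  using assms(1) A.gr_scale assms(2-4) by (rule gr_tensor_induct)

lemma two_sided_gr:
  assumes a: "a \<in> gr A k" and b: "b \<in> gr B l" and t: "t \<in> gr AB n"
  shows "two_sided a b t \<in> gr AB (k + n + l)"
  using t
proof (induction rule: gr_AB_induct)
  case zero
  show ?case
    using two_sided_zero[OF A.gr_car[OF a] B.gr_car[OF b]] gr_AB_zero by simp
next
  case (add s t)
  then show ?case
    using two_sided_add[OF A.gr_car[OF a] B.gr_car[OF b]] gr_AB_add by simp
next
  case (pure i j x y)
  have "mult A a x \<diamondop> mult B y b \<in> gr AB ((k + i) + (j + l))"
    by (intro pure_gr_tensor A.mult_comp B.mult_comp a b pure)
  moreover have "(k + i) + (j + l) = k + n + l" using pure(3) by simp
  moreover have "two_sided a b (x \<diamondop> y) = mult A a x \<diamondop> mult B y b"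
    by (intro two_sided_pure A.gr_car[OF a] B.gr_car[OF b] A.gr_car[OF pure(1)] B.gr_car[OF pure(2)])
  ultimately show ?case by (simp only:)
qed

lemma mult_C_gr:
  assumes s: "s \<in> gr AB m" and t: "t \<in> gr AB n"
  shows "s \<cdot> t \<in> gr AB (m + n)"
  using s
proof (induction rule: gr_AB_induct)
  case (pure k l a b)
  note ab = pure
  show ?case using t
  proof (induction rule: gr_AB_induct)
    case (pure i j a' b')
    have "\<tau> (pure B A b a') \<in> gr AB (l + i)" by (intro tau_gr pure_gr_tensor ab pure)
    then have "two_sided a b' (\<tau> (pure B A b a')) \<in> gr AB (k + (l + i) + j)"
      by (intro two_sided_gr ab pure)
    moreover have "k + (l + i) + j = m + n" using ab(3) pure(3) by simp
    ultimately show ?case using ab pure by (simp add: mult_pure A.gr_car B.gr_car)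
  qed (simp_all add: mult_C_zero_right mult_C_add_right gr_AB_zero gr_AB_add)
qed (simp_all add: mult_C_zero_left mult_C_add_left gr_AB_zero gr_AB_add)

text \<open>An explicit linear projection onto degree \<open>n\<close>, built from the projections
  of the two factors. It shows that the degrees of \<open>A \<otimes> B\<close> are independent,
  which must be known before \<open>hcomp\<close> can be used on the product.\<close>

definition degree_part :: "nat \<Rightarrow> ('k, 'a, 'b) tensor \<Rightarrow> ('k, 'a, 'b) tensor" where
  "degree_part n t = (\<Sum>k\<le>n. tensor_map A B A B (hcomp A k) (hcomp B (n - k)) t)"

lemma degree_part_linear: "linear_on S fscale fscale (degree_part n)"
proof -
  note L = linear_onD[OF AB.tensor_map_linear[OF A.hcomp_linear B.hcomp_linear]]
  show ?thesis unfolding linear_on_def degree_part_def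
    by (simp add: L(1)[OF UNIV_I UNIV_I] L(2)[OF UNIV_I] sum.distrib V.scale_sum_right)
qed

lemmas degree_part_add = linear_onD(1)[OF degree_part_linear UNIV_I UNIV_I]
  and degree_part_zero = linear_on_zero[OF vector_space_fscale vector_space_fscale degree_part_linear UNIV_I]

lemma degree_part_gr:
  assumes "t \<in> gr AB m"
  shows "degree_part n t = (if n = m then t else 0)"
  using assms
proof (induction rule: gr_AB_induct)
  case zero
  show ?case using degree_part_zero by simp
next
  case (add s t)
  then show ?case using degree_part_add by simp
next
  case (pure k l a b)
  have "tensor_map A B A B (hcomp A i) (hcomp B (n - i)) (a \<diamondop> b)
      = (if i = k then (if n - i = l then a \<diamondop> b else 0) else 0)" for i
    using pure by (simp add: AB.tensor_map_pure[OF A.hcomp_linear B.hcomp_linear] A.gr_car B.gr_car A.hcomp_homogeneous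
        B.hcomp_homogeneous pure_zero_left pure_zero_right)
  then have "degree_part n (a \<diamondop> b) = (if k \<le> n \<and> n - k = l then a \<diamondop> b else 0)"
    unfolding degree_part_def by simp
  then show ?case using pure(3) by auto
qed

lemma gr_AB_finite_span: "\<exists>S. finite S \<and> gr AB n = V.span S"
proof -
  obtain S where S: "\<And>k. finite (S k) \<and> gr A k = A.span (S k)" using A.locally_finite by metis
  obtain T where T: "\<And>k. finite (T k) \<and> gr B k = B.span (T k)" using B.locally_finite by metis
  let ?G = "\<Union>k\<le>n. (\<lambda>(a, b). a \<diamondop> b) ` (S k \<times> T (n - k))"
  have "gr AB n = V.span ?G"
  proof (rule antisym)
    show "V.span ?G \<subseteq> gr AB n"
    proof (rule V.span_minimal[OF _ subspace_gr_tensor], clarsimp)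
      fix k a b assume k: "k \<le> n" and ab: "a \<in> S k" "b \<in> T (n - k)"
      have "a \<in> gr A k" "b \<in> gr B (n - k)" using S[of k] T[of "n - k"] ab A.span_base B.span_base by auto
      then show "a \<diamondop> b \<in> gr AB n" using pure_gr_tensor[of a A k b B "n - k"] k by simp
    qed
    have "a \<diamondop> b \<in> V.span ?G" if a: "a \<in> gr A k" and b: "b \<in> gr B l" and kl: "k + l = n" for a b k l
    proof -
      have 1: "x \<diamondop> b \<in> V.span ?G" if x: "x \<in> S k" for x
      proof -
        have "b \<in> B.span (T l)" using b T by blast
        then show ?thesis
        proof (induction rule: B.span_induct_alt)
          case base
          show ?case using V.span_zero by (simp add: pure_zero_right)
        next
          case (step c y z)
          have "x \<diamondop> y \<in> V.span ?G"
            by (rule V.span_base) (use x step kl in \<open>auto intro!: bexI[of _ k]\<close>)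
          then show ?case using step by (simp add: pure_add_right pure_scale_right V.span_add V.span_scale)
        qed
      qed
      have "a \<in> A.span (S k)" using a S by blast
      then show ?thesis
      proof (induction rule: A.span_induct_alt)
        case base
        show ?case using V.span_zero by (simp add: pure_zero_left)
      next
        case (step c y z)
        then show ?case using 1 by (simp add: pure_add_left pure_scale_left V.span_add V.span_scale)
      qed
    qed
    then show "gr AB n \<subseteq> V.span ?G"
      by (intro subsetI) (erule gr_AB_induct, auto intro: V.span_zero V.span_add)
  qed
  moreover have "finite ?G" using S T by auto
  ultimately show ?thesis by blast
qed

text \<open>The map sending \<open>a \<otimes> b\<close> to the augmentation of \<open>b\<close>
  times \<open>a\<close> takes the unit to the unit of \<open>A\<close>.\<close>

lemma unit_C_nonzero: "unit A \<diamondop> unit B \<noteq> 0"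
proof
  assume "unit A \<diamondop> unit B = 0"
  let ?h = "\<lambda>a b. scl A (augmentation B b) a"
  have aug: "augmentation B (scl B c b) = c * augmentation B b" if "b \<in> car B" for c b
    using B.augmentation_mult[OF B.car_scale[OF B.unit_car] that, of c] that
    by (simp add: B.scale_mult_left B.unit_car B.unit_left B.augmentation_unit)
  have bil: "bilinear_on A B A ?h"
    by (auto simp: bilinear_on_def linear_on_def A.scale_right_distrib A.scale_left_distrib B.augmentation_add aug
        mult.commute)
  have "tensor_lift A B A ?h (unit A \<diamondop> unit B) = unit A"
    using AB.lift_pure[OF A.vector_space bil A.unit_car B.unit_car] B.augmentation_unit[of 1] by simp
  moreover have "tensor_lift A B A ?h 0 = 0"
    by (rule linear_on_zero[OF vector_space_fscale A.vector_space AB.lift_linear[OF A.vector_space bil] UNIV_I])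
  ultimately show False using \<open>unit A \<diamondop> unit B = 0\<close> A.unit_nonzero by simp
qed

lemma gr_0_C: "gr AB 0 = {fscale c (unit A \<diamondop> unit B) | c. True}"
proof (intro equalityI subsetI)
  fix t assume "t \<in> gr AB 0"
  then show "t \<in> {fscale c (unit A \<diamondop> unit B) | c. True}"
  proof (induction rule: gr_AB_induct)
    case zero
    show ?case using V.scale_zero_left[symmetric] by blast
  next
    case (add s t)
    then obtain c c' where "s = fscale c (unit A \<diamondop> unit B)" "t = fscale c' (unit A \<diamondop> unit B)" by blast
    then have "s + t = fscale (c + c') (unit A \<diamondop> unit B)" by (simp only: V.scale_left_distrib)
    then show ?case by blast
  next
    case (pure k l a b)
    then obtain c c' where "a = scl A c (unit A)" "b = scl B c' (unit B)"
      using A.connected B.connected by auto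
    then show ?case by (auto simp: pure_scale_left pure_scale_right)
  qed
next
  fix t assume "t \<in> {fscale c (unit A \<diamondop> unit B) | c. True}"
  then show "t \<in> gr AB 0"
    using pure_gr_tensor[OF A.unit_gr B.unit_gr] V.subspace_scale[OF subspace_gr_tensor] by auto
qed

lemma twisted_tensor_connected_graded_algebra: "connected_graded_algebra C"
proof (intro connected_graded_algebra.intro graded_space.intro connected_graded_algebra_axioms.intro;
    (unfold scl_C gr_C car_C unit_C)?)
  show "vector_space (fscale :: 'k \<Rightarrow> ('k, 'a, 'b) tensor \<Rightarrow> _)" by (rule vector_space_fscale)
  show "V.subspace (gr AB n)" for n by (rule subspace_gr_tensor)
  show "f n = 0" if f: "finite N" "\<And>m. m \<in> N \<Longrightarrow> f m \<in> gr AB m" "sum f N = 0" "n \<in> N"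
    for f :: "nat \<Rightarrow> ('k, 'a, 'b) tensor" and N n
  proof -
    have "degree_part n (sum f M) = (\<Sum>m\<in>M. degree_part n (f m))" if "finite M" for M
      using that degree_part_zero
      by (induction M rule: finite_induct) (simp_all add: degree_part_add)
    then have "degree_part n (sum f N) = (\<Sum>m\<in>N. degree_part n (f m))" using f(1) by blast
    also have "\<dots> = (\<Sum>m\<in>N. if n = m then f m else 0)"
      by (rule sum.cong) (simp_all add: degree_part_gr f(2))
    also have "\<dots> = f n" using f(1,4) by simp
    finally show ?thesis
      using degree_part_zero f(3) by metis
  qed
  show "unit A \<diamondop> unit B \<cdot> x = x" if "x \<in> car AB" for x
    using that by (induction rule: AB.car_induct)
      (simp_all add: mult_C_zero_right mult_C_add_right iota_mult_pure A.unit_car A.unit_left)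
  show "x \<cdot> (unit A \<diamondop> unit B) = x" if "x \<in> car AB" for x
    using that by (induction rule: AB.car_induct)
      (simp_all add: mult_C_zero_left mult_C_add_left pure_mult_kappa B.unit_car B.unit_right)
qed (rule mult_C_add_left mult_C_add_right mult_C_scale_left mult_C_scale_right mult_C_assoc mult_C_gr
    unit_C_nonzero gr_0_C gr_AB_finite_span | assumption)+

end

section \<open>Words in a free algebra\<close>

text \<open>The functional dual to a word: with \<open>R v s\<close> the coordinate of
  \<open>v\<close> at the basis vector \<open>s\<close>, coordinates are multiplied position by
  position, and lists of another length give 0.\<close>

primrec word_form :: "('b \<Rightarrow> 'b \<Rightarrow> 'k::field) \<Rightarrow> 'b list \<Rightarrow> 'b list \<Rightarrow> 'k" where
  "word_form R [] vs = (if vs = [] then 1 else 0)"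
| "word_form R (s # w) vs = (case vs of [] \<Rightarrow> 0 | v # vs' \<Rightarrow> R v s * word_form R w vs')"

text \<open>A fixed position enters through exactly one factor, or the value is 0 because the
  lengths differ.\<close>

lemma multilinear_form_word_form:
  assumes R: "\<And>s. Vector_Spaces.linear scale (*) (\<lambda>v. R v s)"
  shows "multilinear_form scale (word_form R w)"
proof -
  note R' = R[unfolded Vector_Spaces.linear_iff]
  have "Vector_Spaces.linear scale (*) (\<lambda>v. word_form R w (xs @ v # ys))" for xs ys
  proof (induction w arbitrary: xs)
    case Nil
    then show ?case using R' by (simp add: Vector_Spaces.linear_iff)
  next
    case (Cons s w)
    show ?case
    proof (cases xs)
      case Nil
      then show ?thesis using R' by (simp add: Vector_Spaces.linear_iff distrib_right mult.assoc)
    next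
      case (Cons x xs')
      then show ?thesis using Cons.IH[of xs'] by (simp add: Vector_Spaces.linear_iff distrib_left mult.left_commute)
    qed
  qed
  then show ?thesis unfolding multilinear_form_def by blast
qed

lemma word_form_delta:
  assumes "\<And>s t. \<lbrakk>s \<in> S; t \<in> S\<rbrakk> \<Longrightarrow> R s t = (if s = t then 1 else 0)" "v \<in> lists S" "w \<in> lists S"
  shows "word_form R w v = (if v = w then 1 else 0)"
  using assms(2,3)
proof (induction w arbitrary: v)
  case (Cons s w)
  then show ?case using assms(1) by (cases v) auto
qed simp

lemma pure_word_add: "pure_word scale (us @ (x + y) # vs) = pure_word scale (us @ x # vs) + pure_word scale (us @ y # vs)"
  and pure_word_scale: "pure_word scale (us @ scale c x # vs) = fscale c (pure_word scale (us @ x # vs))"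
  by (auto simp: pure_word_def multilinear_form_def fun_eq_iff Vector_Spaces.linear_iff fscale_def plus_fun_apply)

context connected_graded_algebra
begin

lemma foldr_mult_car: "vs \<in> lists (car A) \<Longrightarrow> foldr (mult A) vs (unit A) \<in> car A"
  by (induction vs) (auto simp: unit_car mult_car)

text \<open>An element is carried back to the tensor algebra by the inverse of the canonical
  bijection. There it is a functional on multilinear forms, and its coordinate at \<open>w\<close>
  is its value at the form dual to \<open>w\<close>.\<close>

lemma free_word_coordinates:
  fixes S :: "'a set"
  assumes free: "one_generated_free A" and S: "independent S" "span S = gr A 1"
  obtains cf :: "'a list \<Rightarrow> 'a \<Rightarrow> 'k" where
    "\<And>w x y. x \<in> car A \<Longrightarrow> y \<in> car A \<Longrightarrow> cf w (x + y) = cf w x + cf w y"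
    "\<And>w c x. x \<in> car A \<Longrightarrow> cf w (scl A c x) = c * cf w x"
    "\<And>v w. w \<in> lists S \<Longrightarrow> cf v (foldr (mult A) w (unit A)) = (if v = w then 1 else 0)"
    "\<And>x. x \<in> car A \<Longrightarrow> \<exists>F k. finite F \<and> F \<subseteq> lists S \<and> x = (\<Sum>w\<in>F. scl A (k w) (foldr (mult A) w (unit A)))"
proof -
  interpret T: vector_space "fscale :: 'k \<Rightarrow> (('a list \<Rightarrow> 'k) \<Rightarrow> 'k) \<Rightarrow> _" by (rule vector_space_fscale)
  let ?pw = "pure_word (scl A)"
  let ?T = "tensor_algebra (scl A) (gr A 1)"
  let ?word = "\<lambda>w. foldr (mult A) w (unit A)"
  obtain \<Phi> where \<Phi>: "linear_on ?T fscale (scl A) \<Phi>" "\<And>vs. vs \<in> lists (gr A 1) \<Longrightarrow> \<Phi> (?pw vs) = ?word vs"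
      "bij_betw \<Phi> ?T (car A)"
    using free unfolding one_generated_free_def by blast
  have S1: "S \<subseteq> gr A 1" using S(2) span_superset by blast
  have Tsub: "T.subspace ?T" unfolding tensor_algebra_def by (rule T.subspace_span)
  have inj: "inj_on \<Phi> ?T" and surj: "\<Phi> ` ?T = car A" using \<Phi>(3) by (auto simp: bij_betw_def)
  define \<Psi> where "\<Psi> = the_inv_into ?T \<Phi>"
  have \<Psi>T: "\<Psi> x \<in> ?T" and \<Phi>\<Psi>: "\<Phi> (\<Psi> x) = x" if "x \<in> car A" for x
    using that the_inv_into_into[OF inj, of x ?T] f_the_inv_into_f[OF inj, of x] surj by (auto simp: \<Psi>_def)
  have \<Psi>\<Phi>: "\<Psi> (\<Phi> t) = t" if "t \<in> ?T" for t
    unfolding \<Psi>_def by (rule the_inv_into_f_f[OF inj that])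
  \<comment> \<open>Multilinear forms live on the ambient space, so coordinates are taken in a basis
    of all of it that contains \<open>S\<close>.\<close>
  define E where "E = extend_basis S"
  have E: "independent E" "span E = UNIV" "S \<subseteq> E"
    using S(1) unfolding E_def by (auto simp: independent_extend_basis extend_basis_superset)
  define \<phi> where "\<phi> w = word_form (representation E) w" for w
  have \<phi>: "multilinear_form (scl A) (\<phi> w)" for w
    unfolding \<phi>_def by (rule multilinear_form_word_form, rule linear_representation[OF E(1,2)])
  have \<phi>_delta: "\<phi> w v = (if v = w then 1 else 0)" if "v \<in> lists S" "w \<in> lists S" for v w
    unfolding \<phi>_def
    by (rule word_form_delta[OF _ that]) (use E in \<open>auto simp: representation_basis subset_iff\<close>)
  \<comment> \<open>The value 0 on lists outside \<open>lists S\<close> makes the duality with words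
    hold for every \<open>v\<close>.\<close>
  define cf where "cf w x = (if w \<in> lists S then \<Psi> x (\<phi> w) else 0)" for w x
  show ?thesis
  proof (rule that[of cf])
    fix w x y assume x: "x \<in> car A" and y: "y \<in> car A"
    have "\<Psi> (x + y) = \<Psi> (\<Phi> (\<Psi> x + \<Psi> y))"
      using linear_onD(1)[OF \<Phi>(1) \<Psi>T[OF x] \<Psi>T[OF y]] by (simp add: \<Phi>\<Psi> x y)
    also have "\<dots> = \<Psi> x + \<Psi> y" by (rule \<Psi>\<Phi>[OF T.subspace_add[OF Tsub \<Psi>T[OF x] \<Psi>T[OF y]]])
    finally show "cf w (x + y) = cf w x + cf w y" by (simp add: cf_def plus_fun_apply)
  next
    fix w c x assume x: "x \<in> car A"
    have "\<Psi> (scl A c x) = \<Psi> (\<Phi> (fscale c (\<Psi> x)))"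
      using linear_onD(2)[OF \<Phi>(1) \<Psi>T[OF x]] by (simp add: \<Phi>\<Psi> x)
    also have "\<dots> = fscale c (\<Psi> x)" by (rule \<Psi>\<Phi>[OF T.subspace_scale[OF Tsub \<Psi>T[OF x]]])
    finally show "cf w (scl A c x) = c * cf w x" by (simp add: cf_def fscale_def)
  next
    fix v w assume w: "w \<in> lists S"
    then have w1: "w \<in> lists (gr A 1)" using S1 lists_mono by blast
    have "?pw w \<in> ?T" unfolding tensor_algebra_def by (rule T.span_base) (use w1 in blast)
    then have "\<Psi> (?word w) = ?pw w" using \<Psi>\<Phi> \<Phi>(2)[OF w1] by metis
    then show "cf v (?word w) = (if v = w then 1 else 0)"
      using w \<phi> \<phi>_delta[OF w] by (auto simp: cf_def pure_word_def)
  next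
    fix x assume x: "x \<in> car A"
    \<comment> \<open>Multilinearity expands one position at a time; \<open>us\<close> collects the
      entries already replaced by elements of \<open>S\<close>.\<close>
    have span_words: "?pw (us @ vs) \<in> T.span (?pw ` lists S)" if "us \<in> lists S" "vs \<in> lists (gr A 1)" for us vs
      using that
    proof (induction vs arbitrary: us)
      case Nil
      then show ?case by (auto intro: T.span_base)
    next
      case (Cons v vs)
      then have "v \<in> span S" using S(2) by auto
      then show ?case
      proof (induction rule: span_induct_alt)
        case base
        have "?pw (us @ scl A 0 0 # vs) = fscale 0 (?pw (us @ 0 # vs))" by (rule pure_word_scale)
        then show ?case using T.span_zero by simp
      next
        case (step c y z)
        have "?pw ((us @ [y]) @ vs) \<in> T.span (?pw ` lists S)"
          by (rule Cons.IH) (use Cons.prems step in auto)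
        then show ?case using step
          by (simp add: pure_word_add pure_word_scale T.span_add T.span_scale)
      qed
    qed
    have "\<Psi> x \<in> T.span (?pw ` lists S)"
    proof -
      have "?T \<subseteq> T.span (?pw ` lists S)"
        unfolding tensor_algebra_def
        by (rule T.span_minimal[OF _ T.subspace_span]) (use span_words[of "[]"] in auto)
      then show ?thesis using \<Psi>T[OF x] by blast
    qed
    \<comment> \<open>Membership in the tensor algebra is carried along because
      \<open>\<Phi>\<close> is known to be linear only there.\<close>
    then have "\<Psi> x \<in> ?T \<and> (\<exists>F k. finite F \<and> F \<subseteq> lists S \<and> \<Phi> (\<Psi> x) = (\<Sum>w\<in>F. scl A (k w) (?word w)))"
    proof (induction rule: T.span_induct_alt)
      case base
      have "\<Phi> 0 = 0" by (rule linear_on_zero[OF vector_space_fscale vector_space \<Phi>(1) T.subspace_0[OF Tsub]])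
      then show ?case using T.subspace_0[OF Tsub] by (intro conjI exI[of _ "{}"]) auto
    next
      case (step c y t)
      then obtain v F k where v: "v \<in> lists S" "y = ?pw v" and F: "finite F" "F \<subseteq> lists S"
          "\<Phi> t = (\<Sum>w\<in>F. scl A (k w) (?word w))" and t: "t \<in> ?T" by blast
      have v1: "v \<in> lists (gr A 1)" using v S1 lists_mono by blast
      have y: "y \<in> ?T" unfolding tensor_algebra_def v(2) by (rule T.span_base) (use v1 in blast)
      note cy = T.subspace_scale[OF Tsub y, of c]
      have "\<Phi> (fscale c y + t) = scl A c (?word v) + (\<Sum>w\<in>F. scl A (k w) (?word w))"
        using linear_onD(1)[OF \<Phi>(1) cy t] linear_onD(2)[OF \<Phi>(1) y] \<Phi>(2)[OF v1] F(3) v(2) by simp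
      also have "(\<Sum>w\<in>F. scl A (k w) (?word w)) = (\<Sum>w\<in>insert v F. scl A (if w \<in> F then k w else 0) (?word w))"
        by (rule sum.mono_neutral_cong_left) (use F(1) in auto)
      also have "scl A c (?word v) = (\<Sum>w\<in>insert v F. scl A (if w = v then c else 0) (?word w))"
      proof -
        have "(\<Sum>w\<in>insert v F. scl A (if w = v then c else 0) (?word w))
            = (\<Sum>w\<in>insert v F. if w = v then scl A c (?word v) else 0)"
          by (rule sum.cong) auto
        then show ?thesis using F(1) by simp
      qed
      finally have "\<Phi> (fscale c y + t)
          = (\<Sum>w\<in>insert v F. scl A ((if w = v then c else 0) + (if w \<in> F then k w else 0)) (?word w))"
        by (simp only: sum.distrib scale_left_distrib)
      then show ?case using T.subspace_add[OF Tsub cy t] F(1,2) v(1)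
        by (intro conjI exI[of _ "insert v F"] exI[of _ "\<lambda>w. (if w = v then c else 0) + (if w \<in> F then k w else 0)"]) auto
    qed
    then show "\<exists>F k. finite F \<and> F \<subseteq> lists S \<and> x = (\<Sum>w\<in>F. scl A (k w) (?word w))"
      unfolding \<Phi>\<Psi>[OF x] by blast
  qed
qed

lemma foldr_mult_snoc:
  assumes "v \<in> lists (car A)" "t \<in> car A"
  shows "foldr (mult A) (v @ [t]) (unit A) = mult A (foldr (mult A) v (unit A)) t"
  using assms(1)
  by (induction v) (simp_all add: assms(2) unit_left unit_right mult_assoc foldr_mult_car)

lemma koszul_generated:
  assumes "koszul A"
  shows "gr A (Suc n) \<subseteq> span {mult A u v | u v. u \<in> gr A n \<and> v \<in> gr A 1}"
proof
  fix a assume a: "a \<in> gr A (Suc n)"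
  obtain X :: "nat \<Rightarrow> nat set" and d e where res: "linear_free_resolution A X d e"
    using assms unfolding koszul_def by blast
  obtain I :: "nat set" and u v where I: "\<forall>i\<in>I. u i \<in> gr A n \<and> v i \<in> gr A 1" "a = (\<Sum>i\<in>I. mult A (u i) (v i))"
    using koszul_generated_degree_1[OF res a] by blast
  show "a \<in> span {mult A u v | u v. u \<in> gr A n \<and> v \<in> gr A 1}"
    unfolding I(2) by (rule span_sum, rule span_base) (use I(1) in blast)
qed

end

section \<open>From the twisted product to an extension by words\<close>

lemma (in vector_space) independent_Un_direct:
  assumes S: "independent S" and T: "independent T" and ST: "span S \<inter> span T = {0}"
  shows "independent (S \<union> T)" and "S \<inter> T = {}"
proof -
  show disj: "S \<inter> T = {}"
  proof (rule equals0I)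
    fix x assume x: "x \<in> S \<inter> T"
    then have "x \<in> span S \<inter> span T" using span_base by blast
    then show False using ST x S dependent_zero by auto
  qed
  show "independent (S \<union> T)"
  proof
    assume "dependent (S \<union> T)"
    then obtain F u where F: "finite F" "F \<subseteq> S \<union> T" and sum0: "(\<Sum>v\<in>F. scale (u v) v) = 0" and nz: "\<exists>v\<in>F. u v \<noteq> 0"
      unfolding dependent_explicit by blast
    let ?s = "\<Sum>v\<in>F \<inter> S. scale (u v) v" and ?t = "\<Sum>v\<in>F - S. scale (u v) v"
    have st: "?s + ?t = 0" using sum.Int_Diff[OF F(1), of "\<lambda>v. scale (u v) v" S] sum0 by simp
    have "?s \<in> span S" by (intro span_sum span_scale span_base) auto
    moreover have t: "?t \<in> span T" by (intro span_sum span_scale span_base) (use F in auto)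
    \<comment> \<open>The two halves of a linear relation are opposite, so each lies in both
      spans.\<close>
    moreover have "?s = - ?t" using st by (simp add: eq_neg_iff_add_eq_0)
    ultimately have "?s \<in> span S \<inter> span T" using span_neg by simp
    then have s0: "?s = 0" using ST by blast
    then have t0: "?t = 0" using st by simp
    have "u v = 0" if "v \<in> F" for v
    proof (cases "v \<in> S")
      case True
      then show ?thesis using independentD[OF S, of "F \<inter> S" u v] F(1) s0 that by auto
    next
      case False
      then show ?thesis using independentD[OF T, of "F - S" u v] F t0 that by auto
    qed
    then show False using nz by blast
  qed
qed

context twisted_product
begin

text \<open>Freeness of \<open>B\<close> makes the words in a basis of \<open>B_1\<close> a basis of
  \<open>B\<close>, hence a left \<open>A\<close>-basis of \<open>C\<close>. With the letters taken
  from bases of the two summands, the inclusions in \<open>separable\<close> turn into the two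
  support conditions of \<open>free_word_extension\<close>.\<close>

theorem koszul_twisted_tensor:
  assumes kos: "koszul A" and free: "one_generated_free B" and sep: "separable A B \<tau>"
  shows "koszul C"
proof -
  obtain B' B'' where B': "B.subspace B'" "B.subspace B''" "sum_sub B' B'' = gr B 1" "B' \<inter> B'' = {0}"
    and tau': "\<tau> ` tensor_sub B A B' (gr A 1) \<subseteq>
        sum_sub (tensor_sub A B (gr A 2) (gr B 0)) (tensor_sub A B (gr A 1) B')"
    and tau'': "\<tau> ` tensor_sub B A B'' (gr A 1) \<subseteq>
        sum_sub (tensor_sub A B (gr A 1) B'') (tensor_sub A B (gr A 0) (mu B ` tensor_sub B B (gr B 1) B''))"
    using sep unfolding separable_def by (elim exE conjE) (rule that)
  obtain S' where S': "S' \<subseteq> B'" "B.independent S'" "B' \<subseteq> B.span S'"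
    using B.maximal_independent_subset by blast
  obtain S'' where S'': "S'' \<subseteq> B''" "B.independent S''" "B'' \<subseteq> B.span S''"
    using B.maximal_independent_subset by blast
  have span': "B.span S' = B'" and span'': "B.span S'' = B''"
    using B.span_minimal[OF S'(1) B'(1)] B.span_minimal[OF S''(1) B'(2)] S'(3) S''(3) by blast+
  have ST: "B.span S' \<inter> B.span S'' = {0}" unfolding span' span'' by (rule B'(4))
  note ind = B.independent_Un_direct(1)[OF S'(2) S''(2) ST]
  note disj = B.independent_Un_direct(2)[OF S'(2) S''(2) ST]
  let ?S = "S' \<union> S''"
  have span: "B.span ?S = gr B 1"
    unfolding B.span_Un span' span'' B'(3)[symmetric] sum_sub_def by blast
  have S1: "?S \<subseteq> gr B 1" using B.span_superset span by blast
  have Sc: "?S \<subseteq> car B" using S1 B.gr_car by blast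
  have B1: "B' \<subseteq> gr B 1" "B'' \<subseteq> gr B 1"
    using span span' span'' B.span_mono[of S' ?S] B.span_mono[of S'' ?S] by auto
  let ?word = "\<lambda>w. foldr (mult B) w (unit B)"
  have wc: "?word w \<in> car B" if "w \<in> lists ?S" for w
    by (rule B.foldr_mult_car) (use that lists_mono[OF Sc] in blast)
  obtain cf :: "'b list \<Rightarrow> 'b \<Rightarrow> 'k" where
    cf_add: "\<And>w x y. x \<in> car B \<Longrightarrow> y \<in> car B \<Longrightarrow> cf w (x + y) = cf w x + cf w y" and
    cf_scale: "\<And>w c x. x \<in> car B \<Longrightarrow> cf w (scl B c x) = c * cf w x" and
    cf_word: "\<And>v w. w \<in> lists ?S \<Longrightarrow> cf v (?word w) = (if v = w then 1 else 0)" and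
    cf_expand: "\<And>x. x \<in> car B \<Longrightarrow> \<exists>F k. finite F \<and> F \<subseteq> lists ?S \<and> x = (\<Sum>w\<in>F. scl B (k w) (?word w))"
    using B.free_word_coordinates[OF free ind span] by blast
  have cf_zero: "cf w 0 = 0" for w
    using cf_scale[of 0 w 0] B.car_zero by simp
  have cf_sum: "cf w (sum g F) = (\<Sum>i\<in>F. cf w (g i))" if "\<And>i. i \<in> F \<Longrightarrow> g i \<in> car B" for w g and F :: "'b list set"
    using that by (induction F rule: infinite_finite_induct) (auto simp: cf_zero cf_add B.car_sum)
  \<comment> \<open>A coordinate vanishing on all \<open>h q\<close> vanishes on \<open>h\<close> of
    the span. The map \<open>h\<close> is the identity in one use and left multiplication by a fixed
    element in the other.\<close>
  have cf_span: "\<exists>q\<in>Q. cf w (h q) \<noteq> 0"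
    if b: "b \<in> B.span Q" and Q: "Q \<subseteq> car B" and nz: "cf w (h b) \<noteq> 0"
      and h: "linear_on (car B) (scl B) (scl B) h" "h ` car B \<subseteq> car B" for b Q w h
  proof (rule ccontr)
    assume no: "\<not> (\<exists>q\<in>Q. cf w (h q) \<noteq> 0)"
    have h0: "h 0 = 0" by (rule linear_on_zero[OF B.vector_space B.vector_space h(1) B.car_zero])
    have "b \<in> car B \<and> cf w (h b) = 0" using b
    proof (induction rule: B.span_induct_alt)
      case base
      show ?case using h0 cf_zero B.car_zero by simp
    next
      case (step c x y)
      have x: "x \<in> car B" "h x \<in> car B" and y: "h y \<in> car B" using step Q h(2) by blast+
      have "h (scl B c x + y) = scl B c (h x) + h y"
        using linear_onD[OF h(1)] x step B.car_scale by simp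
      then show ?case using x y step no by (simp add: B.car_add B.car_scale cf_add cf_scale)
    qed
    then show False using nz by blast
  qed

  \<comment> \<open>The coordinate functional \<open>cf w\<close> on \<open>B\<close>, tensored with
    the identity of \<open>A\<close>.\<close>
  define coef where "coef w = tensor_lift A B A (\<lambda>a b. scl A (cf w b) a)" for w
  have bil: "bilinear_on A B A (\<lambda>a b. scl A (cf w b) a)" for w
    by (auto simp: bilinear_on_def linear_on_def A.scale_right_distrib A.scale_left_distrib cf_add cf_scale mult.commute)
  have coef_linear: "linear_on T fscale (scl A) (coef w)" for T w
    unfolding coef_def by (rule AB.lift_linear[OF A.vector_space bil])
  note coef_add = linear_onD(1)[OF coef_linear UNIV_I UNIV_I]
  have coef_zero: "coef w 0 = 0" for w
    by (rule linear_on_zero[OF vector_space_fscale A.vector_space coef_linear UNIV_I])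
  have coef_pure: "coef w (a \<diamondop> b) = scl A (cf w b) a" if "a \<in> car A" "b \<in> car B" for w a b
    unfolding coef_def by (rule AB.lift_pure[OF A.vector_space bil that])
  have coef_car: "coef w t \<in> car A" if "t \<in> car AB" for w t
    using that by (induction rule: AB.car_induct)
      (simp_all add: coef_zero coef_add coef_pure A.car_zero A.car_add A.car_scale)
  have coef_sum: "coef w (sum g F) = (\<Sum>i\<in>F. coef w (g i))" for w g and F :: "'b list set"
    by (induction F rule: infinite_finite_induct) (simp_all add: coef_zero coef_add)
  have expand: "\<exists>F a. finite F \<and> F \<subseteq> lists ?S \<and> (\<forall>w. a w \<in> car A) \<and> t = (\<Sum>w\<in>F. a w \<diamondop> ?word w)"
    if "t \<in> car AB" for t
    using that
  proof (induction rule: AB.car_induct)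
    case zero
    show ?case by (intro exI[of _ "{}"] exI[of _ "\<lambda>_. 0"]) (simp add: A.car_zero)
  next
    case (add s t)
    then obtain F a G b where F: "finite F" "F \<subseteq> lists ?S" "\<forall>w. a w \<in> car A" "s = (\<Sum>w\<in>F. a w \<diamondop> ?word w)"
      and G: "finite G" "G \<subseteq> lists ?S" "\<forall>w. b w \<in> car A" "t = (\<Sum>w\<in>G. b w \<diamondop> ?word w)" by blast
    let ?a = "\<lambda>w. if w \<in> F then a w else 0" and ?b = "\<lambda>w. if w \<in> G then b w else 0"
    have "s = (\<Sum>w\<in>F \<union> G. ?a w \<diamondop> ?word w)"
      unfolding F(4) by (rule sum.mono_neutral_cong_left) (use F(1) G(1) in \<open>auto simp: pure_zero_left\<close>)
    moreover have "t = (\<Sum>w\<in>F \<union> G. ?b w \<diamondop> ?word w)"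
      unfolding G(4) by (rule sum.mono_neutral_cong_left) (use F(1) G(1) in \<open>auto simp: pure_zero_left\<close>)
    ultimately have "s + t = (\<Sum>w\<in>F \<union> G. (?a w + ?b w) \<diamondop> ?word w)"
      by (simp only: pure_add_left sum.distrib)
    then show ?case using F G A.car_add A.car_zero
      by (intro exI[of _ "F \<union> G"] exI[of _ "\<lambda>w. ?a w + ?b w"]) auto
  next
    case (pure a b)
    obtain F k where F: "finite F" "F \<subseteq> lists ?S" "b = (\<Sum>w\<in>F. scl B (k w) (?word w))"
      using cf_expand[OF pure(2)] by blast
    have "a \<diamondop> b = (\<Sum>w\<in>F. scl A (k w) a \<diamondop> ?word w)"
      unfolding F(3) pure_sum_right[OF F(1)] pure_scale_left pure_scale_right ..
    then show ?case using F A.car_scale[OF pure(1)]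
      by (intro exI[of _ F] exI[of _ "\<lambda>w. scl A (k w) a"]) auto
  qed
  have supp: "finite {w. coef w t \<noteq> 0} \<and> {w. coef w t \<noteq> 0} \<subseteq> lists ?S \<and>
      t = (\<Sum>w\<in>{w. coef w t \<noteq> 0}. coef w t \<diamondop> ?word w)" if t: "t \<in> car AB" for t
  proof -
    obtain F a where F: "finite F" "F \<subseteq> lists ?S" "\<forall>w. a w \<in> car A" "t = (\<Sum>w\<in>F. a w \<diamondop> ?word w)"
      using expand[OF t] by blast
    have "coef v (a w \<diamondop> ?word w) = (if v = w then a w else 0)" if "w \<in> F" for v w
    proof -
      have w: "w \<in> lists ?S" using that F(2) by blast
      show ?thesis using F(3) by (simp add: coef_pure wc[OF w] cf_word[OF w])
    qed
    then have "coef v t = (\<Sum>w\<in>F. if v = w then a w else 0)" for v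
      unfolding F(4) coef_sum by (rule sum.cong[OF refl])
    then have c: "coef v t = (if v \<in> F then a v else 0)" for v using F(1) by simp
    then have sub: "{w. coef w t \<noteq> 0} \<subseteq> F" by (auto split: if_splits)
    have "(\<Sum>w\<in>F. a w \<diamondop> ?word w) = (\<Sum>w\<in>{w. coef w t \<noteq> 0}. coef w t \<diamondop> ?word w)"
      by (rule sum.mono_neutral_cong_right[OF F(1) sub]) (auto simp: c pure_zero_left)
    then show ?thesis using sub F(1,2,4) finite_subset by (metis subset_trans)
  qed
  have coef_tensor_sub: "\<exists>b\<in>Q. cf w b \<noteq> 0"
    if t: "t \<in> tensor_sub A B (gr A n) Q" and Q: "Q \<subseteq> car B" and nz: "coef w t \<noteq> 0" for t n Q w
  proof (rule ccontr)
    assume no: "\<not> (\<exists>b\<in>Q. cf w b \<noteq> 0)"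
    have "coef w t = 0"
    proof (rule tensor_sub_induct[OF t])
      show "coef w (a \<diamondop> b) = 0" if "a \<in> gr A n" "b \<in> Q" for a b
        using no that Q by (simp add: coef_pure A.gr_car subset_iff)
    qed (simp_all add: A.gr_scale coef_zero coef_add)
    then show False using nz by blast
  qed
  have id_lin: "linear_on (car B) (scl B) (scl B) (\<lambda>x. x)" by (simp add: linear_on_def)
  have word': "w \<in> {[t] | t. t \<in> Q}" if b: "b \<in> B.span Q" and Q: "Q \<subseteq> ?S" and nz: "cf w b \<noteq> 0" for b Q w
  proof -
    obtain q where q: "q \<in> Q" "cf w q \<noteq> 0"
      using cf_span[OF b _ nz id_lin] Q Sc by auto
    have "?word [q] = q" using q Q Sc B.unit_right by auto
    then show ?thesis using cf_word[of "[q]" w] q Q by (auto split: if_splits)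
  qed
  have sub: "tensor_sub B B (gr B 1) B'' \<subseteq> car (B \<otimes> B)"
  proof
    fix u assume u: "u \<in> tensor_sub B B (gr B 1) B''"
    interpret U: vector_space "fscale :: 'k \<Rightarrow> ('k, 'b, 'b) tensor \<Rightarrow> _" by (rule vector_space_fscale)
    have c: "U.subspace (car (B \<otimes> B))" unfolding car_def scl_tensor by (rule U.subspace_span)
    show "u \<in> car (B \<otimes> B)"
    proof (rule tensor_sub_induct[OF u])
      show "pure B B x y \<in> car (B \<otimes> B)" if "x \<in> gr B 1" "y \<in> B''" for x y
        using BB.car_pure[OF B.gr_car[OF that(1)] B.gr_car] that(2) B1(2) by blast
    qed (use B.gr_scale U.subspace_0[OF c] U.subspace_add[OF c] in blast)+
  qed
  \<comment> \<open>Expanding the left factor in words and the right factor in \<open>S''\<close>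
    writes each product of \<open>B_1\<close> and \<open>B''\<close> as a combination of words
    ending in \<open>S''\<close>.\<close>
  have word'': "\<exists>v. \<exists>t\<in>S''. w = v @ [t]"
    if b: "b \<in> mu B ` tensor_sub B B (gr B 1) B''" and nz: "cf w b \<noteq> 0" for b w
  proof (rule ccontr)
    assume no: "\<not> (\<exists>v. \<exists>t\<in>S''. w = v @ [t])"
    obtain u where u: "b = mu B u" "u \<in> tensor_sub B B (gr B 1) B''" using b by blast
    have prod: "cf w (mult B x y) = 0" if x: "x \<in> gr B 1" and y: "y \<in> B''" for x y
    proof (rule ccontr)
      assume nz: "cf w (mult B x y) \<noteq> 0"
      have xc: "x \<in> car B" using B.gr_car[OF x] .
      obtain t where t: "t \<in> S''" "cf w (mult B x t) \<noteq> 0"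
        using cf_span[of y S'' w "mult B x", OF _ _ nz B.mult_linear(1)[OF xc]] y span'' Sc B.mult_car[OF xc] by auto
      have tc: "t \<in> car B" using t Sc by blast
      obtain F k where F: "finite F" "F \<subseteq> lists ?S" "x = (\<Sum>w\<in>F. scl B (k w) (?word w))"
        using cf_expand[OF xc] by blast
      have wF: "?word v \<in> car B" if "v \<in> F" for v using wc F(2) that by blast
      have "mult B x t = (\<Sum>v\<in>F. mult B (scl B (k v) (?word v)) t)"
        unfolding F(3) by (rule B.mult_sum_left[OF B.car_scale[OF wF] tc])
      also have "\<dots> = (\<Sum>v\<in>F. scl B (k v) (?word (v @ [t])))"
      proof (rule sum.cong[OF refl])
        fix v assume v: "v \<in> F"
        have vl: "v \<in> lists (car B)" using v F(2) lists_mono[OF Sc] by blast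
        show "mult B (scl B (k v) (?word v)) t = scl B (k v) (?word (v @ [t]))"
          unfolding B.foldr_mult_snoc[OF vl tc] by (rule B.scale_mult_left[OF wF[OF v] tc])
      qed
      finally have eq: "mult B x t = (\<Sum>v\<in>F. scl B (k v) (?word (v @ [t])))" .
      have vt: "v @ [t] \<in> lists ?S" if "v \<in> F" for v using that F(2) t(1) by auto
      have "cf w (mult B x t) = (\<Sum>v\<in>F. cf w (scl B (k v) (?word (v @ [t]))))"
        unfolding eq by (rule cf_sum, rule B.car_scale, rule wc[OF vt])
      also have "\<dots> = 0"
      proof (rule sum.neutral, rule ballI)
        fix v assume v: "v \<in> F"
        show "cf w (scl B (k v) (?word (v @ [t]))) = 0"
          unfolding cf_scale[OF wc[OF vt[OF v]]] cf_word[OF vt[OF v]] using no t(1) by auto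
      qed
      finally show False using t(2) by blast
    qed
    have "cf w (mu B u) = 0"
    proof (rule tensor_sub_induct[OF u(2)])
      show "cf w (mu B 0) = 0"
        by (simp only: B.mu_zero cf_zero)
      show "cf w (mu B (s + t)) = 0"
        if "s \<in> tensor_sub B B (gr B 1) B''" "t \<in> tensor_sub B B (gr B 1) B''" "cf w (mu B s) = 0" "cf w (mu B t) = 0" for s t
      proof -
        have "s \<in> car (B \<otimes> B)" "t \<in> car (B \<otimes> B)" using that(1,2) sub by blast+
        then show ?thesis
          using cf_add[OF B.mu_car B.mu_car] that(3,4) by (simp add: B.mu_add)
      qed
      show "cf w (mu B (pure B B x y)) = 0" if "x \<in> gr B 1" "y \<in> B''" for x y
        using prod[OF that] B.mu_pure[of x y] B.gr_car that B1(2) by auto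
    qed (rule B.gr_scale)
    then show False using nz u(1) by blast
  qed
  have word0: "w = []" if b: "b \<in> gr B 0" and nz: "cf w b \<noteq> 0" for b w
  proof -
    obtain c where "b = scl B c (?word [])" using b B.connected by auto
    then have "cf w b = c * cf w (?word [])" using cf_scale[OF B.unit_car] by simp
    then show ?thesis using nz cf_word[of "[]" w] by (auto split: if_splits)
  qed

  interpret C: connected_graded_algebra C by (rule twisted_tensor_connected_graded_algebra)
  have word_C: "foldr (\<lambda>s. mult C (\<kappa> s)) w (unit C) = \<kappa> (?word w)" if "w \<in> lists ?S" for w
    using that
  proof (induction w)
    case (Cons s w)
    then have "s \<in> car B" "w \<in> lists ?S" using Sc by auto
    then show ?case using Cons wc by (simp add: pure_mult_kappa A.unit_car)
  qed simp
  have "free_word_extension A C (\<lambda>a. \<iota> a) S' S'' (\<lambda>b. \<kappa> b) coef"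
  proof (intro free_word_extension.intro free_word_extension_axioms.intro)
    show "connected_graded_algebra A" "connected_graded_algebra C" by unfold_locales
    show "\<iota> (x + y) = \<iota> x + \<iota> y" for x y by (rule pure_add_left)
    show "\<iota> (scl A k x) = scl C k (\<iota> x)" for k x by (simp add: pure_scale_left)
    show "\<iota> (mult A x y) = \<iota> x \<cdot> \<iota> y" if "x \<in> car A" "y \<in> car A" for x y
      using that by (simp add: iota_mult_pure B.unit_car)
    show "\<iota> (unit A) = unit C" by simp
    show "\<iota> x \<in> gr C n" if "x \<in> gr A n" for x n
      using pure_gr_tensor[OF that B.unit_gr] by simp
    show "S' \<inter> S'' = {}" by (rule disj)
    show "\<kappa> s \<in> gr C 1" if "s \<in> ?S" for s
      using pure_gr_tensor[OF A.unit_gr, of s B 1] that S1 by auto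
    show "coef w (c + c') = coef w c + coef w c'" for c c' w by (rule coef_add)
    show "coef w c \<in> car A" if "c \<in> car C" for c w using coef_car that by simp
    show "coef w (\<iota> a \<cdot> c) = mult A a (coef w c)" if a: "a \<in> car A" and c: "c \<in> car C" for a c w
    proof -
      have "c \<in> car AB" using c by simp
      then show ?thesis
        by (induction rule: AB.car_induct)
          (simp_all add: mult_C_zero_right mult_C_add_right coef_zero coef_add coef_car A.mult_zero a
            A.distrib_left iota_mult_pure coef_pure A.mult_car A.scale_mult_right)
    qed
    show "coef v (foldr (\<lambda>s. mult C (\<kappa> s)) w (unit C)) = (if v = w then unit A else 0)"
      if w: "w \<in> lists ?S" for v w
      unfolding word_C[OF w] by (simp add: coef_pure[OF A.unit_car wc[OF w]] cf_word[OF w])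
    show "finite {w. coef w c \<noteq> 0}" if "c \<in> car C" for c using supp that by simp
    show "w \<in> lists ?S" if "c \<in> car C" "coef w c \<noteq> 0" for c w using supp[of c] that by auto
    show "c = (\<Sum>w\<in>{w. coef w c \<noteq> 0}. \<iota> (coef w c) \<cdot> foldr (\<lambda>s. mult C (\<kappa> s)) w (unit C))"
      if "c \<in> car C" for c
    proof -
      have c: "c \<in> car AB" using that by simp
      note sp = supp[OF c]
      have "(\<Sum>w\<in>{w. coef w c \<noteq> 0}. \<iota> (coef w c) \<cdot> foldr (\<lambda>s. mult C (\<kappa> s)) w (unit C))
          = (\<Sum>w\<in>{w. coef w c \<noteq> 0}. coef w c \<diamondop> ?word w)"
      proof (rule sum.cong[OF refl])
        fix w assume "w \<in> {w. coef w c \<noteq> 0}"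
        then have w: "w \<in> lists ?S" using sp by blast
        show "\<iota> (coef w c) \<cdot> foldr (\<lambda>s. mult C (\<kappa> s)) w (unit C) = coef w c \<diamondop> ?word w"
          unfolding word_C[OF w] by (rule iota_mult_kappa[OF coef_car[OF c] wc[OF w]])
      qed
      then show ?thesis using sp by simp
    qed
    show "gr A (Suc n) \<subseteq> A.span {mult A u v |u v. u \<in> gr A n \<and> v \<in> gr A 1}" for n
      by (rule A.koszul_generated[OF kos])
    show "w = [] \<or> (\<exists>t\<in>S'. w = [t])"
      if s: "s \<in> S'" and a: "a \<in> gr A 1" and nz: "coef w (\<kappa> s \<cdot> \<iota> a) \<noteq> 0" for s a w
    proof -
      have sc: "s \<in> car B" using s Sc by blast
      have "pure B A s a \<in> tensor_sub B A B' (gr A 1)" using pure_tensor_sub s S'(1) a by blast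
      then obtain x y where xy: "\<tau> (pure B A s a) = x + y" "x \<in> tensor_sub A B (gr A 2) (gr B 0)"
          "y \<in> tensor_sub A B (gr A 1) B'" using tau' unfolding sum_sub_def by blast
      \<comment> \<open>The part in \<open>A_2 \<otimes> B_0\<close> contributes only the empty
        word, the part in \<open>A_1 \<otimes> B'\<close> single letters from
        \<open>S'\<close>.\<close>
      have "coef w x \<noteq> 0 \<or> coef w y \<noteq> 0"
        using nz coef_add[of w x y] unfolding kappa_mult_iota[OF sc A.gr_car[OF a]] xy(1) by auto
      then show ?thesis
      proof
        assume "coef w x \<noteq> 0"
        then show ?thesis using coef_tensor_sub[OF xy(2)] word0 B.gr_car by blast
      next
        assume "coef w y \<noteq> 0"
        then obtain b where "b \<in> B'" "cf w b \<noteq> 0" using coef_tensor_sub[OF xy(3)] B1(1) B.gr_car by blast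
        then show ?thesis using word'[of b S' w] span' by blast
      qed
    qed
    show "\<exists>v. \<exists>t\<in>S''. w = v @ [t]"
      if s: "s \<in> S''" and a: "a \<in> gr A 1" and nz: "coef w (\<kappa> s \<cdot> \<iota> a) \<noteq> 0" for s a w
    proof -
      have sc: "s \<in> car B" using s Sc by blast
      have "pure B A s a \<in> tensor_sub B A B'' (gr A 1)" using pure_tensor_sub s S''(1) a by blast
      then obtain x y where xy: "\<tau> (pure B A s a) = x + y" "x \<in> tensor_sub A B (gr A 1) B''"
          "y \<in> tensor_sub A B (gr A 0) (mu B ` tensor_sub B B (gr B 1) B'')" using tau'' unfolding sum_sub_def by blast
      have mc: "mu B ` tensor_sub B B (gr B 1) B'' \<subseteq> car B"
        using sub B.mu_car by blast
      \<comment> \<open>The part in \<open>A_1 \<otimes> B''\<close> contributes single letters from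
        \<open>S''\<close>, the part with products from \<open>B_1\<close> and \<open>B''\<close>
        words ending in such a letter.\<close>
      have "coef w x \<noteq> 0 \<or> coef w y \<noteq> 0"
        using nz coef_add[of w x y] unfolding kappa_mult_iota[OF sc A.gr_car[OF a]] xy(1) by auto
      then show ?thesis
      proof
        assume "coef w x \<noteq> 0"
        then obtain b where "b \<in> B''" "cf w b \<noteq> 0" using coef_tensor_sub[OF xy(2)] B1(2) B.gr_car by blast
        then show ?thesis using word'[of b S'' w] span'' by (auto intro: exI[of _ "[]"])
      next
        assume "coef w y \<noteq> 0"
        then show ?thesis using coef_tensor_sub[OF xy(3) mc] word'' by blast
      qed
    qed
  qed
  then show ?thesis using free_word_extension.koszul_if_koszul kos by blast
qed

end

theorem corollary1p4:
  fixes A :: "('k::field, 'a::ab_group_add) galg"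
    and B :: "('k, 'b::ab_group_add) galg"
    and \<tau> :: "('k, 'b, 'a) tensor \<Rightarrow> ('k, 'a, 'b) tensor"
  assumes "koszul A"
    and "connected_graded_algebra B" and "one_generated_free B"
    and "graded_twisting_map A B \<tau>"
    and "separable A B \<tau>"
    and "\<And>t. t \<in> tensor_sub B (A \<otimes> A) (gr B 1) (quadratic_relations A) \<Longrightarrow> obstruction A B \<tau> t = 0"
  shows "koszul (twisted_tensor A B \<tau>)"
proof -
  have "twisted_product A B \<tau>"
    using assms(1,2,4) unfolding koszul_def
    by (intro twisted_product.intro twisted_product_axioms.intro) blast+
  then show ?thesis using assms(1,3,5) by (rule twisted_product.koszul_twisted_tensor)
qed

end
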